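(* Let $V\cong\mathbb{R}^n$, let $\omega$ be a simplicial $(n-1)$-cycle on a finite vertex set $M$, and let $k\in M$ be a smooth vertex of $\omega$. Let $\lambda',\lambda''\colon M\to V$ be two characteristic functions for $\omega$ such that $\lambda'(i)=\lambda''(i)$ for all $i\in M\setminus\{k\}$. Then for the multi-fans $\Delta'=(\omega,\lambda')$ and $\Delta''=(\omega,\lambda'')$ one has $\dim\mathcal{A}^{2j}(\Delta')=\dim\mathcal{A}^{2j}(\Delta'')$ for all $j=0,\dots,n$. In other words, the dimensions $d_j$ of the multi-fan algebra do not depend on the values of the characteristic function at smooth vertices.
   Context: Fix a total order on the finite set $M$. A simplicial $(n-1)$-cycle on $M$ is a formal real linear combination $\omega=\sum_{I\subset M,|I|=n}w(I)\,I$ of $n$-element subsets (each oriented by the order of $M$) whose simplicial boundary is zero. A characteristic function for $\omega$ is a map $\lambda\colon M\to V$ such that $\{\lambda(i)\}_{i\in I}$ is a basis of $V$ whenever $w(I)\neq0$; the pair $\Delta=(\omega,\lambda)$ is called a (complete simplicial) multi-fan. Its volume polynomial is $V_\Delta=\frac{1}{n!}\sum_{I:\,w(I)\ne0}\frac{w(I)}{\det\lambda(I)\prod_{j=1}^n\alpha_{I,j}}\big(\alpha_{I,1}c_{i_1}+\dots+\alpha_{I,n}c_{i_n}\big)^n\in\mathbb{R}[c_i: i\in M]$, where $I=\{i_1<\dots<i_n\}$, $\det\lambda(I)$ is the determinant of the matrix with columns $\lambda(i_1),\dots,\lambda(i_n)$ in a fixed basis of $V$, and $\alpha_{I,1},\dots,\alpha_{I,n}$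 are the coordinates of a fixed generic vector $v\in V$ (all $\alpha_{I,j}\neq0$) in the basis $\lambda(i_1),\dots,\lambda(i_n)$; this polynomial does not depend on $v$. Let $\mathcal{D}=\mathbb{R}[\partial_i: i\in M]$ with $\partial_i=\partial/\partial c_i$ acting on polynomials, graded by $\deg\partial_i=2$, and $\operatorname{Ann}V_\Delta=\{D\in\mathcal{D}: DV_\Delta=0\}$. The multi-fan algebra is $\mathcal{A}^*(\Delta)=\mathcal{D}/\operatorname{Ann}V_\Delta$, with graded components $\mathcal{A}^{2j}(\Delta)$, $j=0,\dots,n$; $d_j=\dim\mathcal{A}^{2j}(\Delta)$. For a vertex $k$, the link of $k$ in $\omega$ is the $(n-2)$-cycle $\omega_k=\sum_{I\ni k}\pm w(I)\,(I\setminus\{k\})$ (signs induced by the orientations). The vertex $k$ is smooth if $\omega_k$ is the fundamental cycle of an oriented triangulated homology $(n-2)$-sphere. *)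

theory Defs
  imports "HOL-Analysis.Analysis" "HOL-Analysis.Finite_Function_Topology"
    "HOL-Algebra.QuotRing" "HOL-Algebra.Embedded_Algebras"
begin

section \<open>Simplicial chains, links and homology spheres\<close>

text \<open>
  A formal real linear combination of finite vertex sets is a finitely supported function;
  every simplex is oriented by the order of its vertices. The index \<open>p\<close> of a chain group is always
  the number of vertices of a simplex, i.e. one more than its dimension, so the \<open>(-1)\<close>-dimensional
  empty simplex is \<open>p = 0\<close>. The boundary is the augmented one: the boundary of a vertex is the
  empty simplex, so the homology below is reduced homology.
\<close>

definition supported_in :: "('b \<Rightarrow>\<^sub>0 real) \<Rightarrow> 'b set \<Rightarrow> bool" where
  "supported_in z A \<longleftrightarrow> Poly_Mapping.keys z \<subseteq> A"

definition vertex_sign :: "'a::linorder set \<Rightarrow> 'a \<Rightarrow> real" where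
  "vertex_sign I i = (-1) ^ card {j \<in> I. j < i}"

definition boundary :: "('a::linorder set \<Rightarrow>\<^sub>0 real) \<Rightarrow> ('a set \<Rightarrow>\<^sub>0 real)" where
  "boundary z = (\<Sum>I\<in>Poly_Mapping.keys z. \<Sum>i\<in>I.
     Poly_Mapping.single (I - {i}) (vertex_sign I i * Poly_Mapping.lookup z I))"

text \<open>\<open>simplicial_cycle M n \<omega>\<close>: \<open>\<omega>\<close> is a simplicial \<open>(n-1)\<close>-cycle on \<open>M\<close>.\<close>

definition simplicial_cycle :: "'a::linorder set \<Rightarrow> nat \<Rightarrow> ('a set \<Rightarrow>\<^sub>0 real) \<Rightarrow> bool" where
  "simplicial_cycle M n \<omega> \<longleftrightarrow> supported_in \<omega> {I. I \<subseteq> M \<and> card I = n} \<and> boundary \<omega> = 0"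

definition cycle_link :: "('a::linorder set \<Rightarrow>\<^sub>0 real) \<Rightarrow> 'a \<Rightarrow> ('a set \<Rightarrow>\<^sub>0 real)" where
  "cycle_link \<omega> k = (\<Sum>I\<in>{I \<in> Poly_Mapping.keys \<omega>. k \<in> I}.
     Poly_Mapping.single (I - {k}) (vertex_sign I k * Poly_Mapping.lookup \<omega> I))"

definition simplicial_complex :: "'a set set \<Rightarrow> bool" where
  "simplicial_complex K \<longleftrightarrow>
     finite K \<and> {} \<in> K \<and> (\<forall>\<sigma>\<in>K. finite \<sigma> \<and> (\<forall>\<tau>. \<tau> \<subseteq> \<sigma> \<longrightarrow> \<tau> \<in> K))"

definition complex_link :: "'a set set \<Rightarrow> 'a set \<Rightarrow> 'a set set" where
  "complex_link K \<sigma> = {\<tau> \<in> K. \<tau> \<inter> \<sigma> = {} \<and> \<tau> \<union> \<sigma> \<in> K}"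

definition chains :: "'a set set \<Rightarrow> nat \<Rightarrow> ('a set \<Rightarrow>\<^sub>0 real) set" where
  "chains K p = {z. supported_in z {\<sigma> \<in> K. card \<sigma> = p}}"

definition cycles :: "'a::linorder set set \<Rightarrow> nat \<Rightarrow> ('a set \<Rightarrow>\<^sub>0 real) set" where
  "cycles K p = {z \<in> chains K p. boundary z = 0}"

definition boundaries :: "'a::linorder set set \<Rightarrow> nat \<Rightarrow> ('a set \<Rightarrow>\<^sub>0 real) set" where
  "boundaries K p = boundary ` chains K (Suc p)"

text \<open>The dimension of the reduced real homology of \<open>K\<close> in dimension \<open>p - 1\<close>.\<close>

definition reduced_betti :: "'a::linorder set set \<Rightarrow> nat \<Rightarrow> nat" where
  "reduced_betti K p = dim (cycles K p) - dim (boundaries K p)"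

text \<open>
  \<open>homology_sphere m K\<close>: \<open>K\<close> is a triangulated real homology \<open>(m-1)\<close>-sphere, i.e. the link of every
  simplex \<open>\<sigma>\<close> (the empty one included, whose link is \<open>K\<close>) has the reduced homology of the sphere of
  dimension \<open>m - 1 - card \<sigma>\<close>. For \<open>m = 0\<close> this is the complex \<open>{{}}\<close>.
\<close>

definition homology_sphere :: "nat \<Rightarrow> 'a::linorder set set \<Rightarrow> bool" where
  "homology_sphere m K \<longleftrightarrow> simplicial_complex K \<and>
     (\<forall>\<sigma>\<in>K. \<forall>p. reduced_betti (complex_link K \<sigma>) p = (if p + card \<sigma> = m then 1 else 0))"

text \<open>
  An orientation of \<open>K\<close> is a choice of sign for every facet making the sum of the facets a cycle;
  this sum is the fundamental cycle.
\<close>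

definition fundamental_cycle :: "nat \<Rightarrow> 'a::linorder set set \<Rightarrow> ('a set \<Rightarrow>\<^sub>0 real) \<Rightarrow> bool" where
  "fundamental_cycle m K z \<longleftrightarrow> z \<in> cycles K m \<and>
     (\<forall>\<sigma>\<in>K. card \<sigma> = m \<longrightarrow> Poly_Mapping.lookup z \<sigma> \<in> {1, -1})"

definition smooth_vertex :: "nat \<Rightarrow> ('a::linorder set \<Rightarrow>\<^sub>0 real) \<Rightarrow> 'a \<Rightarrow> bool" where
  "smooth_vertex n \<omega> k \<longleftrightarrow>
     (\<exists>K. homology_sphere (n - 1) K \<and> fundamental_cycle (n - 1) K (cycle_link \<omega> k))"


section \<open>Polynomials and differential operators\<close>

text \<open>
  A monomial is a finitely supported exponent function. The same type carries the polynomials in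
  the \<open>c\<^sub>i\<close> and the constant-coefficient differential operators, i.e. the polynomials in the
  \<open>\<partial>\<^sub>i\<close>; both rings have the product of \<^theory>\<open>HOL-Library.Poly_Mapping\<close>.
\<close>

type_synonym 'a rpoly = "('a \<Rightarrow>\<^sub>0 nat) \<Rightarrow>\<^sub>0 real"

definition Const :: "real \<Rightarrow> 'a rpoly" where
  "Const r = Poly_Mapping.single 0 r"

definition Var :: "'a \<Rightarrow> 'a rpoly" where
  "Var i = Poly_Mapping.single (Poly_Mapping.single i 1) 1"

text \<open>Where \<open>i\<close> does not occur in \<open>m\<close>, the truncated exponent is harmless: the coefficient is 0.\<close>

definition partial :: "'a \<Rightarrow> 'a rpoly \<Rightarrow> 'a rpoly" where
  "partial i P = (\<Sum>m\<in>Poly_Mapping.keys P. Poly_Mapping.single (m - Poly_Mapping.single i 1)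
     (real (Poly_Mapping.lookup m i) * Poly_Mapping.lookup P m))"

definition partial_monom :: "('a::linorder \<Rightarrow>\<^sub>0 nat) \<Rightarrow> 'a rpoly \<Rightarrow> 'a rpoly" where
  "partial_monom m =
     foldr (\<lambda>i. partial i ^^ Poly_Mapping.lookup m i) (sorted_list_of_set (Poly_Mapping.keys m))"

definition apply_op :: "'a::linorder rpoly \<Rightarrow> 'a rpoly \<Rightarrow> 'a rpoly" where
  "apply_op D P = (\<Sum>m\<in>Poly_Mapping.keys D. Poly_Mapping.lookup D m *\<^sub>R partial_monom m P)"

definition diff_ops :: "'a set \<Rightarrow> 'a rpoly ring" where
  "diff_ops M = \<lparr>carrier = {D. \<forall>m\<in>Poly_Mapping.keys D. Poly_Mapping.keys m \<subseteq> M},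
     mult = (*), one = 1, zero = 0, add = (+)\<rparr>"

text \<open>The grading has \<open>deg \<partial>\<^sub>i = 2\<close>.\<close>

definition monom_degree :: "('a \<Rightarrow>\<^sub>0 nat) \<Rightarrow> nat" where
  "monom_degree m = (\<Sum>i\<in>Poly_Mapping.keys m. 2 * Poly_Mapping.lookup m i)"

definition homogeneous :: "nat \<Rightarrow> 'a rpoly \<Rightarrow> bool" where
  "homogeneous d D \<longleftrightarrow> (\<forall>m\<in>Poly_Mapping.keys D. monom_degree m = d)"

definition Ann :: "'a::linorder set \<Rightarrow> 'a rpoly \<Rightarrow> 'a rpoly set" where
  "Ann M P = {D \<in> carrier (diff_ops M). apply_op D P = 0}"


section \<open>Multi-fans\<close>

definition characteristic_function ::
  "('a set \<Rightarrow>\<^sub>0 real) \<Rightarrow> ('a \<Rightarrow> real ^ 'n) \<Rightarrow> bool" where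
  "characteristic_function \<omega> lam \<longleftrightarrow>
     (\<forall>I\<in>Poly_Mapping.keys \<omega>. inj_on lam I \<and> independent (lam ` I) \<and> span (lam ` I) = UNIV)"

text \<open>
  The determinant of the matrix whose columns are \<open>lam(i\<^sub>1), \<dots>, lam(i\<^sub>n)\<close> for
  \<open>I = {i\<^sub>1 < \<dots> < i\<^sub>n}\<close>, in the standard basis. The order of the index type \<open>'n\<close> only serves to
  place the columns; it enumerates the positions as \<open>card {t. t < s}\<close>.
\<close>

definition char_det :: "('a::linorder \<Rightarrow> real ^ 'n::{finite,linorder}) \<Rightarrow> 'a set \<Rightarrow> real" where
  "char_det lam I = det (\<chi> r s. lam (sorted_list_of_set I ! card {t. t < s}) $ r)"

text \<open>The coordinate of \<open>v\<close> at \<open>lam(i)\<close> in the basis \<open>lam ` I\<close>.\<close>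

definition coord :: "('a \<Rightarrow> real ^ 'n) \<Rightarrow> real ^ 'n \<Rightarrow> 'a set \<Rightarrow> 'a \<Rightarrow> real" where
  "coord lam v I i = representation (lam ` I) v (lam i)"

definition generic :: "('a set \<Rightarrow>\<^sub>0 real) \<Rightarrow> ('a \<Rightarrow> real ^ 'n) \<Rightarrow> real ^ 'n \<Rightarrow> bool" where
  "generic \<omega> lam v \<longleftrightarrow> (\<forall>I\<in>Poly_Mapping.keys \<omega>. \<forall>i\<in>I. coord lam v I i \<noteq> 0)"

definition volume_polynomial ::
  "('a::linorder set \<Rightarrow>\<^sub>0 real) \<Rightarrow> ('a \<Rightarrow> real ^ 'n::{finite,linorder}) \<Rightarrow>
    real ^ 'n::{finite,linorder} \<Rightarrow> 'a rpoly" where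
  "volume_polynomial \<omega> lam v = (1 / fact CARD('n)) *\<^sub>R (\<Sum>I\<in>Poly_Mapping.keys \<omega>.
     (Poly_Mapping.lookup \<omega> I / (char_det lam I * (\<Prod>i\<in>I. coord lam v I i))) *\<^sub>R
       (\<Sum>i\<in>I. coord lam v I i *\<^sub>R Var i) ^ CARD('n))"

definition multifan_ann :: "'a::linorder set \<Rightarrow> ('a set \<Rightarrow>\<^sub>0 real) \<Rightarrow>
    ('a \<Rightarrow> real ^ 'n::{finite,linorder}) \<Rightarrow> real ^ 'n::{finite,linorder} \<Rightarrow> 'a rpoly set" where
  "multifan_ann M \<omega> lam v = Ann M (volume_polynomial \<omega> lam v)"

definition multifan_algebra :: "'a::linorder set \<Rightarrow> ('a set \<Rightarrow>\<^sub>0 real) \<Rightarrow>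
    ('a \<Rightarrow> real ^ 'n::{finite,linorder}) \<Rightarrow> real ^ 'n::{finite,linorder} \<Rightarrow> 'a rpoly set ring" where
  "multifan_algebra M \<omega> lam v = diff_ops M Quot multifan_ann M \<omega> lam v"

text \<open>The copy of the real numbers in the multi-fan algebra.\<close>

definition multifan_scalars :: "'a::linorder set \<Rightarrow> ('a set \<Rightarrow>\<^sub>0 real) \<Rightarrow>
    ('a \<Rightarrow> real ^ 'n::{finite,linorder}) \<Rightarrow> real ^ 'n::{finite,linorder} \<Rightarrow> 'a rpoly set set" where
  "multifan_scalars M \<omega> lam v = range (\<lambda>r. multifan_ann M \<omega> lam v +>\<^bsub>diff_ops M\<^esub> Const r)"

definition multifan_component :: "'a::linorder set \<Rightarrow> ('a set \<Rightarrow>\<^sub>0 real) \<Rightarrow>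
    ('a \<Rightarrow> real ^ 'n::{finite,linorder}) \<Rightarrow> real ^ 'n::{finite,linorder} \<Rightarrow> nat \<Rightarrow> 'a rpoly set set" where
  "multifan_component M \<omega> lam v d =
     (\<lambda>D. multifan_ann M \<omega> lam v +>\<^bsub>diff_ops M\<^esub> D) ` {D \<in> carrier (diff_ops M). homogeneous d D}"

text \<open>
  \<open>multifan_dimension M \<omega> lam v d r\<close>: the component of degree \<open>d\<close> has dimension \<open>r\<close> as a real vector
  space, in the sense of \<^theory>\<open>HOL-Algebra.Embedded_Algebras\<close> (in particular it is finite-dimensional).
\<close>

definition multifan_dimension :: "'a::linorder set \<Rightarrow> ('a set \<Rightarrow>\<^sub>0 real) \<Rightarrow>
    ('a \<Rightarrow> real ^ 'n::{finite,linorder}) \<Rightarrow> real ^ 'n::{finite,linorder} \<Rightarrow> nat \<Rightarrow> nat \<Rightarrow> bool" where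
  "multifan_dimension M \<omega> lam v d r \<longleftrightarrow> ring.dimension (multifan_algebra M \<omega> lam v) r
     (multifan_scalars M \<omega> lam v) (multifan_component M \<omega> lam v d)"

end

theory Submission
  imports Defs
begin

text \<open>
  In degree \<open>n\<close> the volume polynomial \<open>V\<close> is the moment functional \<open>x\<^sup>a \<mapsto> \<Sum>\<^sub>I c\<^sub>I \<alpha>\<^sub>I\<^sup>a\<close> on the points
  \<open>\<alpha>\<^sub>I\<close>, and \<open>d\<^sub>j\<close> is the dimension of \<open>\<D>\<^sub>j V\<close>. The derivative \<open>\<partial>\<^sub>k\<close> maps \<open>\<D>\<^sub>j V\<close> onto
  \<open>\<D>\<^sub>j (\<partial>\<^sub>k V)\<close>, so \<open>d\<^sub>j\<close> is the sum of the dimensions of this image and of the kernel.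
  The annihilator of \<open>\<partial>\<^sub>k V\<close> is generated by the linear relations, which kill \<open>V\<close>, and the nonfaces of
  the star of \<open>k\<close>; this is Poincare duality for the face ring of the homology sphere \<open>L\<close> linking \<open>k\<close>.
  Hence the dimension of the image is given by the face numbers of \<open>L\<close>. The kernel is spanned by the
  derivatives of \<open>V\<close> by nonfaces of \<open>L\<close> avoiding \<open>k\<close>; with a common generic vector for both
  characteristic functions these only see the points \<open>\<alpha>\<^sub>I\<close> with \<open>k \<notin> I\<close>, which agree.

  The Cohen-Macaulay property comes from resolving the face ring by the polynomial rings of the faces.
  For duality, evaluation at the points \<open>\<alpha>\<^sub>I\<close> with \<open>k \<in> I\<close> turns the face ring modulo an
  inhomogeneous system of parameters into functions on the facets of \<open>L\<close>. Polynomials of degree less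
  than \<open>d\<close> and less than \<open>n - d\<close> give orthogonal spaces for a nondegenerate weighted inner product, so
  their dimensions add up to at most the number of facets. Summing over \<open>d\<close>, the Hilbert function and
  the fact that every ridge lies in two facets force equality for each \<open>d\<close>.
\<close>

text \<open>Although V records only moments of degree n, the functional is used in all degrees. At
  every point alpha_I the linear form with coefficients \<open>\<xi> \<bullet> lam i\<close> takes
  the value \<open>\<xi> \<bullet> v\<close>, so under the functional it acts as a scalar; since the
  moments below degree n vanish, the form annihilates V. The same vanishing, shifted by one degree
  because the derivative at k puts the factor alpha_I(k) into the weights, is the orthogonality
  behind the duality. The obstacle is that moving the vector at k changes the points and weights of
  all I containing k, so the two volume polynomials cannot be compared term by term. Only the part
  killed by the derivative at k can; the rest must be shown to have a dimension that depends on L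
  alone. A common v exists because nongeneric vectors fill finitely many hyperplanes, and passing to
  it changes nothing: modulo the linear relations every moment of degree n reduces to the numbers
  \<open>lookup \<omega> I / char_det lam I\<close>, in which v does not occur. The weights on the
  facets of L may have both signs. Directness of sums is therefore taken from the standard form,
  after moving the weights to one side.\<close>

abbreviation "lookup \<equiv> Poly_Mapping.lookup"
abbreviation "keys \<equiv> Poly_Mapping.keys"
abbreviation "single \<equiv> Poly_Mapping.single"

section \<open>Finite-dimensional subspaces\<close>

text \<open>The ambient spaces of finitely supported functions are in general infinite-dimensional,
  and there \<open>dim\<close> of an infinite-dimensional subspace is 0 by convention; so finiteness
  is carried along explicitly.\<close>

definition fin_dim :: "'a::real_vector set \<Rightarrow> bool" where
  "fin_dim S \<longleftrightarrow> (\<exists>B. finite B \<and> S \<subseteq> span B)"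

lemma fin_dim_subset: "fin_dim T \<Longrightarrow> S \<subseteq> T \<Longrightarrow> fin_dim S"
  unfolding fin_dim_def by blast

lemma fin_dim_independent_finite:
  assumes "fin_dim S" "B \<subseteq> S" "independent B"
  shows "finite B"
  using assms unfolding fin_dim_def
  by (meson independent_span_bound order_trans)

lemma fin_dim_basis:
  assumes "fin_dim S"
  obtains B where "finite B" "B \<subseteq> S" "independent B" "S \<subseteq> span B" "card B = dim S"
  by (metis assms basis_exists fin_dim_independent_finite)

lemma fin_dim_image:
  assumes "linear f" "fin_dim S"
  shows "fin_dim (f ` S)"
proof -
  obtain B where B: "finite B" "S \<subseteq> span B"
    using assms unfolding fin_dim_def by blast
  have "f ` S \<subseteq> span (f ` B)"
    using B(2) linear_span_image[OF assms(1), of B] by blast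
  then show ?thesis
    unfolding fin_dim_def using B by blast
qed

lemma fin_dim_mono:
  assumes "fin_dim T" "S \<subseteq> T"
  shows "dim S \<le> dim T"
proof -
  obtain B where B: "finite B" "B \<subseteq> T" "independent B" "T \<subseteq> span B" "card B = dim T"
    using fin_dim_basis[OF assms(1)] by blast
  have "S \<subseteq> span B" using B(4) assms(2) by (rule order_trans[rotated])
  then show ?thesis
    using dim_le_card[of S B] B(1,5) by simp
qed

lemma fin_dim_eqI:
  assumes "fin_dim T" "S \<subseteq> T" "subspace S" "dim T \<le> dim S"
  shows "S = T"
proof -
  obtain B where B: "finite B" "B \<subseteq> S" "independent B" "S \<subseteq> span B" "card B = dim S"
    using fin_dim_basis[OF fin_dim_subset[OF assms(1,2)]] by blast
  have "T \<subseteq> span B"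
  proof
    fix x assume x: "x \<in> T"
    show "x \<in> span B"
    proof (rule ccontr)
      assume nx: "x \<notin> span B"
      then have ind: "independent (insert x B)"
        using B by (simp add: independent_insert)
      have "x \<notin> B" using nx span_base by blast
      then have "card (insert x B) = Suc (dim S)"
        using B by simp
      moreover have "card (insert x B) = dim (insert x B)"
        using dim_eq_card_independent[OF ind] by simp
      moreover have "dim (insert x B) \<le> dim T"
        using fin_dim_mono[OF assms(1), of "insert x B"] x B(2) assms(2) by blast
      ultimately show False using assms(4) by simp
    qed
  qed
  then show ?thesis
    using assms B(2) span_minimal[of B S] by blast
qed

lemma subspace_kernel_on:
  assumes "linear f" "subspace S"
  shows "subspace {x \<in> S. f x = 0}"
  using assms by (auto simp: subspace_def linear_add linear_scale linear_0)

lemma rank_nullity: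
  assumes f: "linear f" and S: "subspace S" "fin_dim S"
  shows "dim S = dim (f ` S) + dim {x \<in> S. f x = 0}"
proof -
  define K where "K = {x \<in> S. f x = 0}"
  have KS: "K \<subseteq> S" by (auto simp: K_def)
  obtain B where B: "finite B" "B \<subseteq> K" "independent B" "K \<subseteq> span B" "card B = dim K"
    using fin_dim_basis[OF fin_dim_subset[OF S(2) KS]] by blast
  obtain C where C: "B \<subseteq> C" "C \<subseteq> S" "independent C" "S \<subseteq> span C"
    using maximal_independent_subset_extend[of B S] B KS by blast
  have fC: "finite C" using fin_dim_independent_finite[OF S(2) C(2,3)] .
  define D where "D = C - B"
  have DS: "D \<subseteq> S" "independent D" "finite D"
    using C fC independent_mono[OF C(3)] by (auto simp: D_def)
  \<comment> \<open>A vector of \<open>span D\<close> killed by \<open>f\<close> also lies in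
    \<open>span B\<close>. As \<open>B\<close> and \<open>D\<close> are disjoint parts of the
    independent set \<open>C\<close>, the two spans meet only in 0.\<close>
  have inj: "x = 0" if x: "x \<in> span D" "f x = 0" for x
  proof -
    have "x \<in> S" using x(1) DS(1) S(1) span_minimal by blast
    then have "x \<in> span B" using x(2) B(4) by (auto simp: K_def)
    have "span D \<inter> span B \<subseteq> {0}"
    proof (rule subsetI)
      fix y assume y: "y \<in> span D \<inter> span B"
      obtain u where u: "y = (\<Sum>v\<in>D. u v *\<^sub>R v)"
        using y DS(3) by (auto simp: span_finite)
      obtain w where w: "y = (\<Sum>v\<in>B. w v *\<^sub>R v)"
        using y B(1) by (auto simp: span_finite)
      define c where "c v = (if v \<in> D then u v else - w v)" for v
      have "(\<Sum>v\<in>C. c v *\<^sub>R v) = (\<Sum>v\<in>D. c v *\<^sub>R v) + (\<Sum>v\<in>B. c v *\<^sub>R v)"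
        using C(1) fC D_def by (subst sum.subset_diff[of B C]) auto
      also have "(\<Sum>v\<in>D. c v *\<^sub>R v) = y" unfolding u c_def by (rule sum.cong) auto
      also have "(\<Sum>v\<in>B. c v *\<^sub>R v) = - y"
        unfolding w c_def D_def sum_negf[symmetric] by (rule sum.cong) auto
      finally have "(\<Sum>v\<in>C. c v *\<^sub>R v) = 0" by simp
      then have "\<forall>v\<in>C. c v = 0" using independentD[OF C(3) fC subset_refl] by blast
      then have "\<forall>v\<in>D. u v = 0" by (auto simp: c_def D_def split: if_splits)
      then show "y \<in> {0}" unfolding u by simp
    qed
    then show "x = 0" using x(1) \<open>x \<in> span B\<close> by blast
  qed
  have injD: "inj_on f (span D)"
    using inj linear_injective_on_subspace_0[OF f subspace_span] by blast
  have indf: "independent (f ` D)"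
    by (rule linear_independent_injective_image[OF f DS(2) injD])
  have spf: "f ` S \<subseteq> span (f ` D)"
  proof
    fix y assume "y \<in> f ` S"
    then obtain x where x: "x \<in> S" "y = f x" by blast
    then obtain u where u: "x = (\<Sum>v\<in>C. u v *\<^sub>R v)"
      using C(4) fC by (auto simp: span_finite)
    have "y = (\<Sum>v\<in>C. u v *\<^sub>R f v)"
      unfolding x(2) u by (simp add: linear_sum[OF f] linear_scale[OF f])
    also have "\<dots> = (\<Sum>v\<in>D. u v *\<^sub>R f v)"
      using fC C(1) B(2) by (intro sum.mono_neutral_right) (auto simp: D_def K_def)
    also have "\<dots> \<in> span (f ` D)"
      by (intro span_sum span_scale span_base) auto
    finally show "y \<in> span (f ` D)" .
  qed
  have "card (f ` D) = dim (f ` S)"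
    by (rule basis_card_eq_dim[OF _ spf indf]) (use DS in blast)
  moreover have "card (f ` D) = card D"
    by (intro card_image inj_on_subset[OF injD] span_superset)
  moreover have "card C = dim S"
    by (rule basis_card_eq_dim[OF C(2,4,3)])
  moreover have "card C = card D + card B"
    using fC C(1) unfolding D_def by (simp add: card_Diff_subset card_mono finite_subset)
  ultimately show ?thesis using B(5) by (simp add: K_def)
qed

lemma dim_image_inj:
  assumes "linear f" "subspace S" "fin_dim S" "\<And>x. x \<in> S \<Longrightarrow> f x = 0 \<Longrightarrow> x = 0"
  shows "dim (f ` S) = dim S"
proof -
  have "{x \<in> S. f x = 0} \<subseteq> {0}" using assms(4) by blast
  then have "dim {x \<in> S. f x = 0} \<le> 0"
    using dim_le_card[of "{x \<in> S. f x = 0}" "{}"] by simp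
  then show ?thesis using rank_nullity[OF assms(1-3)] by simp
qed

lemma fin_dim_Times:
  assumes "fin_dim A" "fin_dim B"
  shows "fin_dim (A \<times> B)"
proof -
  obtain X where X: "finite X" "A \<subseteq> span X" using assms(1) unfolding fin_dim_def by blast
  obtain Y where Y: "finite Y" "B \<subseteq> span Y" using assms(2) unfolding fin_dim_def by blast
  have 1: "linear (\<lambda>x::'a. (x, 0::'b))" and 2: "linear (\<lambda>y::'b. (0::'a, y))"
    by (auto intro!: linearI)
  have "A \<times> B \<subseteq> span ((\<lambda>x. (x, 0)) ` X \<union> (\<lambda>y. (0, y)) ` Y)" (is "_ \<subseteq> span ?Z")
  proof
    fix p assume "p \<in> A \<times> B"
    then obtain a b where p: "p = (a, b)" "a \<in> span X" "b \<in> span Y" using X Y by auto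
    have "(a, 0) \<in> span ?Z"
      using linear_span_image[OF 1, of X] p(2) span_mono[of "(\<lambda>x. (x, 0)) ` X" ?Z] by blast
    moreover have "(0, b) \<in> span ?Z"
      using linear_span_image[OF 2, of Y] p(3) span_mono[of "(\<lambda>y. (0, y)) ` Y" ?Z] by blast
    ultimately show "p \<in> span ?Z" using span_add[of "(a,0)" ?Z "(0,b)"] p(1) by simp
  qed
  moreover have "finite ?Z" using X Y by simp
  ultimately show ?thesis unfolding fin_dim_def by (intro exI[of _ ?Z] conjI)
qed

lemma dim_Times_subspaces:
  assumes "subspace A" "fin_dim A" "subspace B" "fin_dim B"
  shows "dim (A \<times> B) = dim A + dim B"
proof -
  have AB: "subspace (A \<times> B)" using assms by (auto simp: subspace_def zero_prod_def)
  have lf: "linear (fst :: 'a \<times> 'b \<Rightarrow> 'a)" by (auto intro!: linearI)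
  have ls: "linear (\<lambda>y::'b. (0::'a, y))" by (auto intro!: linearI)
  have 1: "fst ` (A \<times> B) = A" using subspace_0[OF assms(3)] by force
  have 2: "{x \<in> A \<times> B. fst x = 0} = (\<lambda>y. (0, y)) ` B"
    using subspace_0[OF assms(1)] by force
  have 3: "dim ((\<lambda>y. (0::'a, y)) ` B) = dim B"
    by (rule dim_image_inj[OF ls assms(3,4)]) (simp add: zero_prod_def)
  show ?thesis
    using rank_nullity[OF lf AB fin_dim_Times[OF assms(2,4)], unfolded 1 2 3] .
qed

lemma subspace_sum_image:
  assumes "linear f" "subspace A" "subspace N"
  shows "subspace {a + f x | a x. a \<in> A \<and> x \<in> N}"
proof (rule subspaceI)
  show "0 \<in> {a + f x | a x. a \<in> A \<and> x \<in> N}"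
    using subspace_0[OF assms(2)] subspace_0[OF assms(3)] linear_0[OF assms(1)] by force
next
  fix p q assume "p \<in> {a + f x | a x. a \<in> A \<and> x \<in> N}" "q \<in> {a + f x | a x. a \<in> A \<and> x \<in> N}"
  then obtain a x b y where *: "p = a + f x" "q = b + f y" "a \<in> A" "x \<in> N" "b \<in> A" "y \<in> N" by blast
  then have "p + q = (a + b) + f (x + y)" "a + b \<in> A" "x + y \<in> N"
    using assms by (auto simp: linear_add subspace_add)
  then show "p + q \<in> {a + f x | a x. a \<in> A \<and> x \<in> N}" by blast
next
  fix c p assume "p \<in> {a + f x | a x. a \<in> A \<and> x \<in> N}"
  then obtain a x where *: "p = a + f x" "a \<in> A" "x \<in> N" by blast
  then have "c *\<^sub>R p = c *\<^sub>R a + f (c *\<^sub>R x)" "c *\<^sub>R a \<in> A" "c *\<^sub>R x \<in> N"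
    using assms by (auto simp: linear_scale subspace_scale algebra_simps)
  then show "c *\<^sub>R p \<in> {a + f x | a x. a \<in> A \<and> x \<in> N}" by blast
qed

text \<open>Rank-nullity for \<open>(a, x) \<mapsto> a + f x\<close> on \<open>A \<times> N\<close>,
  whose kernel is a copy of \<open>{x \<in> N. f x \<in> A}\<close> via
  \<open>x \<mapsto> (- f x, x)\<close>. When \<open>A\<close> is an ideal and \<open>f\<close>
  multiplication by a form, that set is the colon.\<close>

lemma dim_sum_image:
  assumes f: "linear f" and A: "subspace A" "fin_dim A" and N: "subspace N" "fin_dim N"
  shows "dim {a + f x | a x. a \<in> A \<and> x \<in> N} + dim {x \<in> N. f x \<in> A} = dim A + dim N"
    and "fin_dim {a + f x | a x. a \<in> A \<and> x \<in> N}"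
proof -
  define g where "g = (\<lambda>p. fst p + f (snd p))"
  have lg: "linear g"
    unfolding g_def using f by (auto intro!: linearI simp: linear_add linear_scale algebra_simps)
  have AN: "subspace (A \<times> N)" using A N by (auto simp: subspace_def zero_prod_def)
  have im: "g ` (A \<times> N) = {a + f x | a x. a \<in> A \<and> x \<in> N}"
    unfolding g_def by force
  define h where "h = (\<lambda>x. (- f x, x))"
  have lh: "linear h"
    unfolding h_def using f by (auto intro!: linearI simp: linear_add linear_scale algebra_simps)
  define L where "L = {x \<in> N. f x \<in> A}"
  have sL: "subspace L" unfolding L_def
    using A(1) N(1)
    by (auto simp: subspace_def linear_add[OF f] linear_scale[OF f] linear_0[OF f])
  have fL: "fin_dim L" by (rule fin_dim_subset[OF N(2)]) (auto simp: L_def)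
  have ker: "{p \<in> A \<times> N. g p = 0} = h ` L"
  proof -
    have "p \<in> h ` L" if "p \<in> A \<times> N" "g p = 0" for p
    proof -
      obtain a x where p: "p = (a, x)" by fastforce
      have "a = - f x" using that p by (simp add: g_def eq_neg_iff_add_eq_0)
      then have "f x \<in> A" using that p subspace_neg[OF A(1), of a] by simp
      then have "x \<in> L" using that p by (simp add: L_def)
      moreover have "p = h x" using p \<open>a = - f x\<close> by (simp add: h_def)
      ultimately show ?thesis by blast
    qed
    moreover have "h x \<in> A \<times> N \<and> g (h x) = 0" if "x \<in> L" for x
      using that subspace_neg[OF A(1), of "f x"] by (simp add: L_def h_def g_def)
    ultimately show ?thesis by blast
  qed
  have "dim (h ` L) = dim L"
    by (rule dim_image_inj[OF lh sL fL]) (simp add: h_def zero_prod_def)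
  then show "dim {a + f x | a x. a \<in> A \<and> x \<in> N} + dim {x \<in> N. f x \<in> A} = dim A + dim N"
    using rank_nullity[OF lg AN fin_dim_Times[OF A(2) N(2)], unfolded im ker] dim_Times_subspaces[OF A N]
    unfolding L_def by linarith
  show "fin_dim {a + f x | a x. a \<in> A \<and> x \<in> N}"
    using fin_dim_image[OF lg fin_dim_Times[OF A(2) N(2)]] by (simp add: im)
qed

section \<open>Coordinate subspaces of finitely supported functions\<close>

definition coords :: "'b set \<Rightarrow> ('b \<Rightarrow>\<^sub>0 real) set" where
  "coords A = {f. keys f \<subseteq> A}"

lemma lookup_scaleR [simp]: "lookup (c *\<^sub>R f) x = c *\<^sub>R lookup f x"
  by (simp add: scaleR_poly_mapping_def)

lemma lookup_single_one: "lookup (single a (r::real)) b = (if a = b then r else 0)"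
  by (simp add: lookup_single when_def)

lemma keys_scaleR: "keys (c *\<^sub>R f) \<subseteq> keys (f :: 'b \<Rightarrow>\<^sub>0 real)"
  by (auto simp: in_keys_iff)

lemma subspace_coords: "subspace (coords A)"
proof (rule subspaceI)
  fix f g :: "'a \<Rightarrow>\<^sub>0 real" and c :: real assume "f \<in> coords A"
  then show "c *\<^sub>R f \<in> coords A" using keys_scaleR[of c f] unfolding coords_def by blast
  assume "g \<in> coords A"
  with \<open>f \<in> coords A\<close> show "f + g \<in> coords A" using keys_add[of f g] unfolding coords_def by blast
qed (simp add: coords_def)

lemma single_in_coords: "a \<in> A \<Longrightarrow> single a r \<in> coords A"
  by (simp add: coords_def)

lemma poly_mapping_expansion:
  assumes "finite A" "f \<in> coords A"
  shows "f = (\<Sum>a\<in>A. lookup f a *\<^sub>R single a (1::real))"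
proof (rule poly_mapping_eqI)
  fix b
  have "(\<Sum>a\<in>A. lookup f a * (if a = b then 1 else 0)) = lookup f b"
    using assms by (auto simp: coords_def in_keys_iff if_distrib cong: if_cong)
  then show "lookup f b =
      lookup (\<Sum>a\<in>A. lookup f a *\<^sub>R single a (1::real)) b"
    by (simp add: lookup_sum lookup_single_one)
qed

lemma coords_span:
  assumes "finite A"
  shows "coords A = span ((\<lambda>a. single a (1::real)) ` A)"
proof
  show "coords A \<subseteq> span ((\<lambda>a. single a (1::real)) ` A)"
  proof
    fix f :: "'a \<Rightarrow>\<^sub>0 real" assume "f \<in> coords A"
    then have "f = (\<Sum>a\<in>A. lookup f a *\<^sub>R single a (1::real))"
      by (rule poly_mapping_expansion[OF assms])
    also have "\<dots> \<in> span ((\<lambda>a. single a (1::real)) ` A)"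
      by (intro span_sum span_scale span_base) auto
    finally show "f \<in> span ((\<lambda>a. single a (1::real)) ` A)" .
  qed
  show "span ((\<lambda>a. single a (1::real)) ` A) \<subseteq> coords A"
    by (intro span_minimal subspace_coords) (auto intro: single_in_coords)
qed

lemma fin_dim_coords: "finite A \<Longrightarrow> fin_dim (coords A)"
  unfolding fin_dim_def using coords_span by (metis finite_imageI order_refl)

lemma dim_coords:
  assumes "finite A"
  shows "dim (coords A) = card A"
proof -
  let ?s = "\<lambda>a. single a (1::real)"
  have inj: "inj_on ?s A"
    by (rule inj_onI) (metis lookup_single_one zero_neq_one)
  have "independent (?s ` A)"
  proof (rule independent_if_scalars_zero)
    show "finite (?s ` A)" using assms by simp
    fix u x assume 0: "(\<Sum>x\<in>?s ` A. u x *\<^sub>R x) = 0" and "x \<in> ?s ` A"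
    then obtain a where a: "a \<in> A" "x = ?s a" by blast
    have "(\<Sum>b\<in>A. u (?s b) *\<^sub>R ?s b) = 0"
      using 0 inj by (simp add: sum.reindex)
    then have "lookup (\<Sum>b\<in>A. u (?s b) *\<^sub>R ?s b) a = 0" by simp
    moreover have "lookup (\<Sum>b\<in>A. u (?s b) *\<^sub>R ?s b) a = u (?s a)"
      using a assms by (simp add: lookup_sum lookup_single_one if_distrib cong: if_cong)
    ultimately show "u x = 0" using a by simp
  qed
  then have "dim (span (?s ` A)) = card (?s ` A)"
    by (rule dim_span_eq_card_independent)
  then show ?thesis by (simp add: coords_span[OF assms] card_image[OF inj])
qed

definition lin_ext :: "('b \<Rightarrow> 'c) \<Rightarrow> ('b \<Rightarrow>\<^sub>0 real) \<Rightarrow> 'c::real_vector" where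
  "lin_ext \<phi> f = (\<Sum>b\<in>keys f. lookup f b *\<^sub>R \<phi> b)"

lemma lin_ext_superset:
  assumes "finite A" "keys f \<subseteq> A"
  shows "lin_ext \<phi> f = (\<Sum>b\<in>A. lookup f b *\<^sub>R \<phi> b)"
  unfolding lin_ext_def using assms by (intro sum.mono_neutral_left) (auto simp: in_keys_iff)

lemma linear_lin_ext: "linear (lin_ext \<phi>)"
proof (rule linearI)
  fix f g :: "'a \<Rightarrow>\<^sub>0 real" and c :: real
  let ?A = "keys f \<union> keys g"
  have "keys (f + g) \<subseteq> ?A" by (rule keys_add)
  then show "lin_ext \<phi> (f + g) = lin_ext \<phi> f + lin_ext \<phi> g"
    by (simp add: lin_ext_superset[of ?A] lookup_add scaleR_add_left sum.distrib)
  show "lin_ext \<phi> (c *\<^sub>R f) = c *\<^sub>R lin_ext \<phi> f"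
    using keys_scaleR[of c f]
    by (simp add: lin_ext_superset[of "keys f"] scaleR_sum_right)
qed

lemma lin_ext_single [simp]: "lin_ext \<phi> (single b r) = r *\<^sub>R \<phi> b"
  by (simp add: lin_ext_superset[of "{b}"])

lemma linear_eq_on_coords:
  assumes "linear f" "linear g" "\<And>a. a \<in> A \<Longrightarrow> f (single a 1) = g (single a 1)"
    and "x \<in> coords A"
  shows "f x = g x"
proof -
  let ?K = "keys x"
  have K: "finite ?K" "?K \<subseteq> A" "x \<in> coords ?K" using assms(4) by (auto simp: coords_def)
  have eq: "x = (\<Sum>a\<in>?K. lookup x a *\<^sub>R single a 1)"
    by (rule poly_mapping_expansion[OF K(1,3)])
  have "f x = (\<Sum>a\<in>?K. lookup x a *\<^sub>R f (single a 1))"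
    by (subst eq) (simp add: linear_sum[OF assms(1)] linear_scale[OF assms(1)])
  also have "\<dots> = (\<Sum>a\<in>?K. lookup x a *\<^sub>R g (single a 1))"
    using K(2) assms(3) by (intro sum.cong) auto
  also have "\<dots> = g x"
    by (subst (3) eq) (simp add: linear_sum[OF assms(2)] linear_scale[OF assms(2)])
  finally show ?thesis .
qed

lemma lin_ext_in_subspace:
  assumes "subspace T" "\<And>a. a \<in> A \<Longrightarrow> \<phi> a \<in> T" "x \<in> coords A"
  shows "lin_ext \<phi> x \<in> T"
  using assms by (auto simp: lin_ext_def coords_def intro!: subspace_sum subspace_scale)

text \<open>The standard form is positive definite over the reals, so orthogonal subspaces meet only
  in 0 and their dimensions add up. The second statement is the case of equality, where the two
  subspaces fill \<open>coords X\<close>.\<close>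

lemma coords_orthogonal:
  assumes X: "finite X" and U: "subspace U" "U \<subseteq> coords X" and W: "subspace W" "W \<subseteq> coords X"
    and orth: "\<And>u w. u \<in> U \<Longrightarrow> w \<in> W \<Longrightarrow>
      (\<Sum>x\<in>X. lookup u x * lookup w x) = 0"
  shows "dim U + dim W \<le> card X"
    and "card X \<le> dim U + dim W \<Longrightarrow> f \<in> coords X \<Longrightarrow> \<exists>u\<in>U. \<exists>w\<in>W. f = u + w"
proof -
  have fU: "fin_dim U" and fW: "fin_dim W"
    using fin_dim_subset[OF fin_dim_coords[OF X]] U W by blast+
  define S where "S = {a + id x | a x. a \<in> U \<and> x \<in> W}"
  have "{x \<in> W. id x \<in> U} \<subseteq> {0}"
  proof
    fix x assume "x \<in> {x \<in> W. id x \<in> U}"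
    then have x: "x \<in> W" "x \<in> U" by auto
    have "\<forall>a\<in>X. lookup x a * lookup x a = 0"
      using orth[OF x(2,1)] X by (subst (asm) sum_nonneg_eq_0_iff) auto
    then have "x = 0"
      using x W by (intro poly_mapping_eqI) (auto simp: coords_def in_keys_iff subset_iff)
    then show "x \<in> {0}" by simp
  qed
  then have "dim {x \<in> W. id x \<in> U} = 0"
    using dim_le_card[of "{x \<in> W. id x \<in> U}" "{}"] by simp
  then have d: "dim S = dim U + dim W"
    using dim_sum_image(1)[OF linear_id U(1) fU W(1) fW] by (simp add: S_def)
  have sS: "subspace S" unfolding S_def
    by (rule subspace_sum_image[OF linear_id U(1) W(1)])
  have SX: "S \<subseteq> coords X"
    unfolding S_def using U W subspace_add[OF subspace_coords] by fastforce
  show "dim U + dim W \<le> card X"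
    using fin_dim_mono[OF fin_dim_coords[OF X] SX] by (simp add: d dim_coords[OF X])
  assume "card X \<le> dim U + dim W" and f: "f \<in> coords X"
  then have "S = coords X"
    by (intro fin_dim_eqI[OF fin_dim_coords[OF X] SX sS]) (simp add: d dim_coords[OF X])
  with f have "f \<in> S" by simp
  then show "\<exists>u\<in>U. \<exists>w\<in>W. f = u + w"
    unfolding S_def by auto
qed

section \<open>Regular sequences on graded vector spaces\<close>

text \<open>Degree \<open>d\<close> part of the submodule generated by the first \<open>s\<close>
  operators. Each operator raises the degree by one, so degree 0 contains only 0. The recursion uses
  nothing but the action on \<open>M\<close>, so no ring has to be formed.\<close>

fun gideal :: "(nat \<Rightarrow> 'v \<Rightarrow> 'v) \<Rightarrow> (nat \<Rightarrow> 'v set) \<Rightarrow> nat \<Rightarrow> nat \<Rightarrow> 'v::real_vector set" where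
  "gideal \<theta> M 0 d = {0}"
| "gideal \<theta> M (Suc s) 0 = {0}"
| "gideal \<theta> M (Suc s) (Suc d) = {a + \<theta> s x | a x. a \<in> gideal \<theta> M s (Suc d) \<and> x \<in> M d}"

lemma gideal_0 [simp]: "gideal \<theta> M s 0 = {0}"
  by (cases s) auto

text \<open>Regular sequence in the sense of commutative algebra: each \<open>\<theta> t\<close> is
  injective on the quotient by the earlier operators.\<close>

definition regular :: "(nat \<Rightarrow> 'v \<Rightarrow> 'v) \<Rightarrow> (nat \<Rightarrow> 'v::real_vector set) \<Rightarrow> nat \<Rightarrow> bool" where
  "regular \<theta> M s \<longleftrightarrow> (\<forall>t<s. \<forall>d. \<forall>x\<in>M d. \<theta> t x \<in> gideal \<theta> M t (Suc d) \<longrightarrow> x \<in> gideal \<theta> M t d)"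

text \<open>On generating functions this is multiplication by 1/(1-t). It inverts the difference
  operator by which a regular linear form changes a Hilbert function.\<close>

definition psum :: "(nat \<Rightarrow> int) \<Rightarrow> nat \<Rightarrow> int" where "psum g d = (\<Sum>e\<le>d. g e)"

lemma psum_inj: "psum g = psum g' \<Longrightarrow> g = g'"
proof
  fix d assume "psum g = psum g'"
  then have "psum g d = psum g' d" "psum g (d - 1) = psum g' (d - 1)" by auto
  then show "g d = g' d" by (cases d) (auto simp: psum_def)
qed

lemma psum_pow_inj: "(psum ^^ k) g = (psum ^^ k) g' \<Longrightarrow> g = g'"
  by (induct k) (auto dest: psum_inj)

lemma psum_pow_mono: "(\<And>d. g d \<le> g' d) \<Longrightarrow> (psum ^^ k) g d \<le> (psum ^^ k) g' d"
  by (induct k arbitrary: d) (auto simp: psum_def intro: sum_mono)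

locale graded_module =
  fixes \<theta> :: "nat \<Rightarrow> 'v \<Rightarrow> 'v::real_vector" and M :: "nat \<Rightarrow> 'v set"
  assumes lin: "linear (\<theta> r)"
    and sub: "subspace (M d)"
    and fin: "fin_dim (M d)"
    and act: "x \<in> M d \<Longrightarrow> \<theta> r x \<in> M (Suc d)"
    and comm: "x \<in> M d \<Longrightarrow> \<theta> r (\<theta> s x) = \<theta> s (\<theta> r x)"
begin

abbreviation "I \<equiv> gideal \<theta> M"

lemma gideal_subspace: "subspace (I s d)" and gideal_subset: "I s d \<subseteq> M d"
proof (induct s arbitrary: d)
  case 0
  { case 1 show ?case by simp }
  { case 2 show ?case using subspace_0[OF sub] by simp }
next
  case (Suc s)
  { case 1 show ?case
      using subspace_sum_image[OF lin[of s] Suc.hyps(1) sub] by (cases d) auto }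
  { case 2 show ?case
    proof (cases d)
      case 0 then show ?thesis using subspace_0[OF sub] by simp
    next
      case (Suc e)
      have "a + \<theta> s x \<in> M (Suc e)" if "a \<in> I s (Suc e)" "x \<in> M e" for a x
        using that Suc.hyps(2)[of "Suc e"] by (intro subspace_add[OF sub] act) auto
      then show ?thesis using Suc by auto
    qed }
qed

lemma gideal_fin_dim: "fin_dim (I s d)"
  by (rule fin_dim_subset[OF fin gideal_subset])

lemma gideal_act: "x \<in> I s d \<Longrightarrow> \<theta> r x \<in> I s (Suc d)"
proof (induct s arbitrary: d x)
  case 0 then show ?case using linear_0[OF lin] by simp
next
  case (Suc s)
  show ?case
  proof (cases d)
    case 0 then show ?thesis using Suc.prems linear_0[OF lin] subspace_0[OF gideal_subspace[of "Suc s" "Suc 0"]] by simp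
  next
    case (Suc e)
    then obtain a y where *: "x = a + \<theta> s y" "a \<in> I s (Suc e)" "y \<in> M e" using Suc.prems by auto
    then have "\<theta> r x = \<theta> r a + \<theta> s (\<theta> r y)"
      using linear_add[OF lin] comm by metis
    then show ?thesis using Suc.hyps[OF *(2)] act[OF *(3)] Suc by auto
  qed
qed

lemma sum_in_gideal:
  "(\<And>r. r < s \<Longrightarrow> y r \<in> M d) \<Longrightarrow> (\<Sum>r<s. \<theta> r (y r)) \<in> I s (Suc d)"
  by (induct s) force+

lemma gideal_sumE:
  assumes "x \<in> I s (Suc d)"
  obtains y where "\<And>r. r < s \<Longrightarrow> y r \<in> M d" "x = (\<Sum>r<s. \<theta> r (y r))"
  using assms
proof (induct s arbitrary: x thesis)
  case 0 then show ?case by simp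
next
  case (Suc s)
  then obtain a w where x: "x = a + \<theta> s w" "a \<in> I s (Suc d)" "w \<in> M d" by auto
  obtain y where y: "\<And>r. r < s \<Longrightarrow> y r \<in> M d" "a = (\<Sum>r<s. \<theta> r (y r))"
    using Suc.hyps[OF _ x(2)] by blast
  show ?case
    by (rule Suc.prems(1)[of "y(s := w)"]) (use x y in \<open>auto simp: less_Suc_eq\<close>)
qed

text \<open>Hilbert function of the quotient of \<open>M\<close> by the first \<open>s\<close>
  operators, with integer values so that differences can be taken.\<close>

definition h :: "nat \<Rightarrow> nat \<Rightarrow> int" where
  "h s d = int (dim (M d)) - int (dim (I s d))"

lemma dim_zero: "dim {0::'v} = 0"
  using dim_le_card[of "{0::'v}" "{}"] by simp

lemma h_0 [simp]: "h 0 d = int (dim (M d))" and h_deg_0 [simp]: "h s 0 = int (dim (M 0))"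
  by (simp_all add: h_def dim_zero)

text \<open>Exact sequence of multiplication by \<open>\<theta> s\<close> on the quotient: the
  bracket is the dimension of its kernel in degree \<open>d\<close>.\<close>

lemma h_Suc: "h (Suc s) (Suc d) = h s (Suc d) - h s d +
   (int (dim {x \<in> M d. \<theta> s x \<in> I s (Suc d)}) - int (dim (I s d)))"
proof -
  have "dim (I (Suc s) (Suc d)) + dim {x \<in> M d. \<theta> s x \<in> I s (Suc d)} = dim (I s (Suc d)) + dim (M d)"
    using dim_sum_image(1)[OF lin gideal_subspace gideal_fin_dim sub fin, of s s "Suc d" d] by simp
  then show ?thesis by (simp add: h_def)
qed

lemma gideal_colon: "I s d \<subseteq> {x \<in> M d. \<theta> s x \<in> I s (Suc d)}"
  using gideal_subset gideal_act by blast

lemma colon_fin_dim: "fin_dim {x \<in> M d. \<theta> s x \<in> I s (Suc d)}"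
  by (rule fin_dim_subset[OF fin]) auto

lemma h_Suc_ge: "h s (Suc d) - h s d \<le> h (Suc s) (Suc d)"
  using h_Suc[of s d] fin_dim_mono[OF colon_fin_dim gideal_colon, of s d] by simp

lemma h_Suc_regular:
  assumes "regular \<theta> M q" "s < q"
  shows "h (Suc s) (Suc d) = h s (Suc d) - h s d"
proof -
  have "{x \<in> M d. \<theta> s x \<in> I s (Suc d)} = I s d"
    using gideal_colon[of s d] assms by (auto simp: regular_def)
  then show ?thesis using h_Suc[of s d] by simp
qed

lemma h_le_psum: "h s d \<le> psum (h (Suc s)) d"
proof (induct d)
  case 0 then show ?case by (simp add: psum_def)
next
  case (Suc d) then show ?case using h_Suc_ge[of s d] by (simp add: psum_def)
qed

text \<open>After iterated partial summation the inequalities \<open>h s \<le> psum (h (Suc s))\<close> form a chain with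
  equal ends.\<close>

lemma regular_by_count:
  assumes top: "\<And>d. I q (Suc d) = M (Suc d)"
    and count: "\<And>d. int (dim (M d)) = c * (psum ^^ q) (\<lambda>e. if e = 0 then 1 else 0) d"
  shows "regular \<theta> M q"
proof -
  let ?A = "\<lambda>s. (psum ^^ s) (h s)"
  have step: "?A s d \<le> ?A (Suc s) d" for s d
    unfolding funpow_Suc_right o_def by (rule psum_pow_mono) (rule h_le_psum)
  have mono: "?A s d \<le> ?A t d" if "s \<le> t" for s t d
    using lift_Suc_mono_le[of "\<lambda>s. ?A s d"] step that by blast
  have c: "int (dim (M 0)) = c"
  proof -
    have "(psum ^^ q) (\<lambda>e. if e = 0 then 1 else 0) 0 = 1"
      by (induct q) (auto simp: psum_def)
    then show ?thesis using count[of 0] by simp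
  qed
  have hq: "h q = (\<lambda>e. c * (if e = 0 then 1 else 0))"
  proof
    fix e show "h q e = c * (if e = 0 then 1 else 0)"
      using c top by (cases e) (simp_all add: h_def dim_zero)
  qed
  have scal: "(psum ^^ k) (\<lambda>e. c * g e) = (\<lambda>d. c * (psum ^^ k) g d)" for k g
    by (induct k) (auto simp: psum_def sum_distrib_left)
  have "?A q d = ?A 0 d" for d
    by (simp add: hq scal count)
  then have eq: "?A s = ?A (Suc s)" if "s < q" for s
    using mono[of 0 s] mono[of "Suc s" q] step[of s] that by (intro ext) (smt (verit) Suc_leI zero_le)
  have heq: "h s = psum (h (Suc s))" if "s < q" for s
    using eq[OF that] unfolding funpow_Suc_right o_def by (rule psum_pow_inj)
  have "x \<in> I s d" if "s < q" "x \<in> M d" "\<theta> s x \<in> I s (Suc d)" for s d x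
  proof -
    have "h s (Suc d) = h s d + h (Suc s) (Suc d)"
      using heq[OF that(1)] by (metis psum_def sum.atMost_Suc)
    then have "int (dim {x \<in> M d. \<theta> s x \<in> I s (Suc d)}) = int (dim (I s d))"
      using h_Suc[of s d] by simp
    then have "I s d = {x \<in> M d. \<theta> s x \<in> I s (Suc d)}"
      by (intro fin_dim_eqI[OF colon_fin_dim gideal_colon gideal_subspace]) simp
    then show ?thesis using that by blast
  qed
  then show ?thesis by (auto simp: regular_def)
qed

end

text \<open>The depth lemma for \<open>0 \<rightarrow> ker D \<rightarrow> M \<rightarrow> D M
  \<rightarrow> 0\<close>. Regularity on the image shows that an element of the kernel lying in the
  ideal times \<open>M\<close> already lies in the ideal times the kernel; injectivity is then
  inherited from \<open>M\<close>.\<close>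

lemma regular_kernel:
  assumes M: "graded_module \<theta> M" and D: "linear D"
    and comm: "\<And>r d x. x \<in> M d \<Longrightarrow> D (\<theta> r x) = \<theta> r (D x)"
    and regN: "regular \<theta> (\<lambda>d. D ` M d) s" and regM: "regular \<theta> M (Suc s)"
  shows "regular \<theta> (\<lambda>d. {x \<in> M d. D x = 0}) (Suc s)"
proof -
  interpret M: graded_module \<theta> M by (rule M)
  let ?K = "\<lambda>d. {x \<in> M d. D x = 0}" and ?N = "\<lambda>d. D ` M d"
  have IN: "gideal \<theta> ?N t d = D ` gideal \<theta> M t d" for t d
  proof (induct t arbitrary: d)
    case 0 then show ?case using linear_0[OF D] by simp
  next
    case (Suc t)
    show ?case
    proof (cases d)
      case 0 then show ?thesis using linear_0[OF D] by simp
    next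
      case (Suc e)
      show ?thesis unfolding Suc gideal.simps Suc.hyps
      proof (rule Set.set_eqI, rule iffI)
        fix y assume "y \<in> {a + \<theta> t x |a x. a \<in> D ` gideal \<theta> M t (Suc e) \<and> x \<in> D ` M e}"
        then obtain a x where "y = D a + \<theta> t (D x)" "a \<in> gideal \<theta> M t (Suc e)" "x \<in> M e" by blast
        moreover then have "y = D (a + \<theta> t x)" by (simp add: linear_add[OF D] comm)
        ultimately show "y \<in> D ` {a + \<theta> t x |a x. a \<in> gideal \<theta> M t (Suc e) \<and> x \<in> M e}" by blast
      next
        fix y assume "y \<in> D ` {a + \<theta> t x |a x. a \<in> gideal \<theta> M t (Suc e) \<and> x \<in> M e}"
        then obtain a x where "y = D (a + \<theta> t x)" "a \<in> gideal \<theta> M t (Suc e)" "x \<in> M e" by blast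
        moreover then have "y = D a + \<theta> t (D x)" by (simp add: linear_add[OF D] comm)
        ultimately show "y \<in> {a + \<theta> t x |a x. a \<in> D ` gideal \<theta> M t (Suc e) \<and> x \<in> D ` M e}" by blast
      qed
    qed
  qed
  have KM: "gideal \<theta> ?K t d \<subseteq> gideal \<theta> M t d" for t d
  proof (induct t arbitrary: d)
    case (Suc t)
    show ?case
    proof (cases d)
      case (Suc e)
      show ?thesis unfolding Suc gideal.simps using Suc.hyps[of "Suc e"] by blast
    qed simp
  qed simp
  \<comment> \<open>The passage from \<open>t\<close> to \<open>Suc t \<le> s\<close> uses
    regularity on the image at the index \<open>t < s\<close> only, so one operator more can be
    handled than is regular there.\<close>
  have key: "x \<in> gideal \<theta> ?K t d" if "t \<le> s" "x \<in> gideal \<theta> M t d" "D x = 0" for t d x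
    using that
  proof (induct t arbitrary: d x)
    case 0 then show ?case by simp
  next
    case (Suc t)
    show ?case
    proof (cases d)
      case 0 then show ?thesis using Suc.prems by simp
    next
      case (Suc e)
      then obtain a y where x: "x = a + \<theta> t y" and a: "a \<in> gideal \<theta> M t (Suc e)" and y: "y \<in> M e"
        using Suc.prems(2) by auto
      have "\<theta> t (D y) = - D a"
        using Suc.prems(3) x y by (simp add: linear_add[OF D] comm eq_neg_iff_add_eq_0 add.commute)
      also have "\<dots> = D (- a)" by (simp add: linear_neg[OF D])
      also have "\<dots> \<in> gideal \<theta> ?N t (Suc e)"
        unfolding IN using subspace_neg[OF M.gideal_subspace a] by blast
      finally have "D y \<in> gideal \<theta> ?N t e"
        using regN y Suc.prems(1) by (auto simp: regular_def)
      then obtain b where b: "b \<in> gideal \<theta> M t e" "D y = D b" unfolding IN by blast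
      \<comment> \<open>\<open>y\<close> need not lie in the kernel. It is corrected by a lift
        \<open>b\<close> with the same image, and \<open>\<theta> t b\<close> is absorbed into the
        earlier summand.\<close>
      define k where "k = y - b"
      have bM: "b \<in> M e" using b(1) M.gideal_subset by blast
      have k: "k \<in> ?K e"
        using subspace_diff[OF M.sub y bM] b(2) by (simp add: k_def linear_diff[OF D])
      define a' where "a' = a + \<theta> t b"
      have xa: "x = a' + \<theta> t k"
        unfolding x a'_def k_def by (simp add: linear_diff[OF M.lin])
      have "D (\<theta> t k) = 0" using comm[of k e t] k linear_0[OF M.lin] by simp
      then have "D a' = 0" using Suc.prems(3) xa by (simp add: linear_add[OF D])
      moreover have "a' \<in> gideal \<theta> M t (Suc e)"
        unfolding a'_def by (rule subspace_add[OF M.gideal_subspace a M.gideal_act[OF b(1)]])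
      ultimately have "a' \<in> gideal \<theta> ?K t (Suc e)"
        using Suc.hyps Suc.prems(1) by simp
      then show ?thesis unfolding Suc gideal.simps using xa k by blast
    qed
  qed
  show ?thesis
    unfolding regular_def
  proof (intro allI impI ballI)
    fix t d x
    assume t: "t < Suc s" and x: "x \<in> ?K d" and i: "\<theta> t x \<in> gideal \<theta> ?K t (Suc d)"
    have "x \<in> gideal \<theta> M t d"
      using regM t x i KM unfolding regular_def by blast
    then show "x \<in> gideal \<theta> ?K t d" using key t x by simp
  qed
qed

section \<open>Homology spheres\<close>

abbreviation basis_elem :: "'b \<Rightarrow> ('b \<Rightarrow>\<^sub>0 real)" where
  "basis_elem a \<equiv> single a 1"

lemma scaleR_single [simp]: "c *\<^sub>R single a (r::real) = single a (c * r)"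
  by (rule poly_mapping_eqI) (simp add: lookup_single_one)

lemma boundary_lin_ext:
  "boundary = lin_ext (\<lambda>I. \<Sum>i\<in>I. vertex_sign I i *\<^sub>R basis_elem (I - {i}))"
  unfolding boundary_def lin_ext_def by (simp add: scaleR_sum_right mult.commute)

lemma linear_boundary: "linear boundary"
  unfolding boundary_lin_ext by (rule linear_lin_ext)

lemma boundary_basis: "boundary (basis_elem I) = (\<Sum>i\<in>I. vertex_sign I i *\<^sub>R basis_elem (I - {i}))"
  unfolding boundary_lin_ext by simp

lemma vertex_sign_remove:
  assumes "finite I" "i \<in> I" "j \<in> I" "i < j"
  shows "vertex_sign (I - {i}) j = - vertex_sign I j" "vertex_sign (I - {j}) i = vertex_sign I i"
proof -
  have "{l \<in> I. l < j} = insert i {l \<in> I - {i}. l < j}" using assms by auto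
  then have "card {l \<in> I. l < j} = Suc (card {l \<in> I - {i}. l < j})"
    using assms(1) by (simp add: card_insert_if)
  then show "vertex_sign (I - {i}) j = - vertex_sign I j" by (simp add: vertex_sign_def)
  have "{l \<in> I. l < i} = {l \<in> I - {j}. l < i}" using assms by auto
  then show "vertex_sign (I - {j}) i = vertex_sign I i" by (simp add: vertex_sign_def)
qed

lemma boundary_boundary_basis:
  assumes "finite I"
  shows "boundary (boundary (basis_elem I)) = 0"
proof -
  let ?t = "\<lambda>i j. (vertex_sign I i * vertex_sign (I - {i}) j) *\<^sub>R basis_elem (I - {i} - {j})"
  let ?P = "{(i, j). i \<in> I \<and> j \<in> I \<and> i < j}" and ?Q = "{(i, j). i \<in> I \<and> j \<in> I \<and> j < i}"
  have "boundary (boundary (basis_elem I)) = (\<Sum>i\<in>I. \<Sum>j\<in>I - {i}. ?t i j)"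
    by (simp only: boundary_basis linear_sum[OF linear_boundary] linear_scale[OF linear_boundary]
        scaleR_sum_right scaleR_scaleR)
  also have "\<dots> = (\<Sum>(i, j)\<in>Sigma I (\<lambda>i. I - {i}). ?t i j)"
    by (rule sum.Sigma) (use assms in auto)
  also have "Sigma I (\<lambda>i. I - {i}) = ?P \<union> ?Q" by auto
  also have "(\<Sum>(i, j)\<in>?P \<union> ?Q. ?t i j) = (\<Sum>(i, j)\<in>?P. ?t i j) + (\<Sum>(i, j)\<in>?Q. ?t i j)"
    by (rule sum.union_disjoint)
       (use assms in \<open>auto intro: finite_subset[of _ "I \<times> I"]\<close>)
  also have "(\<Sum>(i, j)\<in>?Q. ?t i j) = (\<Sum>(i, j)\<in>?P. ?t j i)"
    by (rule sum.reindex_bij_witness[of _ prod.swap prod.swap]) auto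
  also have "(\<Sum>(i, j)\<in>?P. ?t i j) + (\<Sum>(i, j)\<in>?P. ?t j i) = (\<Sum>p\<in>?P. 0)"
    unfolding sum.distrib[symmetric]
  proof (rule sum.cong[OF refl])
    fix p assume "p \<in> ?P"
    then obtain i j where p: "p = (i, j)" "i \<in> I" "j \<in> I" "i < j" by auto
    have "I - {i} - {j} = I - {j} - {i}" by auto
    then have "?t i j = - ?t j i"
      using vertex_sign_remove[OF assms p(2-4)] by (simp add: mult.commute flip: single_uminus)
    then show "(case p of (i, j) \<Rightarrow> ?t i j) + (case p of (i, j) \<Rightarrow> ?t j i) = 0"
      unfolding p(1) prod.case by (simp only: add.left_inverse)
  qed
  finally show ?thesis by simp
qed

lemma boundary_boundary:
  assumes "\<And>I. I \<in> keys z \<Longrightarrow> finite I"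
  shows "boundary (boundary z) = 0"
proof -
  have "z \<in> coords {I. finite I}" using assms by (auto simp: coords_def)
  then have "(boundary \<circ> boundary) z = 0"
    using linear_eq_on_coords[OF linear_compose[OF linear_boundary linear_boundary] linear_zero,
        of "{I. finite I}" z] by (simp add: boundary_boundary_basis)
  then show ?thesis by simp
qed

lemma chains_coords: "chains K p = coords {\<sigma> \<in> K. card \<sigma> = p}"
  by (simp add: chains_def supported_in_def coords_def)

lemma simplicial_complex_link:
  assumes "simplicial_complex K" "\<sigma> \<in> K"
  shows "simplicial_complex (complex_link K \<sigma>)"
  unfolding simplicial_complex_def
proof (intro conjI ballI allI impI)
  show "finite (complex_link K \<sigma>)" "{} \<in> complex_link K \<sigma>"
    using assms by (auto simp: simplicial_complex_def complex_link_def)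
  fix \<tau> assume \<tau>: "\<tau> \<in> complex_link K \<sigma>"
  show "finite \<tau>" using \<tau> assms by (auto simp: simplicial_complex_def complex_link_def)
  fix \<rho> assume "\<rho> \<subseteq> \<tau>"
  then have "\<rho> \<union> \<sigma> \<subseteq> \<tau> \<union> \<sigma>" by auto
  then show "\<rho> \<in> complex_link K \<sigma>"
    using \<tau> \<open>\<rho> \<subseteq> \<tau>\<close> assms by (auto simp: simplicial_complex_def complex_link_def)
qed

lemma boundary_chain:
  assumes K: "simplicial_complex K" and z: "z \<in> chains K (Suc p)"
  shows "boundary z \<in> chains K p"
  unfolding boundary_lin_ext chains_coords
proof (rule lin_ext_in_subspace[OF subspace_coords])
  show "z \<in> coords {\<sigma> \<in> K. card \<sigma> = Suc p}" using z by (simp add: chains_coords)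
  fix \<sigma> assume "\<sigma> \<in> {\<sigma> \<in> K. card \<sigma> = Suc p}"
  then show "(\<Sum>i\<in>\<sigma>. vertex_sign \<sigma> i *\<^sub>R basis_elem (\<sigma> - {i})) \<in> coords {\<sigma> \<in> K. card \<sigma> = p}"
    using K by (intro subspace_sum subspace_scale subspace_coords single_in_coords)
      (auto simp: simplicial_complex_def)
qed

lemma boundary_chain_0:
  assumes K: "simplicial_complex K" and z: "z \<in> chains K 0"
  shows "boundary z = 0"
proof -
  have "boundary z = (\<lambda>_. 0) z"
  proof (rule linear_eq_on_coords[OF linear_boundary linear_zero])
    show "z \<in> coords {{}}"
      using K z unfolding chains_coords coords_def simplicial_complex_def by (auto simp: subset_iff)
  qed (simp add: boundary_basis)
  then show ?thesis by simp
qed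

lemma fin_dim_chains: "simplicial_complex K \<Longrightarrow> fin_dim (chains K p)"
  unfolding chains_coords by (rule fin_dim_coords) (auto simp: simplicial_complex_def)

lemma subspace_cycles: "subspace (cycles K p)"
  unfolding cycles_def chains_coords by (rule subspace_kernel_on[OF linear_boundary subspace_coords])

lemma subspace_boundaries: "subspace (boundaries K p)"
  unfolding boundaries_def chains_coords by (rule linear_subspace_image[OF linear_boundary subspace_coords])

lemma boundaries_subset_cycles:
  assumes "simplicial_complex K"
  shows "boundaries K p \<subseteq> cycles K p"
proof -
  have "boundary (boundary z) = 0" if "z \<in> chains K (Suc p)" for z
  proof (rule boundary_boundary)
    fix I assume "I \<in> keys z"
    then have "I \<in> K" using that unfolding chains_def supported_in_def by blast
    then show "finite I" using assms unfolding simplicial_complex_def by blast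
  qed
  then show ?thesis
    unfolding boundaries_def cycles_def by (auto intro: boundary_chain[OF assms])
qed

text \<open>The truncated difference in \<open>reduced_betti\<close> being 0 says only that the
  boundaries have at least the dimension of the cycles; the inclusion turns this into
  equality.\<close>

lemma cycles_eq_boundaries:
  assumes "simplicial_complex K" "reduced_betti K p = 0"
  shows "cycles K p = boundaries K p"
proof -
  have "fin_dim (cycles K p)"
    by (rule fin_dim_subset[OF fin_dim_chains[OF assms(1), of p]]) (auto simp: cycles_def)
  then have "boundaries K p = cycles K p"
    using assms(2) by (intro fin_dim_eqI[OF _ boundaries_subset_cycles[OF assms(1)] subspace_boundaries])
      (simp_all add: reduced_betti_def)
  then show ?thesis by simp
qed

locale sphere =
  fixes m :: nat and L :: "'a::linorder set set" and z :: "'a set \<Rightarrow>\<^sub>0 real"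
  assumes sphere: "homology_sphere m L" and fund: "fundamental_cycle m L z"
begin

lemma complex: "simplicial_complex L" using sphere by (simp add: homology_sphere_def)

lemma finite_L: "finite L" and empty_L: "{} \<in> L" and finite_face: "\<sigma> \<in> L \<Longrightarrow> finite \<sigma>"
  and face_subset: "\<sigma> \<in> L \<Longrightarrow> \<tau> \<subseteq> \<sigma> \<Longrightarrow> \<tau> \<in> L"
  using complex by (auto simp: simplicial_complex_def)

lemma betti: "\<sigma> \<in> L \<Longrightarrow> reduced_betti (complex_link L \<sigma>) p = (if p + card \<sigma> = m then 1 else 0)"
  using sphere by (simp add: homology_sphere_def)

text \<open>A maximal face has link \<open>{{}}\<close>, whose Betti number in index 0 is 1.
  Comparison with the sphere condition forces the face to have exactly \<open>m\<close>
  vertices.\<close>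

lemma pure:
  assumes "\<sigma> \<in> L"
  obtains \<tau> where "\<tau> \<in> L" "\<sigma> \<subseteq> \<tau>" "card \<tau> = m"
proof -
  have "finite {\<tau> \<in> L. \<sigma> \<subseteq> \<tau>}" using finite_L by simp
  then obtain \<tau> where \<tau>': "\<tau> \<in> {\<tau> \<in> L. \<sigma> \<subseteq> \<tau>}" and mx': "\<forall>\<rho>\<in>{\<tau> \<in> L. \<sigma> \<subseteq> \<tau>}. \<tau> \<subseteq> \<rho> \<longrightarrow> \<tau> = \<rho>"
    using finite_has_maximal2[of "{\<tau> \<in> L. \<sigma> \<subseteq> \<tau>}" \<sigma>] assms by auto
  from \<tau>' have \<tau>: "\<tau> \<in> L" "\<sigma> \<subseteq> \<tau>" by auto
  have mx: "\<rho> = \<tau>" if "\<rho> \<in> L" "\<tau> \<subseteq> \<rho>" for \<rho>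
    using mx'[rule_format, of \<rho>] that \<tau>(2) by auto
  have lk: "complex_link L \<tau> = {{}}"
  proof -
    have "\<rho> = {}" if "\<rho> \<in> complex_link L \<tau>" for \<rho>
      using that mx[of "\<rho> \<union> \<tau>"] by (auto simp: complex_link_def)
    moreover have "{} \<in> complex_link L \<tau>" using \<tau> empty_L by (simp add: complex_link_def)
    ultimately show ?thesis by blast
  qed
  have c0: "{\<sigma> \<in> {{}::'a set}. card \<sigma> = 0} = {{}}" and c1: "{\<sigma> \<in> {{}::'a set}. card \<sigma> = Suc 0} = {}"
    by auto
  have "cycles {{}::'a set} 0 = coords {{}}"
  proof -
    have "boundary f = 0" if "f \<in> coords {{}}" for f :: "'a set \<Rightarrow>\<^sub>0 real"
    proof -
      have "boundary f = (\<lambda>_. 0) f"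
        by (rule linear_eq_on_coords[OF linear_boundary linear_zero _ that]) (simp add: boundary_basis)
      then show ?thesis by simp
    qed
    moreover have "chains {{}::'a set} 0 = coords {{}}" unfolding chains_coords c0 ..
    ultimately show ?thesis unfolding cycles_def by blast
  qed
  then have "dim (cycles {{}::'a set} 0) = 1" by (simp add: dim_coords)
  moreover have "dim (boundaries {{}::'a set} 0) = 0"
  proof -
    have "chains {{}::'a set} (Suc 0) \<subseteq> {0}" unfolding chains_coords c1 by (auto simp: coords_def)
    then have "boundaries {{}::'a set} 0 \<subseteq> {0}"
      using linear_0[OF linear_boundary] by (auto simp: boundaries_def)
    then show ?thesis using dim_le_card[of "boundaries {{}::'a set} 0" "{}"] by simp
  qed
  ultimately have "reduced_betti (complex_link L \<tau>) 0 = 1" by (simp add: lk reduced_betti_def)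
  then have "card \<tau> = m" using betti[OF \<tau>(1), of 0] by (metis add_0 zero_neq_one)
  then show ?thesis by (rule that[OF \<tau>])
qed

lemma card_face_le: "\<sigma> \<in> L \<Longrightarrow> card \<sigma> \<le> m"
  by (metis card_mono finite_face pure)

definition facets :: "'a set set" where "facets = {\<sigma> \<in> L. card \<sigma> = m}"

lemma z_facets: "z \<in> coords facets" and z_boundary: "boundary z = 0"
  using fund by (auto simp: fundamental_cycle_def cycles_def chains_coords facets_def)

lemma z_nonzero: "\<sigma> \<in> facets \<Longrightarrow> lookup z \<sigma> \<noteq> 0"
  using fund by (fastforce simp: fundamental_cycle_def facets_def)

section \<open>Open stars of faces and their homology\<close>

definition star :: "'a set \<Rightarrow> nat \<Rightarrow> 'a set set" where
  "star S p = {\<sigma> \<in> L. S \<subseteq> \<sigma> \<and> card \<sigma> = p}"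

text \<open>Only vertices outside \<open>S\<close> are removed, so on chains of \<open>L\<close>
  this is the boundary of the relative complex modulo the faces not containing \<open>S\<close>. Up
  to signs and a shift by \<open>card S\<close> it is the augmented complex of the link of
  \<open>S\<close>.\<close>

definition star_bd :: "'a set \<Rightarrow> ('a set \<Rightarrow>\<^sub>0 real) \<Rightarrow> ('a set \<Rightarrow>\<^sub>0 real)" where
  "star_bd S = lin_ext (\<lambda>\<sigma>. \<Sum>i\<in>\<sigma> - S. vertex_sign \<sigma> i *\<^sub>R basis_elem (\<sigma> - {i}))"

lemma linear_star_bd: "linear (star_bd S)" unfolding star_bd_def by (rule linear_lin_ext)

definition twist :: "'a set \<Rightarrow> 'a set \<Rightarrow> real" where
  "twist S \<tau> = (-1) ^ card {(s, i). s \<in> S \<and> i \<in> \<tau> \<and> s < i}"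

lemma twist_sq: "twist S \<tau> * twist S \<tau> = 1"
  by (simp add: twist_def flip: power_add mult_2)

text \<open>The sign of a shuffle makes joining with \<open>S\<close> a chain map from the link of \<open>S\<close> to its star.\<close>

lemma twist_remove:
  assumes "finite S" "finite \<tau>" "S \<inter> \<tau> = {}" "i \<in> \<tau>"
  shows "vertex_sign (\<tau> \<union> S) i * twist S \<tau> = twist S (\<tau> - {i}) * vertex_sign \<tau> i"
proof -
  have "{j \<in> \<tau> \<union> S. j < i} = {j \<in> \<tau>. j < i} \<union> {j \<in> S. j < i}" by auto
  then have 1: "card {j \<in> \<tau> \<union> S. j < i} = card {j \<in> \<tau>. j < i} + card {j \<in> S. j < i}"
    using assms by (subst card_Un_disjoint[symmetric]) auto
  have "{(s, l). s \<in> S \<and> l \<in> \<tau> \<and> s < l} =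
      {(s, l). s \<in> S \<and> l \<in> \<tau> - {i} \<and> s < l} \<union> (\<lambda>s. (s, i)) ` {j \<in> S. j < i}"
    using assms by auto
  moreover have "finite {(s, l). s \<in> S \<and> l \<in> \<tau> - {i} \<and> s < l}"
    by (rule finite_subset[of _ "S \<times> \<tau>"]) (use assms in auto)
  ultimately have 2: "card {(s, l). s \<in> S \<and> l \<in> \<tau> \<and> s < l} =
      card {(s, l). s \<in> S \<and> l \<in> \<tau> - {i} \<and> s < l} + card {j \<in> S. j < i}"
    using assms by (simp only:) (subst card_Un_disjoint, auto simp: card_image inj_on_def)
  have sq: "(-1::real) ^ c * (-1) ^ c = 1" for c :: nat by (simp flip: power_add mult_2)
  have "vertex_sign (\<tau> \<union> S) i * twist S \<tau> =
     vertex_sign \<tau> i * twist S (\<tau> - {i}) * ((-1) ^ card {j \<in> S. j < i} * (-1) ^ card {j \<in> S. j < i})"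
    by (simp only: vertex_sign_def twist_def 1 2 power_add mult_ac)
  then show ?thesis by (simp add: sq mult.commute)
qed

definition join :: "'a set \<Rightarrow> ('a set \<Rightarrow>\<^sub>0 real) \<Rightarrow> ('a set \<Rightarrow>\<^sub>0 real)" where
  "join S = lin_ext (\<lambda>\<tau>. twist S \<tau> *\<^sub>R basis_elem (\<tau> \<union> S))"

text \<open>Inverse of \<open>join S\<close> between chains of the star and of the link; the signs
  are their own inverses.\<close>

definition unjoin :: "'a set \<Rightarrow> ('a set \<Rightarrow>\<^sub>0 real) \<Rightarrow> ('a set \<Rightarrow>\<^sub>0 real)" where
  "unjoin S = lin_ext (\<lambda>\<sigma>. twist S (\<sigma> - S) *\<^sub>R basis_elem (\<sigma> - S))"

lemma linear_join: "linear (join S)" and linear_unjoin: "linear (unjoin S)"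
  unfolding join_def unjoin_def by (rule linear_lin_ext)+

lemma join_unjoin:
  assumes "f \<in> coords (star S p)"
  shows "join S (unjoin S f) = f"
proof -
  have "(join S \<circ> unjoin S) f = id f"
  proof (rule linear_eq_on_coords[OF linear_compose[OF linear_unjoin linear_join] linear_id _ assms])
    fix \<sigma> assume "\<sigma> \<in> star S p"
    then have "\<sigma> - S \<union> S = \<sigma>" by (auto simp: star_def)
    then show "(join S \<circ> unjoin S) (basis_elem \<sigma>) = id (basis_elem \<sigma>)"
      by (simp add: join_def unjoin_def twist_sq)
  qed
  then show ?thesis by simp
qed

lemma unjoin_join:
  assumes "f \<in> chains (complex_link L S) p"
  shows "unjoin S (join S f) = f"
proof -
  have "(unjoin S \<circ> join S) f = id f"
  proof (rule linear_eq_on_coords[OF linear_compose[OF linear_join linear_unjoin] linear_id])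
    show "f \<in> coords {\<sigma> \<in> complex_link L S. card \<sigma> = p}" using assms by (simp add: chains_coords)
    fix \<tau> assume "\<tau> \<in> {\<sigma> \<in> complex_link L S. card \<sigma> = p}"
    then have "\<tau> \<union> S - S = \<tau>" by (auto simp: complex_link_def)
    then show "(unjoin S \<circ> join S) (basis_elem \<tau>) = id (basis_elem \<tau>)"
      by (simp add: join_def unjoin_def twist_sq)
  qed
  then show ?thesis by simp
qed

lemma star_bd_join:
  assumes S: "S \<in> L" and f: "f \<in> chains (complex_link L S) p"
  shows "star_bd S (join S f) = join S (boundary f)"
proof -
  have "(star_bd S \<circ> join S) f = (join S \<circ> boundary) f"
  proof (rule linear_eq_on_coords[OF linear_compose[OF linear_join linear_star_bd]
        linear_compose[OF linear_boundary linear_join]])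
    show "f \<in> coords {\<sigma> \<in> complex_link L S. card \<sigma> = p}" using f by (simp add: chains_coords)
    fix \<tau> assume "\<tau> \<in> {\<sigma> \<in> complex_link L S. card \<sigma> = p}"
    then have \<tau>: "finite \<tau>" "S \<inter> \<tau> = {}" "\<tau> \<union> S - S = \<tau>"
      using finite_face by (auto simp: complex_link_def)
    have "(star_bd S \<circ> join S) (basis_elem \<tau>) =
        (\<Sum>i\<in>\<tau>. (vertex_sign (\<tau> \<union> S) i * twist S \<tau>) *\<^sub>R basis_elem (\<tau> \<union> S - {i}))"
      by (simp add: join_def star_bd_def linear_scale[OF linear_lin_ext] \<tau>(3) scaleR_sum_right mult_ac
          flip: scaleR_single[of "twist S \<tau>"] del: scaleR_single)
    also have "\<dots> = (\<Sum>i\<in>\<tau>. (twist S (\<tau> - {i}) * vertex_sign \<tau> i) *\<^sub>R basis_elem (\<tau> - {i} \<union> S))"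
    proof (rule sum.cong[OF refl])
      fix i assume i: "i \<in> \<tau>"
      then have "\<tau> \<union> S - {i} = \<tau> - {i} \<union> S" using \<tau> by auto
      then show "(vertex_sign (\<tau> \<union> S) i * twist S \<tau>) *\<^sub>R basis_elem (\<tau> \<union> S - {i}) =
          (twist S (\<tau> - {i}) * vertex_sign \<tau> i) *\<^sub>R basis_elem (\<tau> - {i} \<union> S)"
        using twist_remove[OF finite_face[OF S] \<tau>(1,2) i] by simp
    qed
    also have "\<dots> = (join S \<circ> boundary) (basis_elem \<tau>)"
      by (simp add: boundary_basis linear_sum[OF linear_join]) (simp add: join_def mult_ac)
    finally show "(star_bd S \<circ> join S) (basis_elem \<tau>) = (join S \<circ> boundary) (basis_elem \<tau>)" .
  qed
  then show ?thesis by simp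
qed

lemma unjoin_chain:
  assumes "S \<in> L" "f \<in> coords (star S p)"
  shows "unjoin S f \<in> chains (complex_link L S) (p - card S)"
  unfolding unjoin_def chains_coords
proof (rule lin_ext_in_subspace[OF subspace_coords _ assms(2)])
  fix \<sigma> assume \<sigma>: "\<sigma> \<in> star S p"
  then have "\<sigma> - S \<union> S = \<sigma>" by (auto simp: star_def)
  moreover have "card (\<sigma> - S) = p - card S"
    using \<sigma> finite_face[OF assms(1)] by (auto simp: star_def card_Diff_subset)
  ultimately have "\<sigma> - S \<in> {\<sigma> \<in> complex_link L S. card \<sigma> = p - card S}"
    using \<sigma> face_subset[of \<sigma> "\<sigma> - S"] by (auto simp: star_def complex_link_def)
  then show "twist S (\<sigma> - S) *\<^sub>R basis_elem (\<sigma> - S) \<in> coords {\<sigma> \<in> complex_link L S. card \<sigma> = p - card S}"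
    by (intro subspace_scale subspace_coords single_in_coords)
qed

lemma join_star:
  assumes "S \<in> L" "f \<in> chains (complex_link L S) p"
  shows "join S f \<in> coords (star S (p + card S))"
  unfolding join_def
proof (rule lin_ext_in_subspace[OF subspace_coords])
  show "f \<in> coords {\<sigma> \<in> complex_link L S. card \<sigma> = p}" using assms(2) by (simp add: chains_coords)
  fix \<tau> assume \<tau>: "\<tau> \<in> {\<sigma> \<in> complex_link L S. card \<sigma> = p}"
  then have "\<tau> \<union> S \<in> star S (p + card S)"
    using finite_face[OF assms(1)] finite_face[of \<tau>]
    by (auto simp: star_def complex_link_def card_Un_disjoint)
  then show "twist S \<tau> *\<^sub>R basis_elem (\<tau> \<union> S) \<in> coords (star S (p + card S))"
    by (intro subspace_scale subspace_coords single_in_coords)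
qed

lemma unjoin_cycle:
  assumes S: "S \<in> L" and f: "f \<in> coords (star S p)" and 0: "star_bd S f = 0"
  shows "unjoin S f \<in> cycles (complex_link L S) (p - card S)"
proof -
  let ?c = "unjoin S f"
  have c: "?c \<in> chains (complex_link L S) (p - card S)" by (rule unjoin_chain[OF S f])
  have lk: "simplicial_complex (complex_link L S)" by (rule simplicial_complex_link[OF complex S])
  have "join S (boundary ?c) = 0"
    using star_bd_join[OF S c] join_unjoin[OF f] 0 by simp
  \<comment> \<open>In index 0 the boundary of a multiple of the empty simplex is 0, so the
    truncated index \<open>p - card S - 1\<close> does no harm.\<close>
  moreover have "boundary ?c \<in> chains (complex_link L S) (p - card S - 1)"
  proof (cases "p - card S")
    case (Suc q)
    then show ?thesis using boundary_chain[OF lk, of ?c q] c by simp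
  next
    case 0
    have "boundary ?c = 0" using boundary_chain_0[OF lk] c 0 by simp
    then show ?thesis using subspace_0[OF subspace_coords] by (simp add: chains_coords)
  qed
  ultimately have "boundary ?c = 0"
    using unjoin_join[of "boundary ?c" S] linear_0[OF linear_unjoin, of S] by simp
  then show ?thesis using c by (simp add: cycles_def)
qed

text \<open>The link of \<open>S\<close> has homology only in index \<open>m - card S\<close>, and
  joining with \<open>S\<close> carries the vanishing below it over to the star. If
  \<open>p < card S\<close>, the star has no simplex at all.\<close>

lemma star_exact:
  assumes S: "S \<in> L" and p: "p < m" and f: "f \<in> coords (star S p)" and 0: "star_bd S f = 0"
  obtains g where "g \<in> coords (star S (Suc p))" "star_bd S g = f"
proof (cases "card S \<le> p")
  case True
  let ?K = "complex_link L S"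
  have "reduced_betti ?K (p - card S) = 0"
    using betti[OF S, of "p - card S"] True p by simp
  then have "unjoin S f \<in> boundaries ?K (p - card S)"
    using unjoin_cycle[OF S f 0] cycles_eq_boundaries[OF simplicial_complex_link[OF complex S]] by blast
  then obtain b where b: "b \<in> chains ?K (Suc (p - card S))" "unjoin S f = boundary b"
    unfolding boundaries_def by blast
  have "star_bd S (join S b) = f"
    using star_bd_join[OF S b(1)] b(2) join_unjoin[OF f] by simp
  moreover have "join S b \<in> coords (star S (Suc p))"
    using join_star[OF S b(1)] True by simp
  ultimately show ?thesis using that by blast
next
  case False
  have "star S p = {}"
  proof (rule ccontr)
    assume "star S p \<noteq> {}"
    then obtain \<sigma> where "\<sigma> \<in> L" "S \<subseteq> \<sigma>" "card \<sigma> = p" by (auto simp: star_def)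
    then show False using False card_mono[OF finite_face] by blast
  qed
  then have "f = 0" using f by (simp add: coords_def)
  then have "star_bd S 0 = f" using linear_0[OF linear_star_bd] by simp
  with subspace_0[OF subspace_coords] show ?thesis by (rule that)
qed

lemma star_bd_star_bd:
  assumes S: "S \<in> L" and f: "f \<in> coords (star S p)"
  shows "star_bd S (star_bd S f) = 0"
proof -
  let ?c = "unjoin S f" and ?K = "complex_link L S"
  have c: "?c \<in> chains ?K (p - card S)" by (rule unjoin_chain[OF S f])
  have lk: "simplicial_complex ?K" by (rule simplicial_complex_link[OF complex S])
  have 1: "star_bd S f = join S (boundary ?c)"
    using star_bd_join[OF S c] join_unjoin[OF f] by simp
  show ?thesis
  proof (cases "p - card S")
    case (Suc q)
    have "boundary ?c \<in> cycles ?K q"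
      using boundaries_subset_cycles[OF lk, of q] c unfolding Suc boundaries_def by blast
    then have "boundary ?c \<in> chains ?K q" "boundary (boundary ?c) = 0" by (auto simp: cycles_def)
    then show ?thesis unfolding 1 using star_bd_join[OF S] linear_0[OF linear_join] by simp
  next
    case 0
    have "boundary ?c = 0" using boundary_chain_0[OF lk] c 0 by simp
    then show ?thesis unfolding 1 by (simp add: linear_0[OF linear_join] linear_0[OF linear_star_bd])
  qed
qed

definition restr :: "'a set \<Rightarrow> ('a set \<Rightarrow>\<^sub>0 real) \<Rightarrow> ('a set \<Rightarrow>\<^sub>0 real)" where
  "restr S = lin_ext (\<lambda>\<sigma>. if S \<subseteq> \<sigma> then basis_elem \<sigma> else 0)"

lemma linear_restr: "linear (restr S)" unfolding restr_def by (rule linear_lin_ext)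

text \<open>The faces not containing \<open>S\<close> form a subcomplex, so forgetting them is a
  chain map. Applied to the fundamental cycle it yields a cycle on every star.\<close>

lemma star_bd_restr:
  assumes "f \<in> coords facets"
  shows "star_bd S (restr S f) = restr S (boundary f)"
proof -
  have "(star_bd S \<circ> restr S) f = (restr S \<circ> boundary) f"
  proof (rule linear_eq_on_coords[OF linear_compose[OF linear_restr linear_star_bd]
        linear_compose[OF linear_boundary linear_restr] _ assms])
    fix \<sigma> assume "\<sigma> \<in> facets"
    then have fin: "finite \<sigma>" using finite_face by (auto simp: facets_def)
    have "(restr S \<circ> boundary) (basis_elem \<sigma>) =
        (\<Sum>i\<in>\<sigma>. vertex_sign \<sigma> i *\<^sub>R (if S \<subseteq> \<sigma> - {i} then basis_elem (\<sigma> - {i}) else 0))"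
      by (simp add: boundary_basis linear_sum[OF linear_restr]) (simp add: restr_def)
    also have "\<dots> = (\<Sum>i\<in>\<sigma>. if S \<subseteq> \<sigma> \<and> i \<notin> S then vertex_sign \<sigma> i *\<^sub>R basis_elem (\<sigma> - {i}) else 0)"
      by (intro sum.cong) (auto simp: subset_Diff_insert)
    also have "\<dots> = (star_bd S \<circ> restr S) (basis_elem \<sigma>)"
    proof (cases "S \<subseteq> \<sigma>")
      case True
      have "(\<Sum>i\<in>\<sigma>. if S \<subseteq> \<sigma> \<and> i \<notin> S then vertex_sign \<sigma> i *\<^sub>R basis_elem (\<sigma> - {i}) else 0) =
          (\<Sum>i\<in>\<sigma> - S. vertex_sign \<sigma> i *\<^sub>R basis_elem (\<sigma> - {i}))"
        using fin True by (intro sum.mono_neutral_cong_right) auto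
      then show ?thesis using True by (simp add: restr_def star_bd_def)
    next
      case False then show ?thesis
        by (simp add: restr_def linear_0[OF linear_star_bd])
    qed
    finally show "(star_bd S \<circ> restr S) (basis_elem \<sigma>) = (restr S \<circ> boundary) (basis_elem \<sigma>)" by simp
  qed
  then show ?thesis by simp
qed

lemma lookup_restr:
  "lookup (restr S f) \<sigma> = (if S \<subseteq> \<sigma> then lookup f \<sigma> else 0)"
proof -
  have "lookup (restr S f) \<sigma> =
      (\<Sum>b\<in>keys f. lookup f b * (if b = \<sigma> \<and> S \<subseteq> \<sigma> then 1 else 0))"
    unfolding restr_def lin_ext_def lookup_sum
    by (intro sum.cong) (auto simp: lookup_single_one)
  also have "\<dots> = (if S \<subseteq> \<sigma> then lookup f \<sigma> else 0)"
    by (cases "S \<subseteq> \<sigma>") (auto simp: if_distrib in_keys_iff cong: if_cong)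
  finally show ?thesis .
qed

lemma restr_z_star: "restr S z \<in> coords (star S m)"
  using z_facets by (auto simp: coords_def in_keys_iff lookup_restr star_def facets_def split: if_splits)

lemma star_bd_restr_z: "star_bd S (restr S z) = 0"
  using star_bd_restr[OF z_facets] by (simp add: z_boundary linear_0[OF linear_restr])

text \<open>Top cycles of the star form a line: the link has top Betti number 1 and no simplices
  above the top, hence no boundaries. The line is spanned by \<open>restr S z\<close>, which is
  nonzero because \<open>S\<close> lies in a facet and \<open>z\<close> does not vanish
  there.\<close>

lemma star_top:
  assumes S: "S \<in> L" and f: "f \<in> coords (star S m)" and 0: "star_bd S f = 0"
  obtains c where "f = c *\<^sub>R restr S z"
proof -
  let ?K = "complex_link L S" let ?q = "m - card S" let ?u = "unjoin S (restr S z)"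
  have lk: "simplicial_complex ?K" by (rule simplicial_complex_link[OF complex S])
  have le: "card S \<le> m" by (rule card_face_le[OF S])
  have "reduced_betti ?K ?q = 1" using betti[OF S, of ?q] le by simp
  then have dim: "dim (cycles ?K ?q) \<le> 1 + dim (boundaries ?K ?q)" by (simp add: reduced_betti_def)
  have "chains ?K (Suc ?q) \<subseteq> {0}"
  proof -
    have e: "{\<tau> \<in> ?K. card \<tau> = Suc ?q} = {}"
    proof (rule ccontr)
      assume "{\<tau> \<in> ?K. card \<tau> = Suc ?q} \<noteq> {}"
      then obtain \<tau> where \<tau>: "\<tau> \<inter> S = {}" "\<tau> \<union> S \<in> L" "card \<tau> = Suc ?q"
        by (auto simp: complex_link_def)
      then have "card (\<tau> \<union> S) = Suc ?q + card S"
        using finite_face[of "\<tau> \<union> S"] by (simp add: card_Un_disjoint)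
      then show False using card_face_le[OF \<tau>(2)] le by simp
    qed
    show ?thesis unfolding chains_coords coords_def e by simp
  qed
  then have "boundaries ?K ?q \<subseteq> {0}"
    using linear_0[OF linear_boundary] by (auto simp: boundaries_def)
  then have "dim (boundaries ?K ?q) = 0" using dim_le_card[of "boundaries ?K ?q" "{}"] by simp
  then have dim1: "dim (cycles ?K ?q) \<le> 1" using dim by simp
  have u: "?u \<in> cycles ?K ?q" by (rule unjoin_cycle[OF S restr_z_star star_bd_restr_z])
  obtain \<sigma> where \<sigma>: "\<sigma> \<in> L" "S \<subseteq> \<sigma>" "card \<sigma> = m" using pure[OF S] by blast
  have "lookup (restr S z) \<sigma> \<noteq> 0"
    using \<sigma> z_nonzero by (simp add: lookup_restr facets_def)
  then have "restr S z \<noteq> 0" by auto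
  then have "?u \<noteq> 0" using join_unjoin[OF restr_z_star, of S] linear_0[OF linear_join, of S] by force
  then have "dim (span {?u}) = 1" by (simp add: dim_span_eq_card_independent del: dim_span)
  moreover have "fin_dim (cycles ?K ?q)"
    by (rule fin_dim_subset[OF fin_dim_chains[OF lk, of ?q]]) (auto simp: cycles_def)
  moreover have "span {?u} \<subseteq> cycles ?K ?q"
    using u by (intro span_minimal subspace_cycles) auto
  ultimately have "span {?u} = cycles ?K ?q"
    using dim1 by (intro fin_dim_eqI[OF _ _ subspace_span]) simp_all
  then have "unjoin S f \<in> span {?u}" using unjoin_cycle[OF S f 0] by simp
  then obtain c where c: "unjoin S f = c *\<^sub>R ?u" by (auto simp: span_singleton)
  have "f = join S (c *\<^sub>R ?u)" using join_unjoin[OF f] c by simp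
  also have "\<dots> = c *\<^sub>R restr S z"
    by (simp add: linear_scale[OF linear_join] join_unjoin[OF restr_z_star])
  finally show ?thesis using that by blast
qed

end

section \<open>Counting monomials\<close>

abbreviation evar :: "'a \<Rightarrow> ('a \<Rightarrow>\<^sub>0 nat)" where "evar i \<equiv> single i 1"

definition mdeg :: "('a \<Rightarrow>\<^sub>0 nat) \<Rightarrow> nat" where
  "mdeg x = (\<Sum>i\<in>keys x. lookup x i)"

lemma mdeg_superset: "finite A \<Longrightarrow> keys x \<subseteq> A \<Longrightarrow> mdeg x = (\<Sum>i\<in>A. lookup x i)"
  unfolding mdeg_def by (rule sum.mono_neutral_left) (auto simp: in_keys_iff)

lemma keys_add_nat: "keys (x + y) = keys x \<union> keys (y :: 'a \<Rightarrow>\<^sub>0 nat)"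
  by (auto simp: in_keys_iff lookup_add)

lemma mdeg_add: "mdeg (x + y) = mdeg x + mdeg y"
proof -
  let ?A = "keys x \<union> keys y"
  have "mdeg x = (\<Sum>i\<in>?A. lookup x i)" "mdeg y = (\<Sum>i\<in>?A. lookup y i)"
    "mdeg (x + y) = (\<Sum>i\<in>?A. lookup (x + y) i)"
    by (rule mdeg_superset; simp add: keys_add_nat)+
  then show ?thesis by (simp add: lookup_add sum.distrib)
qed

lemma mdeg_single [simp]: "mdeg (single i a) = a"
  using mdeg_superset[of "{i}" "single i a"] by simp

lemma mdeg_0 [simp]: "mdeg 0 = 0" by (simp add: mdeg_def)

lemma mdeg_eq_0_iff [simp]: "mdeg x = 0 \<longleftrightarrow> x = 0"
  by (auto simp: mdeg_def in_keys_iff intro: poly_mapping_eqI)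

lemma monom_degree_mdeg: "monom_degree x = 2 * mdeg x"
  by (simp add: monom_degree_def mdeg_def sum_distrib_left)

definition mons :: "'a set \<Rightarrow> nat \<Rightarrow> ('a \<Rightarrow>\<^sub>0 nat) set" where
  "mons A d = {x. keys x \<subseteq> A \<and> mdeg x = d}"

lemma split_monomial:
  fixes x :: "'a \<Rightarrow>\<^sub>0 nat"
  obtains y where "x = y + single a (lookup x a)" "a \<notin> keys y"
    "keys y = keys x - {a}"
proof -
  let ?s = "single a (lookup x a)"
  have "x = (x - ?s) + ?s"
    by (rule poly_mapping_eqI) (simp add: lookup_add lookup_minus lookup_single when_def)
  moreover have "keys (x - ?s) = keys x - {a}"
    by (auto simp: in_keys_iff lookup_minus lookup_single when_def split: if_splits)
  ultimately show ?thesis using that by blast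
qed

lemma card_add_single:
  assumes "\<And>x. x \<in> B \<Longrightarrow> a \<notin> keys (x :: 'a \<Rightarrow>\<^sub>0 nat)"
  shows "card ((\<lambda>x. x + single a c) ` B) = card B"
  by (rule card_image) (auto intro: inj_onI)

lemma card_UN_add_single:
  assumes "finite E" "inj_on c E" "\<And>e. e \<in> E \<Longrightarrow> finite (B e)"
    and notin: "\<And>e x. x \<in> B e \<Longrightarrow> a \<notin> keys (x :: 'a \<Rightarrow>\<^sub>0 nat)"
  shows "card (\<Union>e\<in>E. (\<lambda>x. x + single a (c e)) ` B e) = (\<Sum>e\<in>E. card (B e))"
proof -
  have "(\<lambda>x. x + single a (c i)) ` B i \<inter> (\<lambda>x. x + single a (c j)) ` B j = {}"
    if ij: "i \<in> E" "j \<in> E" "i \<noteq> j" for i j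
  proof -
    have "x + single a (c i) \<noteq> y + single a (c j)" if "x \<in> B i" "y \<in> B j" for x y
    proof
      assume "x + single a (c i) = y + single a (c j)"
      then have "lookup (x + single a (c i)) a = lookup (y + single a (c j)) a" by simp
      then have "c i = c j" using notin[OF that(1)] notin[OF that(2)] by (simp add: lookup_add in_keys_iff)
      then show False using inj_onD[OF assms(2)] ij by blast
    qed
    then show ?thesis by blast
  qed
  then have "card (\<Union>e\<in>E. (\<lambda>x. x + single a (c e)) ` B e) = (\<Sum>e\<in>E. card ((\<lambda>x. x + single a (c e)) ` B e))"
    using assms by (intro card_UN_disjoint) auto
  also have "\<dots> = (\<Sum>e\<in>E. card (B e))"
    using notin by (intro sum.cong refl card_add_single) auto
  finally show ?thesis .
qed

lemma mons_insert:
  assumes "a \<notin> A"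
  shows "mons (insert a A) d = (\<Union>e\<le>d. (\<lambda>x. x + single a (d - e)) ` mons A e)"
proof (intro subset_antisym subsetI)
  fix x assume x: "x \<in> mons (insert a A) d"
  obtain y where y: "x = y + single a (lookup x a)"
    "keys y = keys x - {a}" by (rule split_monomial[of x a])
  have "mdeg x = mdeg y + lookup x a" by (subst y(1)) (simp add: mdeg_add)
  then have "d = mdeg y + lookup x a" using x by (simp add: mons_def)
  then have "mdeg y \<le> d" "lookup x a = d - mdeg y" by auto
  moreover have "y \<in> mons A (mdeg y)" using x y(2) by (auto simp: mons_def)
  ultimately show "x \<in> (\<Union>e\<le>d. (\<lambda>x. x + single a (d - e)) ` mons A e)"
    using y(1) by auto
next
  fix x assume "x \<in> (\<Union>e\<le>d. (\<lambda>x. x + single a (d - e)) ` mons A e)"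
  then obtain e y where "e \<le> d" "y \<in> mons A e" "x = y + single a (d - e)" by auto
  then show "x \<in> mons (insert a A) d"
    by (auto simp: mons_def keys_add_nat mdeg_add split: if_splits)
qed

lemma mons_empty: "mons {} d = (if d = 0 then {0} else {})"
  by (auto simp: mons_def)

lemma finite_mons: "finite A \<Longrightarrow> finite (mons A d)"
proof (induct A arbitrary: d rule: finite_induct)
  case (insert a A) then show ?case by (simp add: mons_insert)
qed (simp add: mons_empty)

text \<open>Hilbert function of a polynomial ring: each new variable is one more partial summation,
  indexed by the degree left after its power is removed.\<close>

lemma card_mons:
  "finite A \<Longrightarrow> int (card (mons A d)) = (psum ^^ card A) (\<lambda>e. if e = 0 then 1 else 0) d"
proof (induct A arbitrary: d rule: finite_induct)
  case (insert a A)
  have notin: "a \<notin> keys x" if "x \<in> mons A e" for x e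
    using that insert.hyps(2) by (auto simp: mons_def)
  have "card (mons (insert a A) d) = (\<Sum>e\<le>d. card (mons A e))"
    unfolding mons_insert[OF insert.hyps(2)]
    using finite_mons[OF insert.hyps(1)] notin
    by (intro card_UN_add_single) (auto simp: inj_on_def)
  then show ?case using insert.hyps by (simp add: psum_def)
qed (simp add: mons_empty)

definition cone_mons :: "'a \<Rightarrow> 'a set \<Rightarrow> nat \<Rightarrow> ('a \<Rightarrow>\<^sub>0 nat) set" where
  "cone_mons k S d = {x. keys x - {k} = S \<and> mdeg x = d}"

lemma cone_mons_insert:
  assumes "a \<notin> S" "a \<noteq> k"
  shows "cone_mons k (insert a S) d = (\<Union>e<d. (\<lambda>x. x + single a (d - e)) ` cone_mons k S e)"
proof (intro subset_antisym subsetI)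
  fix x assume x: "x \<in> cone_mons k (insert a S) d"
  obtain y where y: "x = y + single a (lookup x a)"
    "keys y = keys x - {a}" by (rule split_monomial[of x a])
  have "mdeg x = mdeg y + lookup x a" by (subst y(1)) (simp add: mdeg_add)
  then have d: "d = mdeg y + lookup x a" using x by (simp add: cone_mons_def)
  have "a \<in> keys x" using x by (auto simp: cone_mons_def)
  then have "lookup x a \<noteq> 0" by (simp add: in_keys_iff)
  then have "mdeg y < d" "lookup x a = d - mdeg y" using d by auto
  moreover have "y \<in> cone_mons k S (mdeg y)" using x y(2) assms by (auto simp: cone_mons_def)
  ultimately show "x \<in> (\<Union>e<d. (\<lambda>x. x + single a (d - e)) ` cone_mons k S e)"
    using y(1) by auto
next
  fix x assume "x \<in> (\<Union>e<d. (\<lambda>x. x + single a (d - e)) ` cone_mons k S e)"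
  then obtain e y where "e < d" "y \<in> cone_mons k S e" "x = y + single a (d - e)" by auto
  then show "x \<in> cone_mons k (insert a S) d"
    using assms by (auto simp: cone_mons_def keys_add_nat mdeg_add split: if_splits)
qed

lemma cone_mons_empty: "cone_mons k {} d = {single k d}"
proof (intro subset_antisym subsetI)
  fix x assume x: "x \<in> cone_mons k {} d"
  then have "keys x \<subseteq> {k}" by (auto simp: cone_mons_def)
  then have "mdeg x = lookup x k" using mdeg_superset[of "{k}" x] by simp
  then have "x = single k d"
    using x \<open>keys x \<subseteq> {k}\<close>
    by (intro poly_mapping_eqI) (auto simp: cone_mons_def lookup_single when_def in_keys_iff)
  then show "x \<in> {single k d}" by simp
qed (auto simp: cone_mons_def split: if_splits)

text \<open>The vertices of \<open>S\<close> have positive exponents and the apex \<open>k\<close>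
  an arbitrary one, so this is the coefficient of t^d in t^c/(1-t)^(c+1) with c =
  \<open>card S\<close>.\<close>

lemma card_cone_mons:
  assumes "finite S" "k \<notin> S"
  shows "finite (cone_mons k S d) \<and> card (cone_mons k S d) = d choose card S"
  using assms
proof (induct S arbitrary: d rule: finite_induct)
  case (insert a S)
  have ak: "a \<noteq> k" and kS: "k \<notin> S" using insert.prems by auto
  have IH: "finite (cone_mons k S e)" "card (cone_mons k S e) = e choose card S" for e
    using insert.hyps(3)[OF kS] by auto
  have notin: "a \<notin> keys x" if "x \<in> cone_mons k S e" for x e
    using that insert.hyps(2) ak by (auto simp: cone_mons_def)
  have "card (cone_mons k (insert a S) d) = (\<Sum>e<d. card (cone_mons k S e))"
    unfolding cone_mons_insert[OF insert.hyps(2) ak]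
    using IH(1) notin by (intro card_UN_add_single) (auto simp: inj_on_def)
  also have "\<dots> = (\<Sum>e<d. e choose card S)" using IH(2) by simp
  also have "\<dots> = d choose Suc (card S)"
    by (induct d) (auto simp: add.commute)
  finally show ?case
    using IH insert.hyps by (simp add: cone_mons_insert[OF insert.hyps(2) ak])
qed (simp add: cone_mons_empty)

section \<open>The face ring of a cone over a homology sphere\<close>

text \<open>\<open>t r i\<close> is the coefficient of the variable \<open>i\<close> in the
  \<open>r\<close>-th linear form. Genericity is asked for every face, not only for facets: the
  first \<open>Suc (card \<sigma>)\<close> forms restrict to a basis of the linear forms on the cone
  over \<open>\<sigma>\<close>, hence to a regular sequence on its polynomial ring.\<close>

locale sphere_cone = sphere m L z for m :: nat and L :: "'a::linorder set set" and z +
  fixes M :: "'a set" and k :: 'a and t :: "nat \<Rightarrow> 'a \<Rightarrow> real"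
  assumes finM: "finite M" and kM: "k \<in> M" and LM: "\<sigma> \<in> L \<Longrightarrow> \<sigma> \<subseteq> M - {k}"
    and generic: "\<sigma> \<in> L \<Longrightarrow> i \<in> insert k \<sigma> \<Longrightarrow>
      \<exists>a. \<forall>j\<in>insert k \<sigma>. (\<Sum>r<Suc (card \<sigma>). a r * t r j) = (if j = i then 1 else 0)"
begin

lemma k_notin: "\<sigma> \<in> L \<Longrightarrow> k \<notin> \<sigma>" using LM by blast

text \<open>Index set of the direct sum, over the faces with \<open>p\<close> vertices, of the
  polynomial rings in the vertices of their cones with apex \<open>k\<close>.\<close>

definition FI :: "nat \<Rightarrow> nat \<Rightarrow> ('a set \<times> ('a \<Rightarrow>\<^sub>0 nat)) set" where
  "FI p d = Sigma {\<sigma> \<in> L. card \<sigma> = p} (\<lambda>\<sigma>. mons (insert k \<sigma>) d)"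

abbreviation "F p d \<equiv> coords (FI p d)"

definition theta :: "nat \<Rightarrow> ('a set \<times> ('a \<Rightarrow>\<^sub>0 nat) \<Rightarrow>\<^sub>0 real) \<Rightarrow> ('a set \<times> ('a \<Rightarrow>\<^sub>0 nat) \<Rightarrow>\<^sub>0 real)" where
  "theta r = lin_ext (\<lambda>(\<sigma>, x). \<Sum>i\<in>insert k \<sigma>. t r i *\<^sub>R basis_elem (\<sigma>, x + evar i))"

text \<open>Simplicial boundary combined with restriction of polynomials from the cone over
  \<open>\<sigma>\<close> to the one over \<open>\<sigma> - {i}\<close>. A monomial divisible by the
  variable \<open>i\<close> restricts to 0, which leaves the vertices outside
  \<open>keys x\<close>.\<close>

definition bd :: "('a set \<times> ('a \<Rightarrow>\<^sub>0 nat) \<Rightarrow>\<^sub>0 real) \<Rightarrow> ('a set \<times> ('a \<Rightarrow>\<^sub>0 nat) \<Rightarrow>\<^sub>0 real)" where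
  "bd = lin_ext (\<lambda>(\<sigma>, x). \<Sum>i\<in>\<sigma> - keys x. vertex_sign \<sigma> i *\<^sub>R basis_elem (\<sigma> - {i}, x))"

text \<open>In a fixed monomial the complex \<open>F m \<rightarrow> \<dots> \<rightarrow> F 0\<close> is the augmented chain complex of a star, and its
  kernel at \<open>F m\<close> is the face ring of the cone.\<close>

lemma linear_theta: "linear (theta r)" and linear_bd: "linear bd"
  unfolding theta_def bd_def by (rule linear_lin_ext)+

lemma theta_basis: "theta r (basis_elem (\<sigma>, x)) = (\<Sum>i\<in>insert k \<sigma>. t r i *\<^sub>R basis_elem (\<sigma>, x + evar i))"
  by (simp add: theta_def)

lemma bd_basis: "bd (basis_elem (\<sigma>, x)) =
    (\<Sum>i\<in>\<sigma> - keys x. vertex_sign \<sigma> i *\<^sub>R basis_elem (\<sigma> - {i}, x))"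
  by (simp add: bd_def)

lemma finite_FI: "finite (FI p d)"
  unfolding FI_def using finite_L finite_face by (intro finite_SigmaI finite_mons) auto

lemma mons_add_var: "x \<in> mons A d \<Longrightarrow> i \<in> A \<Longrightarrow> x + evar i \<in> mons A (Suc d)"
  by (auto simp: mons_def keys_add_nat mdeg_add)

lemma theta_F:
  assumes "f \<in> F p d" shows "theta r f \<in> F p (Suc d)"
  unfolding theta_def
proof (rule lin_ext_in_subspace[OF subspace_coords _ assms])
  fix b assume "b \<in> FI p d"
  then obtain \<sigma> x where b: "b = (\<sigma>, x)" "\<sigma> \<in> L" "card \<sigma> = p" "x \<in> mons (insert k \<sigma>) d"
    by (auto simp: FI_def)
  then show "(case b of (\<sigma>, x) \<Rightarrow> \<Sum>i\<in>insert k \<sigma>. t r i *\<^sub>R basis_elem (\<sigma>, x + evar i)) \<in> F p (Suc d)"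
    unfolding b(1) prod.case
    by (intro subspace_sum subspace_scale subspace_coords single_in_coords)
      (auto simp: FI_def simp del: insert_iff One_nat_def intro!: mons_add_var)
qed

lemma bd_F:
  assumes "f \<in> F (Suc p) d" shows "bd f \<in> F p d"
  unfolding bd_def
proof (rule lin_ext_in_subspace[OF subspace_coords _ assms])
  fix b assume "b \<in> FI (Suc p) d"
  then obtain \<sigma> x where b: "b = (\<sigma>, x)" "\<sigma> \<in> L" "card \<sigma> = Suc p" "x \<in> mons (insert k \<sigma>) d"
    by (auto simp: FI_def)
  have "(\<sigma> - {i}, x) \<in> FI p d" if "i \<in> \<sigma> - keys x" for i
    using that b face_subset[of \<sigma> "\<sigma> - {i}"] finite_face[of \<sigma>] by (auto simp: FI_def mons_def)
  then show "(case b of (\<sigma>, x) \<Rightarrow> \<Sum>i\<in>\<sigma> - keys x. vertex_sign \<sigma> i *\<^sub>R basis_elem (\<sigma> - {i}, x)) \<in> F p d"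
    unfolding b(1) prod.case
    by (intro subspace_sum subspace_scale subspace_coords single_in_coords)
qed

lemma theta_comm: "theta r (theta s f) = theta s (theta r f)"
proof -
  have "(theta r \<circ> theta s) f = (theta s \<circ> theta r) f"
  proof (rule linear_eq_on_coords[OF linear_compose[OF linear_theta linear_theta]
        linear_compose[OF linear_theta linear_theta], where A = UNIV])
    fix b :: "'a set \<times> ('a \<Rightarrow>\<^sub>0 nat)"
    obtain \<sigma> x where b: "b = (\<sigma>, x)" by fastforce
    have e: "theta r (theta s (basis_elem b)) =
      (\<Sum>i\<in>insert k \<sigma>. \<Sum>j\<in>insert k \<sigma>. (t s i * t r j) *\<^sub>R basis_elem (\<sigma>, x + evar i + evar j))" for r s
      unfolding b by (simp only: theta_basis linear_sum[OF linear_theta] linear_scale[OF linear_theta]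
        scaleR_sum_right scaleR_scaleR)
    show "(theta r \<circ> theta s) (basis_elem b) = (theta s \<circ> theta r) (basis_elem b)"
      unfolding o_apply e by (subst sum.swap) (simp add: ac_simps)
  qed (simp add: coords_def)
  then show ?thesis by simp
qed

lemma bd_theta:
  assumes "f \<in> F p d"
  shows "bd (theta r f) = theta r (bd f)"
proof -
  have "(bd \<circ> theta r) f = (theta r \<circ> bd) f"
  proof (rule linear_eq_on_coords[OF linear_compose[OF linear_theta linear_bd]
        linear_compose[OF linear_bd linear_theta] _ assms])
    fix b assume "b \<in> FI p d"
    then obtain \<sigma> x where b: "b = (\<sigma>, x)" "\<sigma> \<in> L" by (auto simp: FI_def)
    have fin: "finite (insert k \<sigma>)" "finite \<sigma>" using finite_face b by auto
    let ?K = "keys x"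
    let ?t = "\<lambda>i j. (t r i * vertex_sign \<sigma> j) *\<^sub>R basis_elem (\<sigma> - {j}, x + evar i)"
    have "(bd \<circ> theta r) (basis_elem b) =
        (\<Sum>i\<in>insert k \<sigma>. \<Sum>j\<in>\<sigma> - keys (x + evar i). ?t i j)"
      by (simp only: o_apply b(1) theta_basis bd_basis linear_sum[OF linear_bd] linear_scale[OF linear_bd]
        scaleR_sum_right scaleR_scaleR)
    also have "\<dots> = (\<Sum>i\<in>insert k \<sigma>. \<Sum>j\<in>\<sigma> - ?K. if j \<noteq> i then ?t i j else 0)"
      using fin by (intro sum.cong refl sum.mono_neutral_cong_left) (auto simp: keys_add_nat)
    also have "\<dots> = (\<Sum>j\<in>\<sigma> - ?K. \<Sum>i\<in>insert k \<sigma>. if j \<noteq> i then ?t i j else 0)"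
      by (rule sum.swap)
    also have "\<dots> = (\<Sum>j\<in>\<sigma> - ?K. \<Sum>i\<in>insert k (\<sigma> - {j}). ?t i j)"
      using fin k_notin[OF b(2)] by (intro sum.cong refl sum.mono_neutral_cong_right) auto
    also have "\<dots> = (theta r \<circ> bd) (basis_elem b)"
      by (simp only: o_apply b(1) theta_basis bd_basis linear_sum[OF linear_theta] linear_scale[OF linear_theta]
        scaleR_sum_right scaleR_scaleR mult.commute)
    finally show "(bd \<circ> theta r) (basis_elem b) = (theta r \<circ> bd) (basis_elem b)" .
  qed
  then show ?thesis by simp
qed

lemma graded_F: "graded_module theta (F p)"
  by (rule graded_module.intro)
    (auto intro: linear_theta subspace_coords fin_dim_coords finite_FI theta_F theta_comm)

lemma card_FI: "int (card (FI p d)) =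
    int (card {\<sigma> \<in> L. card \<sigma> = p}) * (psum ^^ Suc p) (\<lambda>e. if e = 0 then 1 else 0) d"
proof -
  have "card (FI p d) = (\<Sum>\<sigma>\<in>{\<sigma> \<in> L. card \<sigma> = p}. card (mons (insert k \<sigma>) d))"
    unfolding FI_def using finite_L finite_face by (intro card_SigmaI) (auto intro: finite_mons)
  then have "int (card (FI p d)) = (\<Sum>\<sigma>\<in>{\<sigma> \<in> L. card \<sigma> = p}. int (card (mons (insert k \<sigma>) d)))"
    by simp
  also have "\<dots> = (\<Sum>\<sigma>\<in>{\<sigma> \<in> L. card \<sigma> = p}. (psum ^^ Suc p) (\<lambda>e. if e = 0 then 1 else 0) d)"
    by (intro sum.cong refl, subst card_mons) (use finite_face k_notin in auto)
  finally show ?thesis by simp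
qed

text \<open>On the cone over a face with \<open>p\<close> vertices the first \<open>p + 1\<close>
  forms span all linear forms, hence generate every monomial of positive degree.\<close>

lemma gideal_F: "gideal theta (F p) (Suc p) (Suc d) = F p (Suc d)"
proof (rule subset_antisym)
  interpret G: graded_module theta "F p" by (rule graded_F)
  show "gideal theta (F p) (Suc p) (Suc d) \<subseteq> F p (Suc d)" by (rule G.gideal_subset)
  have gen: "basis_elem b \<in> gideal theta (F p) (Suc p) (Suc d)" if b: "b \<in> FI p (Suc d)" for b
  proof -
    obtain \<sigma> x where b: "b = (\<sigma>, x)" "\<sigma> \<in> L" "card \<sigma> = p" "x \<in> mons (insert k \<sigma>) (Suc d)"
      using b by (auto simp: FI_def)
    have "x \<noteq> 0" using b(4) by (auto simp: mons_def)
    then have "keys x \<noteq> {}" by simp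
    then obtain i where i: "i \<in> keys x" by blast
    define y where "y = x - evar i"
    have x: "x = y + evar i" unfolding y_def using i
      by (intro poly_mapping_eqI) (auto simp: lookup_add lookup_minus lookup_single when_def in_keys_iff)
    have ik: "i \<in> insert k \<sigma>" using i b(4) by (auto simp: mons_def)
    have y: "y \<in> mons (insert k \<sigma>) d" using b(4) unfolding x by (auto simp: mons_def keys_add_nat mdeg_add)
    obtain a where a: "\<forall>j\<in>insert k \<sigma>. (\<Sum>r<Suc (card \<sigma>). a r * t r j) = (if j = i then 1 else 0)"
      using generic[OF b(2) ik] by blast
    \<comment> \<open>With the coefficients \<open>a\<close> dual to \<open>i\<close>, the
      combination of the forms restricts to the single variable \<open>i\<close>, so it takes
      \<open>y\<close> to \<open>x\<close>.\<close>
    have "(\<Sum>r<Suc p. theta r (a r *\<^sub>R basis_elem (\<sigma>, y))) =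
        (\<Sum>r<Suc p. \<Sum>j\<in>insert k \<sigma>. (a r * t r j) *\<^sub>R basis_elem (\<sigma>, y + evar j))"
      by (simp only: linear_scale[OF linear_theta] theta_basis scaleR_sum_right scaleR_scaleR)
    also have "\<dots> = (\<Sum>j\<in>insert k \<sigma>. (\<Sum>r<Suc p. a r * t r j) *\<^sub>R basis_elem (\<sigma>, y + evar j))"
      by (subst sum.swap) (simp only: scaleR_sum_left)
    also have "\<dots> = (\<Sum>j\<in>insert k \<sigma>. if j = i then basis_elem (\<sigma>, y + evar j) else 0)"
    proof (rule sum.cong[OF refl])
      fix j assume "j \<in> insert k \<sigma>"
      then have "(\<Sum>r<Suc p. a r * t r j) = (if j = i then 1 else 0)" using a unfolding b(3) by blast
      then show "(\<Sum>r<Suc p. a r * t r j) *\<^sub>R basis_elem (\<sigma>, y + evar j) =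
          (if j = i then basis_elem (\<sigma>, y + evar j) else 0)"
        by (simp only: if_distrib[of "\<lambda>c. c *\<^sub>R _"] scaleR_one scaleR_zero_left)
    qed
    also have "\<dots> = basis_elem b"
      using ik finite_face[OF b(2)] x b(1) by (subst sum.delta) auto
    finally have "basis_elem b = (\<Sum>r<Suc p. theta r (a r *\<^sub>R basis_elem (\<sigma>, y)))" by simp
    also have "\<dots> \<in> gideal theta (F p) (Suc p) (Suc d)"
      by (intro G.sum_in_gideal subspace_scale subspace_coords single_in_coords)
        (use b y in \<open>auto simp: FI_def\<close>)
    finally show ?thesis .
  qed
  show "F p (Suc d) \<subseteq> gideal theta (F p) (Suc p) (Suc d)"
    unfolding coords_span[OF finite_FI] using gen
    by (intro span_minimal G.gideal_subspace[unfolded coords_span[OF finite_FI]])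
      (auto simp: coords_span[OF finite_FI])
qed

text \<open>Each summand is a polynomial ring in \<open>p + 1\<close> variables whose maximal ideal
  is generated by \<open>p + 1\<close> forms; the Hilbert function then forces regularity.\<close>

lemma regular_F: "regular theta (F p) (Suc p)"
  by (rule graded_module.regular_by_count[OF graded_F gideal_F, where c = "int (card {\<sigma> \<in> L. card \<sigma> = p})"])
    (simp only: dim_coords[OF finite_FI] card_FI)

text \<open>Part of a chain at the fixed monomial \<open>x\<close>. As \<open>bd\<close> never
  changes the monomial, the complex splits into these parts.\<close>

definition slice :: "('a \<Rightarrow>\<^sub>0 nat) \<Rightarrow> ('a set \<times> ('a \<Rightarrow>\<^sub>0 nat) \<Rightarrow>\<^sub>0 real) \<Rightarrow> ('a set \<Rightarrow>\<^sub>0 real)" where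
  "slice x = lin_ext (\<lambda>(\<sigma>, y). if y = x then basis_elem \<sigma> else 0)"

definition unslice :: "('a \<Rightarrow>\<^sub>0 nat) \<Rightarrow> ('a set \<Rightarrow>\<^sub>0 real) \<Rightarrow> ('a set \<times> ('a \<Rightarrow>\<^sub>0 nat) \<Rightarrow>\<^sub>0 real)" where
  "unslice x = lin_ext (\<lambda>\<sigma>. basis_elem (\<sigma>, x))"

lemma linear_slice: "linear (slice x)" and linear_unslice: "linear (unslice x)"
  unfolding slice_def unslice_def by (rule linear_lin_ext)+

lemma lookup_slice: "lookup (slice x f) \<sigma> = lookup f (\<sigma>, x)"
proof -
  have "lookup (slice x f) \<sigma> =
      (\<Sum>b\<in>keys f. if b = (\<sigma>, x) then lookup f b else 0)"
    unfolding slice_def lin_ext_def lookup_sum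
    by (intro sum.cong) (auto simp: lookup_single_one split: if_splits)
  then show ?thesis by (auto simp: in_keys_iff)
qed

lemma lookup_unslice: "lookup (unslice x f) (\<sigma>, y) = (if y = x then lookup f \<sigma> else 0)"
proof -
  have "lookup (unslice x f) (\<sigma>, y) =
      (\<Sum>b\<in>keys f. if b = \<sigma> then (if y = x then lookup f b else 0) else 0)"
    unfolding unslice_def lin_ext_def lookup_sum
    by (intro sum.cong) (auto simp: lookup_single_one)
  then show ?thesis by (auto simp: in_keys_iff)
qed

abbreviation base :: "('a \<Rightarrow>\<^sub>0 nat) \<Rightarrow> 'a set" where "base x \<equiv> keys x - {k}"

text \<open>A monomial lives on the cone over \<open>\<sigma>\<close> only if its support off the
  apex is contained in \<open>\<sigma>\<close>.\<close>

lemma slice_star: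
  assumes f: "f \<in> F p d"
  shows "slice x f \<in> coords (star (base x) p)"
  unfolding coords_def
proof (rule CollectI, rule subsetI)
  fix \<sigma> assume "\<sigma> \<in> keys (slice x f)"
  then have "(\<sigma>, x) \<in> keys f" by (simp add: in_keys_iff lookup_slice)
  then have "(\<sigma>, x) \<in> FI p d" using f unfolding coords_def by blast
  then show "\<sigma> \<in> star (base x) p" by (auto simp: FI_def star_def mons_def)
qed

lemma bd_unslice:
  assumes "g \<in> coords (star S p)" "S = base x"
  shows "bd (unslice x g) = unslice x (star_bd S g)"
proof -
  have "(bd \<circ> unslice x) g = (unslice x \<circ> star_bd S) g"
  proof (rule linear_eq_on_coords[OF linear_compose[OF linear_unslice linear_bd]
        linear_compose[OF linear_star_bd linear_unslice] _ assms(1)])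
    fix \<sigma> assume "\<sigma> \<in> star S p"
    then have "\<sigma> - keys x = \<sigma> - S" using k_notin[of \<sigma>] by (auto simp: star_def assms(2))
    then have "bd (unslice x (basis_elem \<sigma>)) =
        (\<Sum>i\<in>\<sigma> - S. vertex_sign \<sigma> i *\<^sub>R basis_elem (\<sigma> - {i}, x))"
      by (simp add: unslice_def bd_basis)
    also have "\<dots> = unslice x (star_bd S (basis_elem \<sigma>))"
      by (simp add: star_bd_def linear_sum[OF linear_unslice]) (simp add: unslice_def)
    finally show "(bd \<circ> unslice x) (basis_elem \<sigma>) = (unslice x \<circ> star_bd S) (basis_elem \<sigma>)" by simp
  qed
  then show ?thesis by simp
qed

lemma unslice_sum:
  assumes "f \<in> F p d" "finite X" "\<And>\<sigma> x. (\<sigma>, x) \<in> FI p d \<Longrightarrow> x \<in> X"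
  shows "f = (\<Sum>x\<in>X. unslice x (slice x f))"
proof (rule poly_mapping_eqI)
  fix b :: "'a set \<times> ('a \<Rightarrow>\<^sub>0 nat)"
  obtain \<sigma> y where b: "b = (\<sigma>, y)" by fastforce
  have "lookup f (\<sigma>, y) = 0" if "y \<notin> X"
    using assms that by (auto simp: coords_def in_keys_iff subset_iff)
  then show "lookup f b = lookup (\<Sum>x\<in>X. unslice x (slice x f)) b"
    using assms(2) unfolding b by (simp add: lookup_sum lookup_unslice lookup_slice)
qed

lemma star_bd_slice:
  assumes f: "f \<in> F p d"
  shows "star_bd (base x) (slice x f) = slice x (bd f)"
proof (rule poly_mapping_eqI)
  fix \<sigma>
  let ?X = "insert x (mons M d)"
  have X: "finite ?X" using finite_mons[OF finM] by simp
  have "f = (\<Sum>x\<in>?X. unslice x (slice x f))"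
    by (rule unslice_sum[OF f X]) (use LM kM in \<open>auto simp: FI_def mons_def\<close>)
  then have "bd f = bd (\<Sum>x\<in>?X. unslice x (slice x f))" by simp
  also have "\<dots> = (\<Sum>x\<in>?X. unslice x (star_bd (base x) (slice x f)))"
    by (simp only: linear_sum[OF linear_bd] bd_unslice[OF slice_star[OF f] refl])
  finally show "lookup (star_bd (base x) (slice x f)) \<sigma> = lookup (slice x (bd f)) \<sigma>"
    using X by (simp only: lookup_slice lookup_sum lookup_unslice) simp
qed

lemma star_empty: "S \<notin> L \<Longrightarrow> star S p = {}"
  using face_subset by (auto simp: star_def)

lemma bd_bd:
  assumes f: "f \<in> F (Suc p) d"
  shows "bd (bd f) = 0"
proof (rule poly_mapping_eqI)
  fix b :: "'a set \<times> ('a \<Rightarrow>\<^sub>0 nat)"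
  obtain \<sigma> x where b: "b = (\<sigma>, x)" by fastforce
  have "star_bd (base x) (star_bd (base x) (slice x f)) = 0"
  proof (cases "base x \<in> L")
    case True then show ?thesis using star_bd_star_bd slice_star[OF f] by blast
  next
    case False
    then have "slice x f = 0" using slice_star[OF f, of x] star_empty by (auto simp: coords_def)
    then show ?thesis by (simp add: linear_0[OF linear_star_bd])
  qed
  then have "slice x (bd (bd f)) = 0"
    using star_bd_slice[OF f] star_bd_slice[OF bd_F[OF f]] by simp
  then show "lookup (bd (bd f)) b = lookup 0 b"
    using lookup_slice[of x "bd (bd f)" \<sigma>] by (simp add: b)
qed

text \<open>Slice by slice this is exactness of the star of \<open>base x\<close>; a monomial whose
  base is not a face has zero slice. It presents each syzygy module both as a kernel and as an
  image, the form that the depth induction consumes.\<close>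

lemma bd_exact:
  assumes p: "p < m"
  shows "bd ` F (Suc p) d = {f \<in> F p d. bd f = 0}"
proof (rule subset_antisym)
  show "bd ` F (Suc p) d \<subseteq> {f \<in> F p d. bd f = 0}" using bd_F bd_bd by auto
  show "{f \<in> F p d. bd f = 0} \<subseteq> bd ` F (Suc p) d"
  proof
    fix f assume "f \<in> {f \<in> F p d. bd f = 0}"
    then have f: "f \<in> F p d" and 0: "bd f = 0" by auto
    let ?X = "mons M d"
    have X: "finite ?X" by (rule finite_mons[OF finM])
    have "\<exists>g. g \<in> coords (star (base x) (Suc p)) \<and> star_bd (base x) g = slice x f" for x
    proof (cases "base x \<in> L")
      case True
      have "star_bd (base x) (slice x f) = 0"
        using star_bd_slice[OF f] 0 linear_0[OF linear_slice] by simp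
      then show ?thesis using star_exact[OF True p slice_star[OF f]] by metis
    next
      case False
      then have "slice x f = 0" using slice_star[OF f, of x] star_empty by (auto simp: coords_def)
      then show ?thesis using subspace_0[OF subspace_coords] linear_0[OF linear_star_bd] by metis
    qed
    then obtain g where g: "\<And>x. g x \<in> coords (star (base x) (Suc p))"
      "\<And>x. star_bd (base x) (g x) = slice x f" by metis
    let ?g = "\<Sum>x\<in>?X. unslice x (g x)"
    have "bd ?g = (\<Sum>x\<in>?X. unslice x (slice x f))"
      by (simp only: linear_sum[OF linear_bd] bd_unslice[OF g(1) refl] g(2))
    also have "\<dots> = f"
      by (rule unslice_sum[OF f X, symmetric]) (use LM kM in \<open>auto simp: FI_def mons_def\<close>)
    finally have "bd ?g = f" .
    moreover have "unslice x (g x) \<in> F (Suc p) d" if "x \<in> ?X" for x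
      unfolding unslice_def
    proof (rule lin_ext_in_subspace[OF subspace_coords _ g(1)])
      fix \<sigma> assume "\<sigma> \<in> star (base x) (Suc p)"
      then show "basis_elem (\<sigma>, x) \<in> F (Suc p) d"
        using that by (intro single_in_coords) (auto simp: FI_def star_def mons_def)
    qed
    then have "?g \<in> F (Suc p) d" by (intro subspace_sum subspace_coords)
    ultimately show "f \<in> bd ` F (Suc p) d" by blast
  qed
qed

definition K :: "nat \<Rightarrow> nat \<Rightarrow> ('a set \<times> ('a \<Rightarrow>\<^sub>0 nat) \<Rightarrow>\<^sub>0 real) set" where
  "K p d = {f \<in> F p d. bd f = 0}"

text \<open>Depth counts along the resolution: each syzygy module gains one regular element.\<close>

lemma regular_K: "p \<le> m \<Longrightarrow> regular theta (K p) (Suc p)"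
proof (induct p)
  case 0
  have "bd f = (\<lambda>_. 0) f" if "f \<in> F 0 d" for f d
  proof (rule linear_eq_on_coords[OF linear_bd linear_zero _ that])
    fix b assume "b \<in> FI 0 d"
    then obtain x where "b = ({}, x)" using finite_face by (auto simp: FI_def)
    then show "bd (basis_elem b) = 0" by (simp add: bd_basis)
  qed
  then have "K 0 = F 0" by (auto simp: K_def)
  then show ?case using regular_F[of 0] by simp
next
  case (Suc p)
  have "regular theta (\<lambda>d. bd ` F (Suc p) d) (Suc p)"
    using Suc bd_exact[of p] by (simp add: K_def[abs_def])
  then have "regular theta (\<lambda>d. {x \<in> F (Suc p) d. bd x = 0}) (Suc (Suc p))"
    by (intro regular_kernel[OF graded_F linear_bd _ _ regular_F] bd_theta)
  then show ?case by (simp only: K_def[abs_def])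
qed

lemma graded_K: "graded_module theta (K m)"
proof (rule graded_module.intro)
  fix r s d f
  show "linear (theta r)" by (rule linear_theta)
  show "subspace (K m d)" unfolding K_def by (rule subspace_kernel_on[OF linear_bd subspace_coords])
  show "fin_dim (K m d)" unfolding K_def
    by (rule fin_dim_subset[OF fin_dim_coords[OF finite_FI]]) auto
  assume f: "f \<in> K m d"
  then show "theta r f \<in> K m (Suc d)"
    using theta_F bd_theta linear_0[OF linear_theta] by (auto simp: K_def)
  show "theta r (theta s f) = theta s (theta r f)" by (rule theta_comm)
qed

end

text \<open>For \<open>s = 0\<close> this is the Hilbert function of the face ring of a cone over \<open>L\<close>; dividing by a
  regular linear form increases \<open>s\<close>.\<close>

fun hilb :: "'a set set \<Rightarrow> nat \<Rightarrow> nat \<Rightarrow> int" where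
  "hilb L 0 d = (\<Sum>S\<in>L. int (d choose card S))"
| "hilb L (Suc s) 0 = hilb L s 0"
| "hilb L (Suc s) (Suc d) = hilb L s (Suc d) - hilb L s d"

lemma sum_hilb: "(\<Sum>e\<le>d. hilb L (Suc s) e) = hilb L s d"
  by (induct d) auto

text \<open>Pascal's rule applied \<open>s\<close> times. Faces with fewer than \<open>s\<close>
  vertices contribute polynomials of degree below \<open>s\<close> in \<open>d\<close>, which the
  differences kill. Below degree \<open>s\<close> the formula need not hold, since the differences
  start from the value 0 before degree 0.\<close>

lemma hilb_high:
  assumes "finite L" "s \<le> d"
  shows "hilb L s d = (\<Sum>S\<in>{S\<in>L. s \<le> card S}. int ((d - s) choose (card S - s)))"
  using assms(2)
proof (induct s arbitrary: d)
  case 0 then show ?case by simp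
next
  case (Suc s)
  then obtain e where d: "d = Suc e" and e: "s \<le> e" by (cases d) auto
  let ?A = "{S\<in>L. s \<le> card S}"
  have fin: "finite ?A" using assms(1) by simp
  have "hilb L (Suc s) d = (\<Sum>S\<in>?A. int ((Suc e - s) choose (card S - s)) - int ((e - s) choose (card S - s)))"
    using e Suc.hyps[of e] Suc.hyps[of "Suc e"] by (simp add: d sum_subtractf)
  also have "\<dots> = (\<Sum>S\<in>{S\<in>L. Suc s \<le> card S}. int ((d - Suc s) choose (card S - Suc s)))"
  proof (rule sum.mono_neutral_cong_right[OF fin])
    show "\<forall>S\<in>?A - {S \<in> L. Suc s \<le> card S}.
        int (Suc e - s choose (card S - s)) - int (e - s choose (card S - s)) = 0"
    proof
      fix S assume "S \<in> ?A - {S \<in> L. Suc s \<le> card S}"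
      then have "card S = s" by auto
      then show "int (Suc e - s choose (card S - s)) - int (e - s choose (card S - s)) = 0" by simp
    qed
    fix S assume "S \<in> {S \<in> L. Suc s \<le> card S}"
    then obtain c where c: "card S - s = Suc c" "card S - Suc s = c"
      by (metis (lifting) Suc_diff_le diff_Suc_Suc mem_Collect_eq)
    have "Suc e - s = Suc (e - s)" using e by simp
    then show "int (Suc e - s choose (card S - s)) - int (e - s choose (card S - s)) =
        int (d - Suc s choose (card S - Suc s))" by (simp add: c d)
  qed auto
  finally show ?case .
qed

section \<open>The h-vector and the ridges of a homology sphere\<close>

context sphere
begin

text \<open>The face numbers are recovered on the diagonal: the binomial coefficients left by
  \<open>hilb_high\<close> have upper entry 0.\<close>

lemma hilb_diag: "hilb L s s = int (card {S \<in> L. card S = s})"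
proof -
  have "hilb L s s = (\<Sum>S\<in>{S\<in>L. s \<le> card S}. if card S = s then 1 else 0)"
    unfolding hilb_high[OF finite_L order_refl] by (intro sum.cong refl) (auto simp: binomial_eq_0)
  also have "\<dots> = (\<Sum>S\<in>{S\<in>L. card S = s}. 1)"
    using finite_L by (intro sum.mono_neutral_cong_right) auto
  finally show ?thesis by simp
qed

lemma hilb_top: "Suc m \<le> d \<Longrightarrow> hilb L (Suc m) d = 0"
proof -
  assume "Suc m \<le> d"
  moreover have "{S\<in>L. Suc m \<le> card S} = {}" using card_face_le by fastforce
  ultimately show ?thesis by (simp only: hilb_high[OF finite_L] sum.empty)
qed

lemma star_bd_ridge:
  assumes "i \<notin> S"
  shows "star_bd S (basis_elem (insert i S)) = vertex_sign (insert i S) i *\<^sub>R basis_elem S"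
proof -
  have "insert i S - S = {i}" "insert i S - {i} = S" using assms by auto
  then show ?thesis by (simp add: star_bd_def)
qed

lemma vertex_sign_nz: "vertex_sign I i \<noteq> 0" by (simp add: vertex_sign_def)

lemma star_insert:
  assumes "S \<in> L" "Suc (card S) = m" "\<sigma> \<in> star S m"
  obtains i where "i \<notin> S" "\<sigma> = insert i S"
proof -
  have \<sigma>: "finite \<sigma>" "S \<subseteq> \<sigma>" "card \<sigma> = Suc (card S)" using assms finite_face by (auto simp: star_def)
  then have "card (\<sigma> - S) = 1" by (simp add: card_Diff_subset finite_subset)
  then obtain i where "\<sigma> - S = {i}" by (auto simp: card_1_singleton_iff)
  then have "i \<notin> S" "\<sigma> = insert i S" using \<sigma>(2) by auto
  then show ?thesis by (rule that)
qed

text \<open>A single facet around \<open>S\<close> would give \<open>restr S z\<close> a nonzero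
  boundary. For two facets some combination is a cycle of the star, hence a multiple of
  \<open>restr S z\<close> by \<open>star_top\<close>; as \<open>z\<close> is nonzero on every
  facet, there is no third one.\<close>

lemma ridge_two_facets:
  assumes S: "S \<in> L" and c: "Suc (card S) = m"
  shows "card (star S m) = 2"
proof -
  obtain \<sigma>1 where s1: "\<sigma>1 \<in> star S m" using pure[OF S] by (auto simp: star_def)
  obtain i1 where i1: "i1 \<notin> S" "\<sigma>1 = insert i1 S" by (rule star_insert[OF S c s1])
  have nz: "lookup z \<sigma> \<noteq> 0" if "\<sigma> \<in> star S m" for \<sigma>
    using that z_nonzero by (auto simp: star_def facets_def)
  have "\<exists>\<sigma>2\<in>star S m. \<sigma>2 \<noteq> \<sigma>1"
  proof (rule ccontr)
    assume "\<not> ?thesis"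
    then have one: "star S m = {\<sigma>1}" using s1 by blast
    have "restr S z = lookup (restr S z) \<sigma>1 *\<^sub>R basis_elem \<sigma>1"
      using poly_mapping_expansion[of "{\<sigma>1}" "restr S z"] restr_z_star[of S] one by simp
    then have "restr S z = lookup z \<sigma>1 *\<^sub>R basis_elem \<sigma>1"
      by (simp only: lookup_restr i1 subset_insertI if_True)
    then have "star_bd S (restr S z) = (lookup z \<sigma>1 * vertex_sign \<sigma>1 i1) *\<^sub>R basis_elem S"
      using star_bd_ridge[OF i1(1)] by (simp only: linear_scale[OF linear_star_bd] i1(2) scaleR_scaleR)
    then have "lookup z \<sigma>1 * vertex_sign \<sigma>1 i1 = 0"
      by (metis star_bd_restr_z lookup_zero lookup_scaleR lookup_single_one real_scaleR_def mult.right_neutral)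
    then show False using nz[OF s1] vertex_sign_nz[of \<sigma>1 i1] by simp
  qed
  then obtain \<sigma>2 where s2: "\<sigma>2 \<in> star S m" "\<sigma>2 \<noteq> \<sigma>1" by blast
  obtain i2 where i2: "i2 \<notin> S" "\<sigma>2 = insert i2 S" by (rule star_insert[OF S c s2(1)])
  \<comment> \<open>The coefficients are chosen crosswise, so that the two contributions to the
    ridge cancel.\<close>
  define f where "f = vertex_sign \<sigma>2 i2 *\<^sub>R basis_elem \<sigma>1 + (- vertex_sign \<sigma>1 i1) *\<^sub>R basis_elem \<sigma>2"
  have "f \<in> coords (star S m)" unfolding f_def
    by (intro subspace_add subspace_scale subspace_coords single_in_coords s1 s2)
  moreover have "star_bd S f = 0"
    unfolding f_def linear_add[OF linear_star_bd] linear_scale[OF linear_star_bd] i1 i2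
      star_bd_ridge[OF i1(1)] star_bd_ridge[OF i2(1)] by (simp add: mult.commute flip: single_add)
  ultimately obtain b where b: "f = b *\<^sub>R restr S z" using star_top[OF S] by blast
  have l1: "lookup f \<sigma>1 \<noteq> 0"
    using s2(2) vertex_sign_nz[of \<sigma>2 i2] by (simp add: f_def lookup_add lookup_single_one)
  have "star S m = {\<sigma>1, \<sigma>2}"
  proof (rule subset_antisym)
    show "star S m \<subseteq> {\<sigma>1, \<sigma>2}"
    proof
      fix \<sigma> assume \<sigma>: "\<sigma> \<in> star S m"
      have "b \<noteq> 0" using l1 b by auto
      then have "lookup f \<sigma> \<noteq> 0"
        using nz[OF \<sigma>] \<sigma> by (simp add: b lookup_restr star_def)
      then show "\<sigma> \<in> {\<sigma>1, \<sigma>2}"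
        by (auto simp: f_def lookup_add lookup_single_one split: if_splits)
    qed
  qed (use s1 s2 in auto)
  then show ?thesis using s2(2) by simp
qed

text \<open>Double counting of incidences: a ridge lies in two facets, and a facet has
  \<open>m\<close> ridges.\<close>

lemma ridge_count:
  assumes "m = Suc q"
  shows "2 * card {S \<in> L. card S = q} = m * card facets"
proof -
  let ?R = "{S \<in> L. card S = q}"
  have fin: "finite ?R" "finite facets" using finite_L by (auto simp: facets_def)
  have 1: "(\<Sum>S\<in>?R. card {\<sigma> \<in> facets. S \<subseteq> \<sigma>}) = (\<Sum>\<sigma>\<in>facets. m)"
  proof (rule sum_multicount_gen[OF fin], rule ballI)
    fix \<sigma> assume \<sigma>: "\<sigma> \<in> facets"
    then have f: "finite \<sigma>" "card \<sigma> = Suc q" "\<sigma> \<in> L" using finite_face unfolding facets_def assms[symmetric] by auto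
    have "{S \<in> ?R. S \<subseteq> \<sigma>} = (\<lambda>i. \<sigma> - {i}) ` \<sigma>"
    proof (rule subset_antisym)
      show "{S \<in> ?R. S \<subseteq> \<sigma>} \<subseteq> (\<lambda>i. \<sigma> - {i}) ` \<sigma>"
      proof
        fix S assume "S \<in> {S \<in> ?R. S \<subseteq> \<sigma>}"
        then have S: "S \<subseteq> \<sigma>" "card S = q" by auto
        then have "card (\<sigma> - S) = 1" using f by (simp add: card_Diff_subset finite_subset)
        then obtain i where "\<sigma> - S = {i}" by (auto simp: card_1_singleton_iff)
        then have "i \<in> \<sigma>" "S = \<sigma> - {i}" using S by auto
        then show "S \<in> (\<lambda>i. \<sigma> - {i}) ` \<sigma>" by blast
      qed
      show "(\<lambda>i. \<sigma> - {i}) ` \<sigma> \<subseteq> {S \<in> ?R. S \<subseteq> \<sigma>}" using f face_subset by auto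
    qed
    moreover have "inj_on (\<lambda>i. \<sigma> - {i}) \<sigma>" by (rule inj_onI) blast
    ultimately show "card {S \<in> ?R. S \<subseteq> \<sigma>} = m" using f assms by (simp add: card_image)
  qed
  have "card {\<sigma> \<in> facets. S \<subseteq> \<sigma>} = 2" if "S \<in> ?R" for S
  proof -
    have "{\<sigma> \<in> facets. S \<subseteq> \<sigma>} = star S m" by (auto simp: facets_def star_def)
    then show ?thesis using ridge_two_facets[of S] that assms by simp
  qed
  then have "(\<Sum>S\<in>?R. card {\<sigma> \<in> facets. S \<subseteq> \<sigma>}) = (\<Sum>S\<in>?R. 2)" by (intro sum.cong refl) blast
  then have "card ?R * 2 = card facets * m" using 1 by (simp only: sum_constant of_nat_id)
  then show ?thesis by (simp only: mult.commute)
qed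

text \<open>\<open>hilb L (Suc m)\<close> is the h-vector of \<open>L\<close>; summation undoes one
  difference and leads back to the diagonal.\<close>

lemma sum_hilb_total: "(\<Sum>d\<le>m. hilb L (Suc m) d) = int (card facets)"
  unfolding sum_hilb hilb_diag facets_def ..

text \<open>This replaces the full symmetry of the \<open>h\<close>-vector; it only uses that a ridge lies in two facets.\<close>

lemma sum_hilb_half: "2 * (\<Sum>e<m. \<Sum>d\<le>e. hilb L (Suc m) d) = int m * int (card facets)"
proof (cases m)
  case (Suc q)
  have "(\<Sum>e<m. \<Sum>d\<le>e. hilb L (Suc m) d) = (\<Sum>e\<le>q. hilb L (Suc q) e)"
    by (simp only: sum_hilb Suc lessThan_Suc_atMost)
  also have "\<dots> = int (card {S \<in> L. card S = q})" unfolding sum_hilb hilb_diag ..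
  finally show ?thesis using ridge_count[OF Suc] by (simp flip: of_nat_mult)
qed simp

end

section \<open>The face ring as a quotient of the polynomial ring\<close>

context sphere_cone
begin

abbreviation D :: "nat \<Rightarrow> (('a \<Rightarrow>\<^sub>0 nat) \<Rightarrow>\<^sub>0 real) set" where "D d \<equiv> coords (mons M d)"

text \<open>Degree \<open>d\<close> part of the Stanley-Reisner ideal of the cone over
  \<open>L\<close> in the polynomials on \<open>M\<close>. The exponent of the apex is free, and any
  other vertex of \<open>M\<close> outside the complex counts as a nonface.\<close>

definition SR :: "nat \<Rightarrow> (('a \<Rightarrow>\<^sub>0 nat) \<Rightarrow>\<^sub>0 real) set" where
  "SR d = coords {x \<in> mons M d. base x \<notin> L}"

text \<open>Restriction of a polynomial to the cones over all facets, weighted by the coefficients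
  of the fundamental cycle. The weights make the family of restrictions a cycle for
  \<open>bd\<close>, so that the face ring is identified with \<open>K m\<close>.\<close>

definition psi :: "(('a \<Rightarrow>\<^sub>0 nat) \<Rightarrow>\<^sub>0 real) \<Rightarrow> ('a set \<times> ('a \<Rightarrow>\<^sub>0 nat) \<Rightarrow>\<^sub>0 real)" where
  "psi = lin_ext (\<lambda>x. unslice x (restr (base x) z))"

definition thetaM :: "nat \<Rightarrow> (('a \<Rightarrow>\<^sub>0 nat) \<Rightarrow>\<^sub>0 real) \<Rightarrow> (('a \<Rightarrow>\<^sub>0 nat) \<Rightarrow>\<^sub>0 real)" where
  "thetaM r = lin_ext (\<lambda>x. \<Sum>i\<in>M. t r i *\<^sub>R basis_elem (x + evar i))"

lemma linear_psi: "linear psi" and linear_thetaM: "linear (thetaM r)"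
  unfolding psi_def thetaM_def by (rule linear_lin_ext)+

lemma finite_mons_M: "finite (mons M d)" by (rule finite_mons[OF finM])

lemma lookup_psi: "lookup (psi f) (\<sigma>, x) =
    (if base x \<subseteq> \<sigma> then lookup f x * lookup z \<sigma> else 0)"
proof -
  have "lookup (psi f) (\<sigma>, x) =
      (\<Sum>b\<in>keys f. if b = x then
        lookup f b * (if base x \<subseteq> \<sigma> then lookup z \<sigma> else 0) else 0)"
    unfolding psi_def lin_ext_def lookup_sum
    by (intro sum.cong) (auto simp: lookup_unslice lookup_restr)
  then show ?thesis by (auto simp: in_keys_iff)
qed

lemma psi_ker: "{f \<in> D d. psi f = 0} = SR d"
proof (intro subset_antisym subsetI)
  fix f assume "f \<in> {f \<in> D d. psi f = 0}"
  then have f: "f \<in> D d" "psi f = 0" by auto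
  have "base x \<notin> L" if x: "x \<in> keys f" for x
  proof
    assume "base x \<in> L"
    then obtain \<sigma> where \<sigma>: "\<sigma> \<in> L" "base x \<subseteq> \<sigma>" "card \<sigma> = m" using pure by blast
    have "lookup (psi f) (\<sigma>, x) \<noteq> 0"
      using \<sigma> x z_nonzero by (simp add: lookup_psi in_keys_iff facets_def)
    then show False using f by simp
  qed
  then show "f \<in> SR d" using f by (auto simp: SR_def coords_def)
next
  fix f assume f: "f \<in> SR d"
  have "psi f = (\<lambda>_. 0) f"
  proof (rule linear_eq_on_coords[OF linear_psi linear_zero _ f[unfolded SR_def]])
    fix x assume x: "x \<in> {x \<in> mons M d. base x \<notin> L}"
    show "psi (basis_elem x) = 0"
    proof (rule poly_mapping_eqI)
      fix b :: "'a set \<times> ('a \<Rightarrow>\<^sub>0 nat)"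
      obtain \<sigma> y where b: "b = (\<sigma>, y)" by fastforce
      have "lookup z \<sigma> = 0" if "base x \<subseteq> \<sigma>"
      proof (rule ccontr)
        assume "lookup z \<sigma> \<noteq> 0"
        then have "\<sigma> \<in> L" using z_facets by (auto simp: coords_def in_keys_iff facets_def)
        then show False using x that face_subset by blast
      qed
      then show "lookup (psi (basis_elem x)) b = lookup 0 b"
        by (auto simp: b lookup_psi lookup_single_one)
    qed
  qed
  then show "f \<in> {f \<in> D d. psi f = 0}" using f by (auto simp: SR_def coords_def)
qed

text \<open>The slice at \<open>x\<close> of an element of \<open>K m d\<close> is a top cycle of
  the star of \<open>base x\<close>. By \<open>star_top\<close> it is a multiple of
  \<open>restr (base x) z\<close>, the slice of the image of \<open>x\<close> under
  \<open>psi\<close>.\<close>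

lemma psi_image: "psi ` D d = K m d"
proof (intro subset_antisym subsetI)
  fix g assume "g \<in> psi ` D d"
  then obtain f where f: "f \<in> D d" "g = psi f" by blast
  have sub: "subspace (K m d)" using graded_K by (rule graded_module.sub)
  show "g \<in> K m d" unfolding f(2) psi_def
  proof (rule lin_ext_in_subspace[OF sub _ f(1)])
    fix x assume x: "x \<in> mons M d"
    have "unslice x (restr (base x) z) \<in> F m d"
      unfolding unslice_def
    proof (rule lin_ext_in_subspace[OF subspace_coords _ restr_z_star])
      fix \<sigma> assume "\<sigma> \<in> star (base x) m"
      then show "basis_elem (\<sigma>, x) \<in> F m d"
        using x by (intro single_in_coords) (auto simp: FI_def star_def mons_def)
    qed
    moreover have "bd (unslice x (restr (base x) z)) = 0"
      using bd_unslice[OF restr_z_star refl] by (simp add: star_bd_restr_z linear_0[OF linear_unslice])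
    ultimately show "unslice x (restr (base x) z) \<in> K m d" by (simp add: K_def)
  qed
next
  fix f assume "f \<in> K m d"
  then have f: "f \<in> F m d" "bd f = 0" by (auto simp: K_def)
  have "\<exists>c. slice x f = c *\<^sub>R restr (base x) z" for x
  proof (cases "base x \<in> L")
    case True
    have "star_bd (base x) (slice x f) = 0"
      using star_bd_slice[OF f(1)] f(2) linear_0[OF linear_slice] by simp
    then show ?thesis using star_top[OF True slice_star[OF f(1)]] by metis
  next
    case False
    then have "slice x f = 0" using slice_star[OF f(1), of x] star_empty by (auto simp: coords_def)
    then show ?thesis by (metis scaleR_zero_left)
  qed
  then obtain c where c: "\<And>x. slice x f = c x *\<^sub>R restr (base x) z" by metis
  have "f = (\<Sum>x\<in>mons M d. unslice x (slice x f))"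
    by (rule unslice_sum[OF f(1) finite_mons_M]) (use LM kM in \<open>auto simp: FI_def mons_def\<close>)
  also have "\<dots> = (\<Sum>x\<in>mons M d. psi (c x *\<^sub>R basis_elem x))"
    unfolding c by (intro sum.cong refl) (simp add: linear_scale[OF linear_unslice] psi_def)
  also have "\<dots> = psi (\<Sum>x\<in>mons M d. c x *\<^sub>R basis_elem x)"
    by (simp only: linear_sum[OF linear_psi])
  finally show "f \<in> psi ` D d"
    by (rule image_eqI) (intro subspace_sum subspace_scale subspace_coords single_in_coords)
qed

lemma psi_theta: "psi (thetaM r f) = theta r (psi f)"
proof -
  have "(psi \<circ> thetaM r) f = (theta r \<circ> psi) f"
  proof (rule linear_eq_on_coords[OF linear_compose[OF linear_thetaM linear_psi]
        linear_compose[OF linear_psi linear_theta], where A = UNIV])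
    fix x :: "'a \<Rightarrow>\<^sub>0 nat"
    have finF: "finite facets" using finite_L by (simp add: facets_def)
    have psi_basis: "psi (basis_elem y) = (\<Sum>\<sigma>\<in>facets. (if base y \<subseteq> \<sigma> then lookup z \<sigma> else 0) *\<^sub>R basis_elem (\<sigma>, y))" for y
    proof (rule poly_mapping_eqI)
      fix b :: "'a set \<times> ('a \<Rightarrow>\<^sub>0 nat)"
      obtain \<sigma> w where b: "b = (\<sigma>, w)" by fastforce
      have "lookup (\<Sum>\<sigma>\<in>facets. (if base y \<subseteq> \<sigma> then lookup z \<sigma> else 0) *\<^sub>R basis_elem (\<sigma>, y)) b
         = (\<Sum>\<tau>\<in>facets. if \<tau> = \<sigma> then (if base y \<subseteq> \<sigma> \<and> y = w then lookup z \<sigma> else 0) else 0)"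
        unfolding lookup_sum b by (intro sum.cong refl) (simp add: lookup_single_one)
      also have "\<dots> = (if base y \<subseteq> \<sigma> \<and> y = w then lookup z \<sigma> else 0)"
        using finF z_facets by (auto simp: coords_def in_keys_iff)
      finally show "lookup (psi (basis_elem y)) b =
        lookup (\<Sum>\<sigma>\<in>facets. (if base y \<subseteq> \<sigma> then lookup z \<sigma> else 0) *\<^sub>R basis_elem (\<sigma>, y)) b"
        by (auto simp: b lookup_psi lookup_single_one)
    qed
    let ?z = "\<lambda>y \<sigma>. if base y \<subseteq> \<sigma> then lookup z \<sigma> else 0"
    have "(psi \<circ> thetaM r) (basis_elem x) =
        (\<Sum>i\<in>M. \<Sum>\<sigma>\<in>facets. (t r i * ?z (x + evar i) \<sigma>) *\<^sub>R basis_elem (\<sigma>, x + evar i))"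
      by (simp only: o_apply thetaM_def lin_ext_single scaleR_one linear_sum[OF linear_psi]
          linear_scale[OF linear_psi] psi_basis scaleR_sum_right scaleR_scaleR mult_1)
    also have "\<dots> = (\<Sum>\<sigma>\<in>facets. \<Sum>i\<in>M. (t r i * ?z (x + evar i) \<sigma>) *\<^sub>R basis_elem (\<sigma>, x + evar i))"
      by (rule sum.swap)
    also have "\<dots> = (\<Sum>\<sigma>\<in>facets. \<Sum>i\<in>insert k \<sigma>. (?z x \<sigma> * t r i) *\<^sub>R basis_elem (\<sigma>, x + evar i))"
    proof (rule sum.cong[OF refl])
      fix \<sigma> assume "\<sigma> \<in> facets"
      then have "\<sigma> \<in> L" by (simp add: facets_def)
      then have s: "insert k \<sigma> \<subseteq> M" using LM kM by blast
      show "(\<Sum>i\<in>M. (t r i * ?z (x + evar i) \<sigma>) *\<^sub>R basis_elem (\<sigma>, x + evar i)) =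
          (\<Sum>i\<in>insert k \<sigma>. (?z x \<sigma> * t r i) *\<^sub>R basis_elem (\<sigma>, x + evar i))"
      proof (rule sum.mono_neutral_cong_right[OF finM s])
        show "\<forall>i\<in>M - insert k \<sigma>. (t r i * ?z (x + evar i) \<sigma>) *\<^sub>R basis_elem (\<sigma>, x + evar i) = 0"
          by (auto simp: keys_add_nat)
        fix i assume "i \<in> insert k \<sigma>"
        then have "?z (x + evar i) \<sigma> = ?z x \<sigma>" by (auto simp: keys_add_nat)
        then show "(t r i * ?z (x + evar i) \<sigma>) *\<^sub>R basis_elem (\<sigma>, x + evar i) =
            (?z x \<sigma> * t r i) *\<^sub>R basis_elem (\<sigma>, x + evar i)" by (simp only: mult.commute)
      qed
    qed
    also have "\<dots> = (theta r \<circ> psi) (basis_elem x)"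
      by (simp only: o_apply psi_basis linear_sum[OF linear_theta] linear_scale[OF linear_theta]
          theta_basis scaleR_sum_right scaleR_scaleR)
    finally show "(psi \<circ> thetaM r) (basis_elem x) = (theta r \<circ> psi) (basis_elem x)" .
  qed (simp add: coords_def)
  then show ?thesis by simp
qed

text \<open>The monomials outside the Stanley-Reisner ideal are sorted by the face that is their
  support off \<open>k\<close>.\<close>

lemma dim_K: "int (dim (K m d)) = hilb L 0 d"
proof -
  let ?A = "mons M d" and ?B = "{x \<in> mons M d. base x \<notin> L}"
  have "dim (D d) = dim (K m d) + dim (SR d)"
    using rank_nullity[OF linear_psi subspace_coords fin_dim_coords[OF finite_mons_M]]
    unfolding psi_image psi_ker .
  moreover have "dim (SR d) = card ?B" unfolding SR_def
    by (rule dim_coords) (use finite_mons_M in simp)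
  ultimately have "card ?A = dim (K m d) + card ?B" by (simp add: dim_coords[OF finite_mons_M])
  moreover have "card ?A = card (?A - ?B) + card ?B"
    using finite_mons_M card_mono[of ?A ?B] by (subst card_Diff_subset) auto
  ultimately have "dim (K m d) = card (?A - ?B)" by simp
  also have "?A - ?B = (\<Union>S\<in>L. cone_mons k S d)"
    using LM kM by (auto simp: mons_def cone_mons_def)
  also have "card \<dots> = (\<Sum>S\<in>L. card (cone_mons k S d))"
    using card_cone_mons[OF finite_face k_notin] finite_L
    by (intro card_UN_disjoint) (auto simp: cone_mons_def)
  also have "\<dots> = (\<Sum>S\<in>L. d choose card S)"
    using card_cone_mons[OF finite_face k_notin] by (intro sum.cong refl) auto
  finally show ?thesis by simp
qed

lemma h_K: "s \<le> Suc m \<Longrightarrow> graded_module.h theta (K m) s d = hilb L s d"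
proof -
  interpret G: graded_module theta "K m" by (rule graded_K)
  show "s \<le> Suc m \<Longrightarrow> G.h s d = hilb L s d"
  proof (induct s arbitrary: d)
    case 0 then show ?case using dim_K by simp
  next
    case (Suc s)
    show ?case
    proof (cases d)
      case 0
      then show ?thesis using Suc by (metis G.h_deg_0 Suc_leD hilb.simps(2))
    next
      case (Suc e)
      then show ?thesis
        using Suc.hyps Suc.prems G.h_Suc_regular[OF regular_K[OF order_refl], of s e] by simp
    qed
  qed
qed

text \<open>The ideal generated by the linear forms and the nonfaces, defined through
  \<open>psi\<close> so that its codimension is a value of the h-vector. Explicit generators are
  recovered in \<open>T_SucE\<close>.\<close>

definition T :: "nat \<Rightarrow> (('a \<Rightarrow>\<^sub>0 nat) \<Rightarrow>\<^sub>0 real) set" where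
  "T d = {f \<in> D d. psi f \<in> gideal theta (K m) (Suc m) d}"

lemma subspace_T: "subspace (T d)"
proof -
  interpret G: graded_module theta "K m" by (rule graded_K)
  show ?thesis unfolding T_def
    using subspace_inter[OF subspace_coords linear_subspace_vimage[OF linear_psi G.gideal_subspace]]
    by (simp add: Int_def vimage_def)
qed

lemma T_D: "T d \<subseteq> D d" by (auto simp: T_def)

lemma dim_T: "int (dim (D d)) - int (dim (T d)) = hilb L (Suc m) d"
proof -
  interpret G: graded_module theta "K m" by (rule graded_K)
  have "psi ` T d = gideal theta (K m) (Suc m) d"
  proof
    show "gideal theta (K m) (Suc m) d \<subseteq> psi ` T d"
    proof
      fix g assume g: "g \<in> gideal theta (K m) (Suc m) d"
      then have "g \<in> psi ` D d" unfolding psi_image using G.gideal_subset by blast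
      then show "g \<in> psi ` T d" using g by (auto simp: T_def)
    qed
  qed (auto simp: T_def)
  moreover have "{f \<in> T d. psi f = 0} = SR d"
    using subspace_0[OF G.gideal_subspace[of "Suc m" d]] unfolding psi_ker[symmetric] T_def by auto
  ultimately have "dim (T d) = dim (gideal theta (K m) (Suc m) d) + dim (SR d)"
    using rank_nullity[OF linear_psi subspace_T fin_dim_subset[OF fin_dim_coords[OF finite_mons_M] T_D], of d]
    by simp
  moreover have "dim (D d) = dim (K m d) + dim (SR d)"
    using rank_nullity[OF linear_psi subspace_coords fin_dim_coords[OF finite_mons_M]]
    unfolding psi_image psi_ker .
  ultimately show ?thesis using h_K[of "Suc m" d] by (simp add: G.h_def)
qed

lemma T_0: "T 0 = SR 0"
  using psi_ker[of 0] by (auto simp: T_def)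

lemma T_SucE:
  assumes "f \<in> T (Suc e)"
  obtains g s where "\<And>r. r \<le> m \<Longrightarrow> g r \<in> D e" "s \<in> SR (Suc e)" "f = (\<Sum>r\<le>m. thetaM r (g r)) + s"
proof -
  interpret G: graded_module theta "K m" by (rule graded_K)
  have "psi f \<in> gideal theta (K m) (Suc m) (Suc e)" using assms by (simp add: T_def)
  then obtain y where y: "\<And>r. r < Suc m \<Longrightarrow> y r \<in> K m e" "psi f = (\<Sum>r<Suc m. theta r (y r))"
    using G.gideal_sumE[of "psi f" "Suc m" e thesis] by (metis (no_types) G.gideal_sumE)
  then have "\<exists>g. g \<in> D e \<and> y r = psi g" if "r < Suc m" for r
    using that unfolding psi_image[symmetric] by blast
  then obtain g where g: "\<And>r. r < Suc m \<Longrightarrow> g r \<in> D e \<and> y r = psi (g r)" by metis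
  define s where "s = f - (\<Sum>r\<le>m. thetaM r (g r))"
  have th: "thetaM r u \<in> D (Suc e)" if "u \<in> D e" for r u
    unfolding thetaM_def
    by (rule lin_ext_in_subspace[OF subspace_coords _ that])
      (intro subspace_sum subspace_scale subspace_coords single_in_coords mons_add_var)
  have "s \<in> D (Suc e)" unfolding s_def
    using assms g by (intro subspace_diff subspace_sum subspace_coords th) (auto simp: T_def)
  moreover have "psi s = 0"
    using y(2) g by (simp add: s_def linear_diff[OF linear_psi] linear_sum[OF linear_psi] psi_theta lessThan_Suc_atMost)
  ultimately have "s \<in> SR (Suc e)" using psi_ker by blast
  show ?thesis
  proof (rule that)
    show "g r \<in> D e" if "r \<le> m" for r using g[of r] that by simp
    show "s \<in> SR (Suc e)" by fact
    show "f = (\<Sum>r\<le>m. thetaM r (g r)) + s" by (simp add: s_def)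
  qed
qed

lemma T_top: "T (Suc m) = D (Suc m)"
  using dim_T[of "Suc m"] hilb_top[of "Suc m"]
  by (intro fin_dim_eqI[OF fin_dim_coords[OF finite_mons_M] T_D subspace_T]) simp

end

section \<open>Poincare duality through point evaluations\<close>

definition monom_at :: "('a \<Rightarrow>\<^sub>0 nat) \<Rightarrow> ('a \<Rightarrow> real) \<Rightarrow> real" where
  "monom_at x q = (\<Prod>i\<in>keys x. q i ^ lookup x i)"

lemma monom_at_superset:
  "finite A \<Longrightarrow> keys x \<subseteq> A \<Longrightarrow> monom_at x q = (\<Prod>i\<in>A. q i ^ lookup x i)"
  unfolding monom_at_def by (rule prod.mono_neutral_left) (auto simp: in_keys_iff)

lemma monom_at_add: "monom_at (x + y) q = monom_at x q * monom_at y q"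
proof -
  let ?A = "keys x \<union> keys y"
  have "monom_at x q = (\<Prod>i\<in>?A. q i ^ lookup x i)"
    "monom_at y q = (\<Prod>i\<in>?A. q i ^ lookup y i)"
    "monom_at (x + y) q = (\<Prod>i\<in>?A. q i ^ lookup (x + y) i)"
    by (rule monom_at_superset; simp add: keys_add_nat)+
  then show ?thesis by (simp add: lookup_add power_add prod.distrib)
qed

lemma monom_at_0 [simp]: "monom_at 0 q = 1" by (simp add: monom_at_def)

lemma monom_at_single [simp]: "monom_at (single i a) q = q i ^ a"
  using monom_at_superset[of "{i}" "single i a" q] by simp

lemma monom_at_zero: "i \<in> keys x \<Longrightarrow> q i = 0 \<Longrightarrow> monom_at x q = 0"
  unfolding monom_at_def by (rule prod_zero) (auto simp: in_keys_iff)

definition set_monom :: "'a set \<Rightarrow> ('a \<Rightarrow>\<^sub>0 nat)" where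
  "set_monom S = (\<Sum>i\<in>S. single i 1)"

lemma lookup_set_monom: "finite S \<Longrightarrow> lookup (set_monom S) i = (if i \<in> S then 1 else 0)"
  by (simp add: set_monom_def lookup_sum lookup_single when_def)

lemma keys_set_monom: "finite S \<Longrightarrow> keys (set_monom S) = S"
  by (auto simp: in_keys_iff lookup_set_monom split: if_splits)

lemma mdeg_set_monom: "finite S \<Longrightarrow> mdeg (set_monom S) = card S"
  by (simp add: mdeg_def keys_set_monom lookup_set_monom)

lemma monom_at_set_monom: "finite S \<Longrightarrow> monom_at (set_monom S) q = (\<Prod>i\<in>S. q i)"
  by (simp add: monom_at_def keys_set_monom lookup_set_monom)

text \<open>The points are the solutions of the inhomogeneous linear system \<open>theta r = \<tau> r\<close> on the cones over the
  facets; evaluation there deforms the Artinian quotient of the face ring to a ring of functions.\<close>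

locale sphere_points = sphere_cone m L z M k t
  for m :: nat and L :: "'a::linorder set set" and z M k t +
  fixes p :: "'a set \<Rightarrow> 'a \<Rightarrow> real" and c :: "'a set \<Rightarrow> real" and \<tau> :: "nat \<Rightarrow> real"
  assumes p_zero: "\<sigma> \<in> facets \<Longrightarrow> i \<in> M \<Longrightarrow> i \<notin> insert k \<sigma> \<Longrightarrow> p \<sigma> i = 0"
    and p_nz: "\<sigma> \<in> facets \<Longrightarrow> i \<in> insert k \<sigma> \<Longrightarrow> p \<sigma> i \<noteq> 0"
    and c_nz: "\<sigma> \<in> facets \<Longrightarrow> c \<sigma> \<noteq> 0"
    and p_theta: "\<sigma> \<in> facets \<Longrightarrow> (\<Sum>i\<in>insert k \<sigma>. t r i * p \<sigma> i) = \<tau> r"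
    and orth: "x \<in> mons M d \<Longrightarrow> d < m \<Longrightarrow> (\<Sum>\<sigma>\<in>facets. c \<sigma> * monom_at x (p \<sigma>)) = 0"
begin

lemma finite_facets: "finite facets" using finite_L by (simp add: facets_def)

section \<open>Evaluation at the points and its filtration by degree\<close>

definition ev :: "(('a \<Rightarrow>\<^sub>0 nat) \<Rightarrow>\<^sub>0 real) \<Rightarrow> ('a set \<Rightarrow>\<^sub>0 real)" where
  "ev = lin_ext (\<lambda>x. \<Sum>\<sigma>\<in>facets. monom_at x (p \<sigma>) *\<^sub>R basis_elem \<sigma>)"

lemma linear_ev: "linear ev" unfolding ev_def by (rule linear_lin_ext)

lemma ev_facets: "ev f \<in> coords facets"
  unfolding ev_def
  by (rule lin_ext_in_subspace[OF subspace_coords, where A = UNIV])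
    (auto simp: coords_def[of UNIV] intro!: subspace_sum subspace_scale subspace_coords single_in_coords)

lemma lookup_ev_basis:
  "lookup (ev (basis_elem x)) \<sigma> = (if \<sigma> \<in> facets then monom_at x (p \<sigma>) else 0)"
proof -
  have "lookup (ev (basis_elem x)) \<sigma> =
      (\<Sum>\<rho>\<in>facets. if \<rho> = \<sigma> then monom_at x (p \<rho>) else 0)"
    unfolding ev_def lin_ext_single scaleR_one lookup_sum
    by (intro sum.cong refl) (simp add: lookup_single_one)
  then show ?thesis using finite_facets by simp
qed

lemma lookup_ev: "\<sigma> \<in> facets \<Longrightarrow> lookup (ev f) \<sigma> =
    (\<Sum>x\<in>keys f. lookup f x * monom_at x (p \<sigma>))"
proof -
  assume s: "\<sigma> \<in> facets"
  have "ev f = (\<Sum>x\<in>keys f. lookup f x *\<^sub>R ev (basis_elem x))"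
    by (simp add: ev_def lin_ext_def)
  then show ?thesis using s by (simp add: lookup_sum lookup_ev_basis)
qed

text \<open>Functions on the facets given by polynomials of degree below \<open>d\<close>. The
  strict bound makes \<open>G 0\<close> zero and pairs the index \<open>d\<close> with
  \<open>Suc m - d\<close>.\<close>

fun G :: "nat \<Rightarrow> ('a set \<Rightarrow>\<^sub>0 real) set" where
  "G 0 = {0}"
| "G (Suc d) = {a + ev f | a f. a \<in> G d \<and> f \<in> D d}"

lemma subspace_G: "subspace (G d)"
  by (induct d) (auto intro: subspace_sum_image linear_ev subspace_coords simp: subspace_sum_image[OF linear_ev _ subspace_coords])

lemma G_minimal:
  assumes S: "subspace S" and "\<And>i x. i < d \<Longrightarrow> x \<in> mons M i \<Longrightarrow> ev (basis_elem x) \<in> S"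
  shows "G d \<subseteq> S"
  using assms(2)
proof (induct d)
  case 0 then show ?case using subspace_0[OF S] by simp
next
  case (Suc d)
  have "ev f \<in> S" if "f \<in> D d" for f
  proof -
    have "f = (\<Sum>x\<in>mons M d. lookup f x *\<^sub>R basis_elem x)"
      by (rule poly_mapping_expansion[OF finite_mons_M that])
    then have "ev f = ev (\<Sum>x\<in>mons M d. lookup f x *\<^sub>R basis_elem x)" by simp
    also have "\<dots> = (\<Sum>x\<in>mons M d. lookup f x *\<^sub>R ev (basis_elem x))"
      by (simp only: linear_sum[OF linear_ev] linear_scale[OF linear_ev])
    also have "\<dots> \<in> S" using Suc.prems by (intro subspace_sum subspace_scale S) auto
    finally show ?thesis .
  qed
  moreover have "G d \<subseteq> S" by (rule Suc.hyps, rule Suc.prems) auto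
  ultimately show ?case using subspace_add[OF S] by auto
qed

lemma G_facets: "G d \<subseteq> coords facets"
  by (rule G_minimal[OF subspace_coords ev_facets])

lemma fin_dim_G: "fin_dim (G d)"
  by (rule fin_dim_subset[OF fin_dim_coords[OF finite_facets] G_facets])

lemma ev_in_G: "f \<in> D d \<Longrightarrow> ev f \<in> G (Suc d)"
  using subspace_0[OF subspace_G[of d]] by force

text \<open>The squarefree monomial of a facet vanishes at the points of all other facets, since one
  of its vertices is missing there. It has degree \<open>m\<close>, whence the index
  \<open>Suc m\<close>.\<close>

lemma G_top: "G (Suc m) = coords facets"
proof (rule subset_antisym[OF G_facets])
  have "basis_elem \<sigma> \<in> G (Suc m)" if s: "\<sigma> \<in> facets" for \<sigma>
  proof -
    have \<sigma>: "finite \<sigma>" "\<sigma> \<in> L" "card \<sigma> = m" using s finite_face by (auto simp: facets_def)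
    let ?x = "set_monom \<sigma>"
    have x: "?x \<in> mons M m" using \<sigma> LM by (auto simp: mons_def keys_set_monom mdeg_set_monom)
    have nz: "monom_at ?x (p \<sigma>) \<noteq> 0" using p_nz[OF s] \<sigma>(1) by (simp add: monom_at_set_monom)
    have "ev (basis_elem ?x) = monom_at ?x (p \<sigma>) *\<^sub>R basis_elem \<sigma>"
    proof (rule poly_mapping_eqI)
      fix \<rho>
      have "monom_at ?x (p \<rho>) = 0" if r: "\<rho> \<in> facets" "\<rho> \<noteq> \<sigma>"
      proof -
        have "\<rho> \<in> L" "finite \<rho>" "card \<rho> = m" using r finite_face by (auto simp: facets_def)
        then have "\<not> \<sigma> \<subseteq> \<rho>" using card_subset_eq[of \<rho> \<sigma>] r(2) \<sigma>(3) by auto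
        then obtain i where i: "i \<in> \<sigma>" "i \<notin> \<rho>" by blast
        then have "i \<in> M" "i \<notin> insert k \<rho>" using LM[OF \<sigma>(2)] by auto
        then have "p \<rho> i = 0" by (rule p_zero[OF r(1)])
        then show ?thesis using i \<sigma>(1) by (intro monom_at_zero[of i]) (simp_all add: keys_set_monom)
      qed
      then show "lookup (ev (basis_elem ?x)) \<rho> =
          lookup (monom_at ?x (p \<sigma>) *\<^sub>R basis_elem \<sigma>) \<rho>"
        using s by (auto simp: lookup_ev_basis lookup_single_one)
    qed
    then have "basis_elem \<sigma> = (1 / monom_at ?x (p \<sigma>)) *\<^sub>R ev (basis_elem ?x)" using nz by simp
    also have "\<dots> \<in> G (Suc m)"
      by (intro subspace_scale[OF subspace_G] ev_in_G single_in_coords x)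
    finally show ?thesis .
  qed
  then show "coords facets \<subseteq> G (Suc m)"
    unfolding coords_span[OF finite_facets] by (intro span_minimal subspace_G) auto
qed

lemma ev_SR: "f \<in> SR d \<Longrightarrow> ev f = 0"
proof -
  assume f: "f \<in> SR d"
  have "ev f = (\<lambda>_. 0) f"
  proof (rule linear_eq_on_coords[OF linear_ev linear_zero _ f[unfolded SR_def]])
    fix x assume x: "x \<in> {x \<in> mons M d. base x \<notin> L}"
    show "ev (basis_elem x) = 0"
    proof (rule poly_mapping_eqI)
      fix \<sigma>
      have "monom_at x (p \<sigma>) = 0" if s: "\<sigma> \<in> facets"
      proof -
        have "\<sigma> \<in> L" using s by (simp add: facets_def)
        then have "\<not> base x \<subseteq> \<sigma>" using x face_subset by blast
        then obtain i where i: "i \<in> keys x" "i \<notin> insert k \<sigma>" by blast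
        have "i \<in> M" using i x by (auto simp: mons_def)
        then show ?thesis using p_zero[OF s _ i(2)] i(1) by (intro monom_at_zero[of i]) auto
      qed
      then show "lookup (ev (basis_elem x)) \<sigma> = lookup 0 \<sigma>"
        by (simp add: lookup_ev_basis)
    qed
  qed
  then show ?thesis by simp
qed

text \<open>At every point the \<open>r\<close>-th form has the value \<open>\<tau> r\<close>, so
  multiplying by it does not move a function up in the filtration.\<close>

lemma ev_theta: "ev (thetaM r f) = \<tau> r *\<^sub>R ev f"
proof -
  have "(ev \<circ> thetaM r) f = ((\<lambda>g. \<tau> r *\<^sub>R g) \<circ> ev) f"
  proof (rule linear_eq_on_coords[OF linear_compose[OF linear_thetaM linear_ev]
        linear_compose[OF linear_ev linear_scale_self], where A = UNIV])
    fix x :: "'a \<Rightarrow>\<^sub>0 nat"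
    have 1: "ev (thetaM r (basis_elem x)) = (\<Sum>i\<in>M. t r i *\<^sub>R ev (basis_elem (x + evar i)))"
      by (simp only: thetaM_def lin_ext_single scaleR_one linear_sum[OF linear_ev] linear_scale[OF linear_ev])
    have "lookup (ev (thetaM r (basis_elem x))) \<sigma> =
        lookup (\<tau> r *\<^sub>R ev (basis_elem x)) \<sigma>" for \<sigma>
    proof (cases "\<sigma> \<in> facets")
      case True
      then have "insert k \<sigma> \<subseteq> M" using LM kM by (auto simp: facets_def)
      then have "(\<Sum>i\<in>M. t r i * p \<sigma> i) = (\<Sum>i\<in>insert k \<sigma>. t r i * p \<sigma> i)"
        using finM p_zero[OF True] by (intro sum.mono_neutral_right) auto
      then have "(\<Sum>i\<in>M. t r i * p \<sigma> i) = \<tau> r" using p_theta[OF True] by simp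
      then have "monom_at x (p \<sigma>) * (\<Sum>i\<in>M. t r i * p \<sigma> i) = \<tau> r * monom_at x (p \<sigma>)" by simp
      then show ?thesis using True
        by (simp add: 1 lookup_sum lookup_ev_basis monom_at_add sum_distrib_left mult_ac)
    qed (simp add: 1 lookup_sum lookup_ev_basis)
    then show "(ev \<circ> thetaM r) (basis_elem x) = ((\<lambda>g. \<tau> r *\<^sub>R g) \<circ> ev) (basis_elem x)"
      by (intro poly_mapping_eqI) simp
  qed (simp add: coords_def)
  then show ?thesis by simp
qed

text \<open>Forms that agree at the points with a polynomial of lower degree, that is, leading forms
  of polynomials vanishing at all points.\<close>

definition Z :: "nat \<Rightarrow> (('a \<Rightarrow>\<^sub>0 nat) \<Rightarrow>\<^sub>0 real) set" where
  "Z d = {f \<in> D d. ev f \<in> G d}"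

lemma T_Z: "T d \<subseteq> Z d"
proof
  fix f assume f: "f \<in> T d"
  show "f \<in> Z d"
  proof (cases d)
    case 0
    then show ?thesis using f T_0 ev_SR T_D[of d] by (auto simp: Z_def)
  next
    case (Suc e)
    obtain g s where gs: "\<And>r. r \<le> m \<Longrightarrow> g r \<in> D e" "s \<in> SR (Suc e)" "f = (\<Sum>r\<le>m. thetaM r (g r)) + s"
      using T_SucE[of f e] f Suc by blast
    have "ev f = (\<Sum>r\<le>m. \<tau> r *\<^sub>R ev (g r))"
      unfolding gs(3) by (simp add: linear_add[OF linear_ev] linear_sum[OF linear_ev] ev_theta ev_SR[OF gs(2)])
    also have "\<dots> \<in> G (Suc e)"
      by (intro subspace_sum subspace_scale subspace_G ev_in_G gs(1)) simp
    finally show ?thesis using f T_D[of d] Suc by (auto simp: Z_def)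
  qed
qed

lemma fin_dim_Z: "fin_dim (Z d)"
  by (rule fin_dim_subset[OF fin_dim_coords[OF finite_mons_M]]) (auto simp: Z_def)

lemma dim_G_Suc: "dim (G (Suc d)) + dim (Z d) = dim (G d) + dim (D d)"
  unfolding Z_def G.simps
  by (rule dim_sum_image(1)[OF linear_ev subspace_G fin_dim_G subspace_coords fin_dim_coords[OF finite_mons_M]])

lemma dim_G_0: "dim (G 0) = 0"
  using dim_le_card[of "G 0" "{}"] by simp

lemma dim_G_step_le: "int (dim (G (Suc d))) - int (dim (G d)) \<le> hilb L (Suc m) d"
  using dim_G_Suc[of d] fin_dim_mono[OF fin_dim_Z T_Z, of d] dim_T[of d] by linarith

text \<open>Each step is bounded by an entry of the h-vector because \<open>T\<close> is contained
  in \<open>Z\<close>. Both sides add up to the number of facets, so every bound is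
  attained.\<close>

lemma dim_G_step: "d \<le> m \<Longrightarrow> int (dim (G (Suc d))) - int (dim (G d)) = hilb L (Suc m) d"
proof -
  assume d: "d \<le> m"
  have "(\<Sum>d\<le>m. int (dim (G (Suc d))) - int (dim (G d))) = int (dim (G (Suc m))) - int (dim (G 0))"
    unfolding lessThan_Suc_atMost[symmetric] by (rule sum_lessThan_telescope)
  also have "\<dots> = (\<Sum>d\<le>m. hilb L (Suc m) d)"
    unfolding sum_hilb_total G_top dim_G_0 dim_coords[OF finite_facets] by simp
  finally show ?thesis
    using d dim_G_step_le
    by (intro sum_mono_inv[where I = "{..m}" and i = d and g = "hilb L (Suc m)"]) (simp_all del: G.simps)
qed

lemma Z_eq_T: "d \<le> m \<Longrightarrow> Z d = T d"
  using dim_G_Suc[of d] dim_G_step[of d] dim_T[of d]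
  by (intro fin_dim_eqI[OF fin_dim_Z T_Z subspace_T, symmetric]) linarith

lemma dim_G_sum: "e \<le> m \<Longrightarrow> int (dim (G (Suc e))) = (\<Sum>d\<le>e. hilb L (Suc m) d)"
proof (induct e)
  case 0 then show ?case using dim_G_step[of 0] dim_G_0 by simp
next
  case (Suc e) then show ?case using dim_G_step[of "Suc e"] by simp
qed

section \<open>Orthogonality of complementary filtration steps\<close>

definition W :: "('a set \<Rightarrow>\<^sub>0 real) \<Rightarrow> ('a set \<Rightarrow>\<^sub>0 real)" where
  "W = lin_ext (\<lambda>\<sigma>. c \<sigma> *\<^sub>R basis_elem \<sigma>)"

lemma linear_W: "linear W" unfolding W_def by (rule linear_lin_ext)

lemma lookup_W: "lookup (W f) \<sigma> = c \<sigma> * lookup f \<sigma>"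
proof -
  have "lookup (W f) \<sigma> =
      (\<Sum>b\<in>keys f. if b = \<sigma> then c b * lookup f b else 0)"
    unfolding W_def lin_ext_def lookup_sum
    by (intro sum.cong refl) (auto simp: lookup_single_one)
  then show ?thesis by (auto simp: in_keys_iff)
qed

lemma W_inj: "f \<in> coords facets \<Longrightarrow> W f = 0 \<Longrightarrow> f = 0"
proof (rule poly_mapping_eqI)
  fix \<sigma> assume f: "f \<in> coords facets" "W f = 0"
  then have "c \<sigma> * lookup f \<sigma> = 0" using lookup_W[of f \<sigma>] by simp
  then show "lookup f \<sigma> = lookup 0 \<sigma>"
    using c_nz[of \<sigma>] f(1) by (auto simp: coords_def in_keys_iff)
qed

lemma W_facets: "f \<in> coords facets \<Longrightarrow> W f \<in> coords facets"
  unfolding W_def by (erule lin_ext_in_subspace[OF subspace_coords, rotated])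
    (intro subspace_scale subspace_coords single_in_coords)

text \<open>The relevant pairing is weighted by \<open>c\<close>, whose values may have both signs.
  Writing it as \<open>ip (W u) w\<close> moves the weights into one argument and leaves a positive
  definite form, so that \<open>coords_orthogonal\<close> applies to \<open>G (Suc m - d)\<close>
  and the image of \<open>G d\<close> under \<open>W\<close>.\<close>

abbreviation ip :: "('a set \<Rightarrow>\<^sub>0 real) \<Rightarrow> ('a set \<Rightarrow>\<^sub>0 real) \<Rightarrow> real" where
  "ip f g \<equiv> \<Sum>\<sigma>\<in>facets. lookup f \<sigma> * lookup g \<sigma>"

lemma subspace_perp: "subspace {w. ip u w = 0}"
  by (rule subspaceI)
    (simp_all add: lookup_add distrib_left sum.distrib mult.left_commute flip: sum_distrib_left)

lemma subspace_perp': "subspace {u. ip (W u) w = 0}"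
  by (rule subspaceI)
    (simp_all add: lookup_W lookup_add distrib_left distrib_right sum.distrib mult.left_commute mult.assoc
      flip: sum_distrib_left)

lemma ip_W_basis:
  assumes "x \<in> mons M i" "y \<in> mons M j"
  shows "ip (W (ev (basis_elem x))) (ev (basis_elem y)) = (\<Sum>\<sigma>\<in>facets. c \<sigma> * monom_at (x + y) (p \<sigma>))"
  by (intro sum.cong refl) (simp add: lookup_W lookup_ev_basis monom_at_add)

lemma mons_add: "x \<in> mons A i \<Longrightarrow> y \<in> mons A j \<Longrightarrow> x + y \<in> mons A (i + j)"
  by (auto simp: mons_def keys_add_nat mdeg_add)

lemma G_orth:
  assumes "u \<in> G d" "w \<in> G e" "d + e \<le> Suc m"
  shows "ip (W u) w = 0"
proof -
  have "G d \<subseteq> {u. ip (W u) w = 0}"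
  proof (rule G_minimal[OF subspace_perp'])
    fix i x assume x: "i < d" "x \<in> mons M i"
    have "G e \<subseteq> {w. ip (W (ev (basis_elem x))) w = 0}"
    proof (rule G_minimal[OF subspace_perp])
      fix j y assume y: "j < e" "y \<in> mons M j"
      \<comment> \<open>Degrees below \<open>d\<close> and below \<open>e\<close> add up to at most
        \<open>d + e - 2\<close>, hence to less than \<open>m\<close>.\<close>
      have ij: "i + j < m" using x y assms(3) by simp
      show "ev (basis_elem y) \<in> {w. ip (W (ev (basis_elem x))) w = 0}"
        unfolding mem_Collect_eq ip_W_basis[OF x(2) y(2)] by (rule orth[OF mons_add[OF x(2) y(2)] ij])
    qed
    then show "ev (basis_elem x) \<in> {u. ip (W u) w = 0}" using assms(2) by blast
  qed
  then show ?thesis using assms(1) by blast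
qed

lemma dim_WG: "dim (W ` G d) = dim (G d)"
  by (rule dim_image_inj[OF linear_W subspace_G fin_dim_G]) (use W_inj G_facets in blast)

lemma WG_facets: "W ` G d \<subseteq> coords facets"
  using W_facets G_facets by blast

lemma WG_orth: "d \<le> Suc m \<Longrightarrow> u \<in> W ` G d \<Longrightarrow> w \<in> G (Suc m - d) \<Longrightarrow> ip u w = 0"
  using G_orth[of _ d w "Suc m - d"] by auto

lemma dim_G_le: "d \<le> Suc m \<Longrightarrow> dim (G d) + dim (G (Suc m - d)) \<le> card facets"
  using coords_orthogonal(1)[OF finite_facets linear_subspace_image[OF linear_W subspace_G] WG_facets
      subspace_G G_facets WG_orth] by (simp add: dim_WG)

text \<open>The bound \<open>dim_G_le\<close> is summed over all \<open>d\<close>. Its left sides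
  add up to twice the total dimension, which \<open>sum_hilb_half\<close> shows to equal the sum of
  the right sides, so no single bound is strict.\<close>

lemma dim_G_dual: "d \<le> Suc m \<Longrightarrow> dim (G d) + dim (G (Suc m - d)) = card facets"
proof -
  assume d: "d \<le> Suc m"
  let ?g = "\<lambda>d. int (dim (G d))"
  have "(\<Sum>d\<le>Suc m. ?g d) = ?g 0 + (\<Sum>e\<le>m. ?g (Suc e))" by (rule sum.atMost_Suc_shift)
  also have "\<dots> = (\<Sum>e<m. ?g (Suc e)) + ?g (Suc m)"
    by (simp add: dim_G_0 del: G.simps flip: lessThan_Suc_atMost)
  also have "\<dots> = (\<Sum>e<m. \<Sum>d\<le>e. hilb L (Suc m) d) + int (card facets)"
    by (intro arg_cong2[where f = "(+)"] sum.cong refl dim_G_sum)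
      (simp_all add: G_top dim_coords[OF finite_facets] del: G.simps)
  finally have s: "2 * (\<Sum>d\<le>Suc m. ?g d) = int (Suc (Suc m)) * int (card facets)"
    using sum_hilb_half by (simp add: algebra_simps)
  have "(\<Sum>d\<le>Suc m. ?g (Suc m - d)) = (\<Sum>d\<le>Suc m. ?g d)"
    using sum.nat_diff_reindex[of ?g "Suc (Suc m)"] by (simp only: diff_Suc_Suc lessThan_Suc_atMost)
  then have "(\<Sum>d\<le>Suc m. ?g d + ?g (Suc m - d)) = (\<Sum>d\<le>Suc m. int (card facets))"
    using s by (simp only: sum.distrib) simp
  then have "?g d + ?g (Suc m - d) = int (card facets)"
    by (rule sum_mono_inv) (use d dim_G_le in \<open>auto simp del: G.simps simp flip: of_nat_add\<close>)
  then show ?thesis by (simp only: of_nat_add[symmetric] of_nat_eq_iff)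
qed

text \<open>The hypothesis in degree \<open>m - d\<close> and orthogonality in lower degrees make
  \<open>W (ev f)\<close> orthogonal to \<open>G (Suc m - d)\<close>. By \<open>dim_G_dual\<close>
  the orthogonal complement is the image of \<open>G d\<close> under \<open>W\<close>; so
  \<open>f\<close> is a leading form, and these make up \<open>T d\<close>.\<close>

lemma poincare_duality:
  assumes f: "f \<in> D d" and d: "d \<le> m"
    and vanish: "\<And>y. y \<in> mons M (m - d) \<Longrightarrow>
      (\<Sum>\<sigma>\<in>facets. c \<sigma> * (lookup (ev f) \<sigma> * monom_at y (p \<sigma>))) = 0"
  shows "f \<in> T d"
proof -
  have perp: "ip (W (ev f)) w = 0" if "w \<in> G (Suc m - d)" for w
  proof -
    have "G (Suc m - d) \<subseteq> {w. ip (W (ev f)) w = 0}"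
    proof (rule G_minimal[OF subspace_perp], rule CollectI)
      fix i y assume i: "i < Suc m - d" and y: "y \<in> mons M i"
      show "ip (W (ev f)) (ev (basis_elem y)) = 0"
      proof (cases "i = m - d")
        case True
        then show ?thesis using vanish[of y] y by (simp add: lookup_W lookup_ev_basis mult.assoc)
      next
        case False
        have "d + i < m" using i d False by linarith
        then have "Suc d + Suc i \<le> Suc m" by simp
        then show ?thesis
          using G_orth[OF ev_in_G[OF f] ev_in_G[OF single_in_coords[OF y]]] by blast
      qed
    qed
    then show ?thesis using that by blast
  qed
  have "\<exists>u\<in>W ` G d. \<exists>w\<in>G (Suc m - d). W (ev f) = u + w"
  proof (rule coords_orthogonal(2)[OF finite_facets linear_subspace_image[OF linear_W subspace_G] WG_facets
      subspace_G G_facets])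
    show "ip u w = 0" if "u \<in> W ` G d" "w \<in> G (Suc m - d)" for u w
      using WG_orth[OF _ that] d by simp
    show "card facets \<le> dim (W ` G d) + dim (G (Suc m - d))"
      using dim_G_dual[of d] d by (simp add: dim_WG)
    show "W (ev f) \<in> coords facets" by (rule W_facets[OF ev_facets])
  qed
  then obtain u w where uw: "u \<in> W ` G d" "w \<in> G (Suc m - d)" "W (ev f) = u + w" by blast
  obtain g where g: "g \<in> G d" "u = W g" using uw(1) by blast
  \<comment> \<open>\<open>w\<close> is orthogonal to itself, being a difference of two vectors
    orthogonal to \<open>G (Suc m - d)\<close>.\<close>
  have "ip w w = ip (W (ev f)) w - ip (W g) w"
    unfolding uw(3) g(2) by (simp add: lookup_add distrib_right sum.distrib)
  also have "\<dots> = 0" using perp[OF uw(2)] WG_orth[OF _ _ uw(2)] uw(1) g(2) d by simp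
  finally have "\<forall>\<sigma>\<in>facets. lookup w \<sigma> * lookup w \<sigma> = 0"
    using finite_facets by (subst (asm) sum_nonneg_eq_0_iff) auto
  moreover have "w \<in> coords facets" using uw(2) G_facets by blast
  ultimately have "w = 0"
    by (intro poly_mapping_eqI) (auto simp: coords_def in_keys_iff subset_iff)
  then have "W (ev f - g) = 0" using uw(3) g(2) by (simp add: linear_diff[OF linear_W])
  moreover have "ev f - g \<in> coords facets"
    using g(1) G_facets by (intro subspace_diff subspace_coords ev_facets) blast
  ultimately have "ev f = g" using W_inj by fastforce
  then have "f \<in> Z d" using f g(1) by (simp add: Z_def)
  then show ?thesis using Z_eq_T[OF d] by simp
qed

end

section \<open>Moments of a multi-fan\<close>

lemma squarefree_monomial:
  assumes "mdeg x = card (keys x)"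
  shows "x = set_monom (keys x)"
proof (rule poly_mapping_eqI)
  fix i
  have "(\<Sum>i\<in>keys x. 1) = (\<Sum>i\<in>keys x. lookup x i)"
    using assms by (simp add: mdeg_def)
  then have "i \<in> keys x \<Longrightarrow> 1 = lookup x i"
    by (rule sum_mono_inv) (auto simp: in_keys_iff)
  then show "lookup x i = lookup (set_monom (keys x)) i"
    by (auto simp: lookup_set_monom in_keys_iff)
qed

lemma card_keys_le_mdeg: "card (keys x) \<le> mdeg x"
proof -
  have "(\<Sum>i\<in>keys x. 1) \<le> mdeg x"
    unfolding mdeg_def by (rule sum_mono) (simp add: in_keys_iff)
  then show ?thesis by simp
qed

text \<open>A linear relation at a vertex of a repeated factor trades that factor for new vertices, so
  every monomial is reduced to squarefree ones and to monomials not supported on a face.\<close>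

lemma functional_eq_0_by_reduction:
  fixes \<kappa> :: "('a \<Rightarrow>\<^sub>0 nat) \<Rightarrow> real"
  assumes fin: "finite M"
    and nonface: "\<And>x. x \<in> mons M N \<Longrightarrow> \<not> Face (keys x) \<Longrightarrow> \<kappa> x = 0"
    and sqfree: "\<And>S. S \<subseteq> M \<Longrightarrow> card S = N \<Longrightarrow> Face S \<Longrightarrow> \<kappa> (set_monom S) = 0"
    and rel: "\<And>S i. Face S \<Longrightarrow> card S < N \<Longrightarrow> i \<in> S \<Longrightarrow> \<exists>l. l i = 1 \<and> (\<forall>s\<in>S - {i}. l s = 0) \<and>
      (\<forall>y. y \<in> mons M (N - 1) \<longrightarrow> (\<Sum>j\<in>M. l j * \<kappa> (y + single j 1)) = 0)"
    and x: "x \<in> mons M N"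
  shows "\<kappa> x = 0"
  using x
proof (induct "N - card (keys x)" arbitrary: x rule: less_induct)
  case less
  let ?S = "keys x"
  have x: "?S \<subseteq> M" "mdeg x = N" using less.prems by (auto simp: mons_def)
  show ?case
  proof (cases "Face ?S \<and> card ?S < N")
    case False
    show ?thesis
    proof (cases "Face ?S")
      case True
      then have c: "card ?S = N" using False card_keys_le_mdeg[of x] x by simp
      then have "x = set_monom ?S" using squarefree_monomial[of x] x by simp
      then show ?thesis using sqfree[OF x(1) c True] by simp
    qed (use nonface less.prems in blast)
  next
    case True
    have "\<exists>i\<in>?S. lookup x i \<noteq> 1"
    proof (rule ccontr)
      assume "\<not> ?thesis"
      then have "mdeg x = card ?S" unfolding mdeg_def by simp
      then show False using True x by simp
    qed
    then obtain i where i: "i \<in> ?S" "lookup x i \<noteq> 1" by blast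
    then have i2: "2 \<le> lookup x i" by (simp add: in_keys_iff)
    define y where "y = x - single i 1"
    have xy: "x = y + single i 1" unfolding y_def using i2
      by (intro poly_mapping_eqI) (auto simp: lookup_add lookup_minus lookup_single when_def)
    have ky: "keys y = ?S" unfolding y_def using i2
      by (auto simp: in_keys_iff lookup_minus lookup_single when_def)
    have "mdeg x = mdeg y + 1" by (subst xy) (simp add: mdeg_add)
    then have y: "y \<in> mons M (N - 1)" using ky x by (simp add: mons_def)
    obtain l where l: "l i = 1" "\<forall>s\<in>?S - {i}. l s = 0"
      "(\<Sum>j\<in>M. l j * \<kappa> (y + single j 1)) = 0"
      using rel[of ?S i] True i(1) y by blast
    have "l j * \<kappa> (y + single j 1) = 0" if j: "j \<in> M - {i}" for j
    proof (cases "j \<in> ?S")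
      case True then show ?thesis using l(2) j by simp
    next
      case False
      let ?w = "y + single j 1"
      have kw: "keys ?w = insert j ?S" using ky by (simp add: keys_add_nat)
      have "?w \<in> mons M N"
        using kw x j y True \<open>mdeg x = mdeg y + 1\<close> by (simp add: mons_def mdeg_add)
      moreover have "N - card (keys ?w) < N - card ?S"
        using kw False True by (simp add: diff_less_mono2)
      ultimately have "\<kappa> ?w = 0" by (intro less.hyps)
      then show ?thesis by simp
    qed
    then have "(\<Sum>j\<in>M - {i}. l j * \<kappa> (y + single j 1)) = 0"
      by (intro sum.neutral) blast
    moreover have "i \<in> M" using i(1) x(1) by blast
    ultimately have "(\<Sum>j\<in>M. l j * \<kappa> (y + single j 1)) = l i * \<kappa> (y + single i 1)"
      using sum.remove[OF fin, of i "\<lambda>j. l j * \<kappa> (y + single j 1)"] by linarith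
    then show ?thesis using l xy by simp
  qed
qed

section \<open>Determinants of lists of columns\<close>

definition position :: "'n::{finite,linorder} \<Rightarrow> nat" where "position s = card {t. t < s}"

lemma position_mono: "s < t \<Longrightarrow> position s < position t"
  unfolding position_def by (rule psubset_card_mono) auto

lemma position_inj: "position s = position t \<longleftrightarrow> s = t"
  by (metis linorder_neqE order_less_irrefl position_mono)

lemma position_less: "position (s::'n::{finite,linorder}) < CARD('n::{finite,linorder})"
  unfolding position_def by (rule psubset_card_mono) auto

lemma range_position: "range (position :: 'n::{finite,linorder} \<Rightarrow> nat) = {..<CARD('n::{finite,linorder})}"
proof -
  have "inj (position :: 'n \<Rightarrow> nat)" by (simp add: inj_def position_inj)
  then have "card (range (position :: 'n \<Rightarrow> nat)) = CARD('n)" by (rule card_image)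
  moreover have "range (position :: 'n \<Rightarrow> nat) \<subseteq> {..<CARD('n)}" using position_less by auto
  ultimately show ?thesis by (intro card_subset_eq) auto
qed

lemma position_surj:
  assumes "p < CARD('n::{finite,linorder})"
  obtains s :: "'n::{finite,linorder}" where "position s = p"
  using assms that unfolding lessThan_iff[symmetric] range_position[where 'n='n, symmetric] by blast

definition listdet :: "(real ^ 'n::{finite,linorder}) list \<Rightarrow> real" where
  "listdet vs = det (\<chi> r s. (vs ! position s) $ r)"

lemma listdet_swap:
  fixes xs ys :: "(real ^ 'n::{finite,linorder}) list"
  assumes len: "length xs + length ys + 2 = CARD('n)"
  shows "listdet (xs @ a # b # ys) = - listdet (xs @ b # a # ys)"
proof -
  obtain s1 :: 'n where s1: "position s1 = length xs"
    using position_surj[where 'n='n, of "length xs"] len by auto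
  obtain s2 :: 'n where s2: "position s2 = Suc (length xs)"
    using position_surj[where 'n='n, of "Suc (length xs)"] len by auto
  let ?p = "Transposition.transpose s1 s2"
  have ne: "s1 \<noteq> s2" using s1 s2 by auto
  let ?A = "\<chi> s::'n. (xs @ b # a # ys) ! position s"
  have row: "listdet vs = det (\<chi> s. vs ! position s)" for vs :: "(real ^ 'n::{finite,linorder}) list"
    unfolding listdet_def
    by (subst det_transpose[symmetric]) (simp add: Finite_Cartesian_Product.transpose_def)
  have "(xs @ a # b # ys) ! position s = (xs @ b # a # ys) ! position (?p s)" for s
  proof -
    consider "s = s1" | "s = s2" | "s \<noteq> s1" "s \<noteq> s2" by blast
    then show ?thesis
    proof cases
      case 1 then show ?thesis using s1 s2 by (simp add: nth_append)
    next
      case 2 then show ?thesis using s1 s2 by (simp add: nth_append)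
    next
      case 3
      then have "position s \<noteq> length xs" "position s \<noteq> Suc (length xs)"
        using s1 s2 position_inj by metis+
      then have "(xs @ a # b # ys) ! position s = (xs @ b # a # ys) ! position s"
        by (auto simp: nth_append nth_Cons split: nat.splits)
      then show ?thesis using 3 by simp
    qed
  qed
  then have "listdet (xs @ a # b # ys) = det (\<chi> s. ?A $ ?p s)" unfolding row by simp
  also have "\<dots> = of_int (sign ?p) * det ?A"
    by (rule det_permute_rows) (simp add: permutes_swap_id)
  also have "\<dots> = - det ?A" using ne by (simp add: sign_swap_id)
  finally show ?thesis unfolding row .
qed

lemma listdet_move:
  fixes xs ys :: "(real ^ 'n::{finite,linorder}) list"
  assumes "length xs + length ys + 1 = CARD('n)"
  shows "listdet (xs @ v # ys) = (-1) ^ length xs * listdet (v # xs @ ys)"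
  using assms
proof (induct xs arbitrary: ys rule: rev_induct)
  case (snoc a xs)
  have "listdet ((xs @ [a]) @ v # ys) = listdet (xs @ a # v # ys)" by simp
  also have "\<dots> = - listdet (xs @ v # a # ys)" using snoc.prems by (intro listdet_swap) simp
  also have "\<dots> = - ((-1) ^ length xs * listdet (v # xs @ a # ys))"
    using snoc.prems by (subst snoc.hyps) simp_all
  finally show ?case by simp
qed simp

lemma sorted_list_split:
  fixes I :: "'a::linorder set"
  assumes I: "finite I" "i \<in> I"
  obtains xs ys where "sorted_list_of_set I = xs @ i # ys" "sorted_list_of_set (I - {i}) = xs @ ys"
    "length xs = card {j \<in> I. j < i}"
proof -
  have "i \<in> set (sorted_list_of_set I)" using I by simp
  then obtain xs ys where s: "sorted_list_of_set I = xs @ i # ys" by (metis split_list)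
  have d: "distinct (xs @ i # ys)" and so: "sorted (xs @ i # ys)" and se: "set (xs @ i # ys) = I"
    using s I by (metis distinct_sorted_list_of_set, metis sorted_sorted_list_of_set, metis set_sorted_list_of_set)
  have "sorted_list_of_set (I - {i}) = remove1 i (xs @ i # ys)"
    using sorted_list_of_set_remove[OF I(1), of i] s by simp
  also have "\<dots> = xs @ ys" using d by (simp add: remove1_append)
  finally have 1: "sorted_list_of_set (I - {i}) = xs @ ys" .
  have "{j \<in> I. j < i} = set xs"
  proof (rule Set.set_eqI)
    fix j show "j \<in> {j \<in> I. j < i} \<longleftrightarrow> j \<in> set xs"
      using se so d by (fastforce simp: sorted_append)
  qed
  then have "length xs = card {j \<in> I. j < i}" using d distinct_card[of xs] by simp
  then show ?thesis using that s 1 by blast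
qed

lemma dual_vector:
  fixes lam :: "'a \<Rightarrow> real ^ 'n"
  assumes "inj_on lam \<tau>" "independent (lam ` \<tau>)" "i \<in> \<tau>"
  obtains \<xi> where "\<And>j. j \<in> \<tau> \<Longrightarrow> \<xi> \<bullet> lam j = (if j = i then 1 else 0)"
proof -
  obtain f where f: "linear f" "\<And>b. b \<in> lam ` \<tau> \<Longrightarrow> f b = (if b = lam i then 1::real else 0)"
    using linear_independent_extend[OF assms(2), of "\<lambda>b. if b = lam i then 1::real else 0"] by blast
  have "f x = (adjoint f 1) \<bullet> x" for x
    using adjoint_works[OF f(1), of x 1] by (simp add: inner_commute)
  then have "adjoint f 1 \<bullet> lam j = (if j = i then 1 else 0)" if "j \<in> \<tau>" for j
    using f(2)[of "lam j"] that assms(1,3) by (auto simp: inj_on_def)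
  then show ?thesis using that by blast
qed

section \<open>The moment functional of a multi-fan\<close>

locale multifan =
  fixes M :: "'a::linorder set" and \<omega> :: "'a set \<Rightarrow>\<^sub>0 real"
    and lam :: "'a \<Rightarrow> real ^ 'n::{finite,linorder}"
  assumes finM: "finite M" and cyc: "simplicial_cycle M CARD('n) \<omega>"
    and char: "characteristic_function \<omega> lam"
begin

lemma support_facet: assumes "I \<in> keys \<omega>"
  shows "I \<subseteq> M" "card I = CARD('n)" "finite I" "inj_on lam I" "independent (lam ` I)" "span (lam ` I) = UNIV"
proof -
  show 1: "I \<subseteq> M" "card I = CARD('n)" using assms cyc by (auto simp: simplicial_cycle_def supported_in_def)
  show "finite I" using finM 1 by (auto intro: finite_subset)
  show "inj_on lam I" "independent (lam ` I)" "span (lam ` I) = UNIV"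
    using assms char by (auto simp: characteristic_function_def)
qed

lemma coord_expansion:
  assumes "I \<in> keys \<omega>"
  shows "(\<Sum>i\<in>I. coord lam v I i *\<^sub>R lam i) = v"
proof -
  have "(\<Sum>b\<in>lam ` I. representation (lam ` I) v b *\<^sub>R b) = v"
    using support_facet[OF assms] by (intro sum_representation_eq) auto
  then show ?thesis using support_facet(4)[OF assms] by (simp add: sum.reindex coord_def)
qed

lemma dual_basis:
  assumes "I \<in> keys \<omega>" "i \<in> I"
  obtains \<xi> where "\<And>j. j \<in> I \<Longrightarrow> \<xi> \<bullet> lam j = (if j = i then 1 else 0)"
  using dual_vector[OF support_facet(4,5)[OF assms(1)] assms(2)] by blast

text \<open>The coordinates of \<open>v\<close> are extended by 0 outside \<open>I\<close>, so that
  a monomial whose support is not contained in \<open>I\<close> vanishes at this point.\<close>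

definition pt :: "real ^ 'n::{finite,linorder} \<Rightarrow> 'a set \<Rightarrow> 'a \<Rightarrow> real" where
  "pt v I i = (if i \<in> I then coord lam v I i else 0)"

definition wt :: "real ^ 'n::{finite,linorder} \<Rightarrow> 'a set \<Rightarrow> real" where
  "wt v I = lookup \<omega> I / (char_det lam I * (\<Prod>i\<in>I. coord lam v I i))"

definition moment :: "real ^ 'n::{finite,linorder} \<Rightarrow> ('a \<Rightarrow>\<^sub>0 nat) \<Rightarrow> real" where
  "moment v x = (\<Sum>I\<in>keys \<omega>. wt v I * monom_at x (pt v I))"

lemma pt_inner:
  assumes "I \<in> keys \<omega>"
  shows "(\<Sum>i\<in>I. (\<xi> \<bullet> lam i) * pt v I i) = \<xi> \<bullet> v"
proof -
  have "(\<Sum>i\<in>I. (\<xi> \<bullet> lam i) * pt v I i) = \<xi> \<bullet> (\<Sum>i\<in>I. coord lam v I i *\<^sub>R lam i)"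
    by (simp add: inner_sum_right pt_def mult.commute cong: sum.cong)
  then show ?thesis by (simp add: coord_expansion[OF assms])
qed

text \<open>All points satisfy the same inhomogeneous equation \<open>pt_inner\<close>: the form
  with coefficients \<open>\<xi> \<bullet> lam j\<close> has the value
  \<open>\<xi> \<bullet> v\<close> at each of them.\<close>

lemma moment_theta:
  "(\<Sum>j\<in>M. (\<xi> \<bullet> lam j) * moment v (y + single j 1)) = (\<xi> \<bullet> v) * moment v y"
proof -
  have "(\<Sum>j\<in>M. (\<xi> \<bullet> lam j) * moment v (y + single j 1)) =
      (\<Sum>j\<in>M. \<Sum>I\<in>keys \<omega>. wt v I * monom_at y (pt v I) * ((\<xi> \<bullet> lam j) * pt v I j))"
    by (simp add: moment_def monom_at_add sum_distrib_left mult_ac)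
  also have "\<dots> = (\<Sum>I\<in>keys \<omega>. wt v I * monom_at y (pt v I) * (\<Sum>j\<in>M. (\<xi> \<bullet> lam j) * pt v I j))"
    by (subst sum.swap) (simp add: sum_distrib_left)
  also have "\<dots> = (\<Sum>I\<in>keys \<omega>. wt v I * monom_at y (pt v I) * (\<xi> \<bullet> v))"
  proof (rule sum.cong[OF refl])
    fix I assume I: "I \<in> keys \<omega>"
    have "(\<Sum>j\<in>M. (\<xi> \<bullet> lam j) * pt v I j) = (\<Sum>j\<in>I. (\<xi> \<bullet> lam j) * pt v I j)"
      using finM support_facet(1)[OF I] by (intro sum.mono_neutral_right) (auto simp: pt_def)
    then show "wt v I * monom_at y (pt v I) * (\<Sum>j\<in>M. (\<xi> \<bullet> lam j) * pt v I j) =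
        wt v I * monom_at y (pt v I) * (\<xi> \<bullet> v)" by (simp add: pt_inner[OF I])
  qed
  also have "\<dots> = (\<xi> \<bullet> v) * moment v y"
    by (simp add: moment_def sum_distrib_left mult_ac)
  finally show ?thesis .
qed

definition face :: "'a set \<Rightarrow> bool" where "face S \<longleftrightarrow> (\<exists>I\<in>keys \<omega>. S \<subseteq> I)"

lemma monom_at_nonface: "\<not> keys x \<subseteq> I \<Longrightarrow> monom_at x (pt v I) = 0"
  by (auto simp: pt_def intro: monom_at_zero)

lemma moment_nonface: "\<not> face (keys x) \<Longrightarrow> moment v x = 0"
  by (auto simp: moment_def face_def monom_at_nonface intro!: sum.neutral)

text \<open>The right side depends on \<open>I\<close> only through the ridge \<open>I - {i}\<close>
  and a sign, and that sign is the one in the boundary operator. This makes the weights of the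
  facets around a ridge comparable.\<close>

lemma cramer:
  assumes I: "I \<in> keys \<omega>" "i \<in> I"
  shows "char_det lam I * coord lam v I i =
    vertex_sign I i * listdet (v # map lam (sorted_list_of_set (I - {i})))"
proof -
  obtain xs ys where s: "sorted_list_of_set I = xs @ i # ys" "sorted_list_of_set (I - {i}) = xs @ ys"
    "length xs = card {j \<in> I. j < i}" by (rule sorted_list_split[OF support_facet(3)[OF I(1)] I(2)])
  let ?L = "sorted_list_of_set I"
  have len: "length ?L = CARD('n)" using support_facet[OF I(1)] by simp
  then have len': "length xs + length ys + 1 = CARD('n)" using s by simp
  obtain k :: 'n where k: "position k = length xs"
    using position_surj[where 'n='n, of "length xs"] len' by auto
  define A where "A = (\<chi> r s. lam (?L ! position (s::'n)) $ r)"
  define x where "x = (\<chi> s. coord lam v I (?L ! position (s::'n)))"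
  have bij: "bij_betw (\<lambda>s::'n. ?L ! position s) UNIV I"
  proof -
    have "bij_betw (position :: 'n \<Rightarrow> nat) UNIV {..<CARD('n)}"
      unfolding bij_betw_def
    proof
      show "inj (position :: 'n \<Rightarrow> nat)" by (simp add: inj_def position_inj)
      show "range (position :: 'n \<Rightarrow> nat) = {..<CARD('n)}"
        by (rule range_position)
    qed
    moreover have "bij_betw ((!) ?L) {..<CARD('n)} I"
      using bij_betw_nth[of ?L "{..<CARD('n)}" I] len support_facet[OF I(1)] by simp
    ultimately have "bij_betw ((!) ?L \<circ> position) (UNIV :: 'n set) I" by (rule bij_betw_trans)
    then show ?thesis by (simp only: o_def)
  qed
  have "A *v x = (\<Sum>s\<in>UNIV. coord lam v I (?L ! position (s::'n)) *\<^sub>R lam (?L ! position s))"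
    by (simp add: vec_eq_iff matrix_vector_mult_def A_def x_def mult.commute)
  also have "\<dots> = (\<Sum>i\<in>I. coord lam v I i *\<^sub>R lam i)"
    by (rule sum.reindex_bij_betw[OF bij])
  also have "\<dots> = v" by (rule coord_expansion[OF I(1)])
  finally have Ax: "A *v x = v" .
  have "listdet (map lam xs @ v # map lam ys) = det (\<chi> r s. if s = k then (A *v x) $ r else A $ r $ s)"
    unfolding listdet_def
  proof (rule arg_cong[where f = det], simp only: vec_eq_iff vec_lambda_beta, intro allI)
    fix r s
    show "(map lam xs @ v # map lam ys) ! position s $ r = (if s = k then (A *v x) $ r else A $ r $ s)"
    proof (cases "s = k")
      case True then show ?thesis using k by (simp add: Ax nth_append)
    next
      case False
      then have "position s \<noteq> length xs" using k position_inj by metis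
      then have "(map lam xs @ v # map lam ys) ! position s = map lam ?L ! position s"
        by (simp add: s nth_append nth_Cons split: nat.splits)
      then show ?thesis using False position_less[of s] len by (simp add: A_def)
    qed
  qed
  also have "\<dots> = x $ k * det A" by (rule cramer_lemma)
  also have "\<dots> = coord lam v I i * char_det lam I"
    using k by (simp add: x_def A_def char_det_def position_def s nth_append)
  finally have "listdet (map lam xs @ v # map lam ys) = coord lam v I i * char_det lam I" .
  moreover have "listdet (map lam xs @ v # map lam ys) = (-1) ^ length xs * listdet (v # map lam xs @ map lam ys)"
    using listdet_move[of "map lam xs" "map lam ys" v] len' by simp
  ultimately show ?thesis using s by (simp add: vertex_sign_def mult.commute)
qed

lemma lookup_boundary:
  "lookup (boundary \<omega>) S =
    (\<Sum>I\<in>keys \<omega>. \<Sum>i\<in>I. if I - {i} = S then vertex_sign I i * lookup \<omega> I else 0)"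
  unfolding boundary_def by (simp add: lookup_sum lookup_single_one)

context
  fixes v assumes gen: "generic \<omega> lam v"
begin

lemma coord_nz: "I \<in> keys \<omega> \<Longrightarrow> i \<in> I \<Longrightarrow> coord lam v I i \<noteq> 0"
  using gen by (auto simp: generic_def)

text \<open>Here the cycle condition enters: by Cramer's rule the sum is a multiple of a boundary coefficient.\<close>

lemma moment_ridge:
  assumes "S \<subseteq> M" "Suc (card S) = CARD('n)"
  shows "moment v (set_monom S) = 0"
proof -
  define \<delta> where "\<delta> = listdet (v # map lam (sorted_list_of_set S))"
  have fS: "finite S" using assms(1) finM by (rule finite_subset)
  have "moment v (set_monom S) = (\<Sum>I\<in>keys \<omega>.
      (\<Sum>i\<in>I. if I - {i} = S then vertex_sign I i * lookup \<omega> I else 0) / \<delta>)"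
    unfolding moment_def
  proof (rule sum.cong[OF refl])
    fix I assume I: "I \<in> keys \<omega>"
    show "wt v I * monom_at (set_monom S) (pt v I) =
        (\<Sum>i\<in>I. if I - {i} = S then vertex_sign I i * lookup \<omega> I else 0) / \<delta>"
    proof (cases "S \<subseteq> I")
      case False
      then have "\<And>i. I - {i} \<noteq> S" by auto
      then show ?thesis using monom_at_nonface[of "set_monom S"] False fS by (simp add: keys_set_monom)
    next
      case True
      have "card (I - S) = 1" using True support_facet[OF I] assms(2) by (simp add: card_Diff_subset finite_subset)
      then obtain i where "I - S = {i}" by (auto simp: card_1_singleton_iff)
      then have i: "i \<in> I" "i \<notin> S" "I = insert i S" "I - {i} = S" using True by auto
      have uniq: "(I - {j} = S) = (j = i)" if "j \<in> I" for j using i that by auto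
      have "(\<Sum>j\<in>I. if I - {j} = S then vertex_sign I j * lookup \<omega> I else 0) =
          (\<Sum>j\<in>I. if j = i then vertex_sign I j * lookup \<omega> I else 0)"
        using uniq by (intro sum.cong) auto
      also have "\<dots> = vertex_sign I i * lookup \<omega> I" using i(1) support_facet(3)[OF I] by simp
      finally have 1: "(\<Sum>j\<in>I. if I - {j} = S then vertex_sign I j * lookup \<omega> I else 0) =
          vertex_sign I i * lookup \<omega> I" .
      have mon: "monom_at (set_monom S) (pt v I) = (\<Prod>j\<in>S. coord lam v I j)"
        unfolding monom_at_set_monom[OF fS] by (intro prod.cong refl) (use True in \<open>auto simp: pt_def\<close>)
      have pr: "(\<Prod>j\<in>I. coord lam v I j) = coord lam v I i * (\<Prod>j\<in>S. coord lam v I j)"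
        using prod.remove[OF support_facet(3)[OF I] i(1), of "coord lam v I"] i(4) by simp
      have "(\<Prod>j\<in>S. coord lam v I j) \<noteq> 0" using fS True coord_nz[OF I] by auto
      then have "wt v I * monom_at (set_monom S) (pt v I) = lookup \<omega> I / (char_det lam I * coord lam v I i)"
        unfolding wt_def mon pr by (simp add: field_simps)
      also have "char_det lam I * coord lam v I i = vertex_sign I i * \<delta>"
        using cramer[OF I i(1), of v] i(4) by (simp add: \<delta>_def)
      also have "lookup \<omega> I / (vertex_sign I i * \<delta>) = vertex_sign I i * lookup \<omega> I / \<delta>"
        by (cases "even (card {j \<in> I. j < i})") (simp_all add: vertex_sign_def)
      finally show ?thesis unfolding 1 .
    qed
  qed
  also have "\<dots> = lookup (boundary \<omega>) S / \<delta>"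
    unfolding lookup_boundary by (simp add: sum_divide_distrib)
  also have "\<dots> = 0" using cyc by (simp add: simplicial_cycle_def)
  finally show ?thesis .
qed

text \<open>Reduction to ridges by relations that vanish at \<open>v\<close>. Homogeneous relations
  are taken because the moments one degree lower are not yet known to vanish; they exist because the
  surrounding facet has a vertex outside the face.\<close>

lemma moment_low_top: "x \<in> mons M (CARD('n) - 1) \<Longrightarrow> moment v x = 0"
proof (erule functional_eq_0_by_reduction[OF finM, where Face = face, rotated 3])
  fix S assume "S \<subseteq> M" "card S = CARD('n) - 1"
  then show "moment v (set_monom S) = 0" by (intro moment_ridge) (simp_all add: Suc_diff_le)
next
  fix S i assume "face S" and c: "card S < CARD('n) - 1" and i: "i \<in> S"
  then obtain I where I: "I \<in> keys \<omega>" "S \<subseteq> I" by (auto simp: face_def)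
  have "S \<noteq> I" using c support_facet(2)[OF I(1)] by auto
  then obtain j where j: "j \<in> I" "j \<notin> S" using I by blast
  have iI: "i \<in> I" using I i by blast
  obtain \<xi> where \<xi>: "\<And>l. l \<in> I \<Longrightarrow> \<xi> \<bullet> lam l = (if l = i then 1 else 0)" by (rule dual_basis[OF I(1) iI]) blast
  obtain \<eta> where \<eta>: "\<And>l. l \<in> I \<Longrightarrow> \<eta> \<bullet> lam l = (if l = j then 1 else 0)" by (rule dual_basis[OF I(1) j(1)]) blast
  have dual: "\<zeta> \<bullet> v = coord lam v I l" if "l \<in> I" "\<And>s. s \<in> I \<Longrightarrow> \<zeta> \<bullet> lam s = (if s = l then 1 else 0)" for \<zeta> l
  proof -
    have "\<zeta> \<bullet> v = (\<Sum>s\<in>I. if s = l then pt v I s else 0)"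
      unfolding pt_inner[OF I(1), where \<xi> = \<zeta> and v = v, symmetric]
      by (intro sum.cong refl) (simp add: that(2))
    then show ?thesis using that(1) support_facet(3)[OF I(1)] by (simp add: pt_def)
  qed
  \<comment> \<open>Chosen so that the combined functional vanishes at \<open>v\<close>; genericity
    of \<open>v\<close> makes the division meaningful. As \<open>j\<close> lies outside
    \<open>S\<close>, the values on \<open>S\<close> are those of \<open>\<xi>\<close>.\<close>
  define a where "a = coord lam v I i / coord lam v I j"
  let ?\<zeta> = "\<xi> - a *\<^sub>R \<eta>"
  have "?\<zeta> \<bullet> v = 0"
    using dual[OF iI \<xi>] dual[OF j(1) \<eta>] coord_nz[OF I(1) j(1)] by (simp add: inner_diff_left a_def)
  moreover have "?\<zeta> \<bullet> lam i = 1" using \<xi>[OF iI] \<eta>[OF iI] i j by (auto simp: inner_diff_left)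
  moreover have "?\<zeta> \<bullet> lam s = 0" if "s \<in> S - {i}" for s
    using \<xi>[of s] \<eta>[of s] that I j by (auto simp: inner_diff_left)
  ultimately show "\<exists>l. l i = 1 \<and> (\<forall>s\<in>S - {i}. l s = 0) \<and>
      (\<forall>y. y \<in> mons M (CARD('n) - 1 - 1) \<longrightarrow> (\<Sum>j\<in>M. l j * moment v (y + single j 1)) = 0)"
    by (intro exI[of _ "\<lambda>j. ?\<zeta> \<bullet> lam j"]) (auto simp only: moment_theta)
qed (rule moment_nonface)

lemma v_nonzero: "keys \<omega> \<noteq> {} \<Longrightarrow> v \<noteq> 0"
proof
  assume "keys \<omega> \<noteq> {}" "v = 0"
  then obtain I where I: "I \<in> keys \<omega>" by blast
  have "card I \<noteq> 0" using support_facet(2)[OF I] by simp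
  then obtain i where "i \<in> I" by fastforce
  then show False using coord_nz[OF I] \<open>v = 0\<close> by (simp add: coord_def representation_zero)
qed

text \<open>Downward induction on the degree: a functional with value 1 at \<open>v\<close>
  expresses a moment through moments of one degree more.\<close>

lemma moment_low:
  assumes "d < CARD('n)" "x \<in> mons M d"
  shows "moment v x = 0"
  using assms
proof (induct "CARD('n) - 1 - d" arbitrary: d x)
  case 0
  then have "d = CARD('n) - 1" by linarith
  then show ?case using moment_low_top 0 by blast
next
  case (Suc q)
  show ?case
  proof (cases "keys \<omega> = {}")
    case True then show ?thesis unfolding moment_def by (simp only: sum.empty)
  next
    case False
    let ?\<xi> = "(1 / (v \<bullet> v)) *\<^sub>R v"
    have "?\<xi> \<bullet> v = 1" using v_nonzero[OF False] by simp
    then have "moment v x = (\<Sum>j\<in>M. (?\<xi> \<bullet> lam j) * moment v (x + single j 1))"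
      unfolding moment_theta by simp
    also have "\<dots> = 0"
    proof (rule sum.neutral, rule ballI)
      fix j assume "j \<in> M"
      then have "x + single j 1 \<in> mons M (Suc d)"
        using Suc.prems by (auto simp: mons_def keys_add_nat mdeg_add)
      then have "moment v (x + single j 1) = 0"
        using Suc.hyps(1)[of "Suc d"] Suc.hyps(2) Suc.prems(1) by simp
      then show "?\<xi> \<bullet> lam j * moment v (x + single j 1) = 0" by simp
    qed
    finally show ?thesis .
  qed
qed

text \<open>Only the point of \<open>I\<close> itself sees this monomial, and its coordinates cancel
  the product in the weight; with them the dependence on \<open>v\<close> disappears.\<close>

lemma moment_facet:
  assumes "I \<in> keys \<omega>"
  shows "moment v (set_monom I) = lookup \<omega> I / char_det lam I"
proof -
  note I = support_facet[OF assms]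
  have "moment v (set_monom I) = (\<Sum>J\<in>keys \<omega>. if J = I then lookup \<omega> I / char_det lam I else 0)"
    unfolding moment_def
  proof (rule sum.cong[OF refl])
    fix J assume J: "J \<in> keys \<omega>"
    show "wt v J * monom_at (set_monom I) (pt v J) = (if J = I then lookup \<omega> I / char_det lam I else 0)"
    proof (cases "J = I")
      case True
      have "monom_at (set_monom I) (pt v I) = (\<Prod>j\<in>I. coord lam v I j)"
        unfolding monom_at_set_monom[OF I(3)] by (intro prod.cong refl) (simp add: pt_def)
      moreover have "(\<Prod>j\<in>I. coord lam v I j) \<noteq> 0" using coord_nz[OF assms] I(3) by simp
      ultimately show ?thesis using True by (simp add: wt_def)
    next
      case False
      then have "\<not> I \<subseteq> J" using card_subset_eq[OF support_facet(3)[OF J], of I] support_facet(2)[OF J] I(2) by auto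
      then show ?thesis using False monom_at_nonface[of "set_monom I"] I(3) by (simp add: keys_set_monom)
    qed
  qed
  then show ?thesis using assms by simp
qed

end

text \<open>The difference of the two functionals satisfies all linear relations, because the
  moments one degree lower vanish for both; on the squarefree monomials of facets both values are
  the same by \<open>moment_facet\<close>.\<close>

lemma moment_independent:
  assumes "generic \<omega> lam v" "generic \<omega> lam v'" "x \<in> mons M CARD('n)"
  shows "moment v x = moment v' x"
proof -
  have "moment v x - moment v' x = 0"
    using assms(3)
  proof (rule functional_eq_0_by_reduction[OF finM, where Face = face, rotated 3])
    fix x :: "'a \<Rightarrow>\<^sub>0 nat" assume "\<not> face (keys x)"
    then show "moment v x - moment v' x = 0" by (simp add: moment_nonface)
  next
    fix S assume "card S = CARD('n)" "face S"
    then obtain I where I: "I \<in> keys \<omega>" "S \<subseteq> I" by (auto simp: face_def)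
    then have "S = I" using card_subset_eq[OF support_facet(3)[OF I(1)], of S] support_facet(2)[OF I(1)] \<open>card S = CARD('n)\<close> by simp
    then show "moment v (set_monom S) - moment v' (set_monom S) = 0"
      using moment_facet[OF assms(1) I(1)] moment_facet[OF assms(2) I(1)] by simp
  next
    fix S i assume "face S" "i \<in> S"
    then obtain I where I: "I \<in> keys \<omega>" "S \<subseteq> I" by (auto simp: face_def)
    then have iI: "i \<in> I" using \<open>i \<in> S\<close> by blast
    obtain \<xi> where \<xi>: "\<And>l. l \<in> I \<Longrightarrow> \<xi> \<bullet> lam l = (if l = i then 1 else 0)" by (rule dual_basis[OF I(1) iI]) blast
    have "(\<Sum>j\<in>M. (\<xi> \<bullet> lam j) * (moment v (y + single j 1) - moment v' (y + single j 1))) = 0"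
      if "y \<in> mons M (CARD('n) - 1)" for y
      using that moment_low_top[OF assms(1)] moment_low_top[OF assms(2)]
      by (simp only: right_diff_distrib sum_subtractf moment_theta)
    moreover have "\<xi> \<bullet> lam i = 1" "\<And>s. s \<in> S - {i} \<Longrightarrow> \<xi> \<bullet> lam s = 0" using \<xi> iI I by auto
    ultimately show "\<exists>l. l i = 1 \<and> (\<forall>s\<in>S - {i}. l s = 0) \<and>
      (\<forall>y. y \<in> mons M (CARD('n) - 1) \<longrightarrow> (\<Sum>j\<in>M. l j * (moment v (y + single j 1) - moment v' (y + single j 1))) = 0)"
      by (intro exI[of _ "\<lambda>j. \<xi> \<bullet> lam j"]) blast
  qed
  then show ?thesis by simp
qed

end

section \<open>Differential operators on coefficients\<close>

definition mfact :: "('a \<Rightarrow>\<^sub>0 nat) \<Rightarrow> real" where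
  "mfact x = (\<Prod>i\<in>keys x. fact (lookup x i))"

lemma mfact_nz [simp]: "mfact x \<noteq> 0" by (simp add: mfact_def)

lemma mfact_superset:
  "finite A \<Longrightarrow> keys x \<subseteq> A \<Longrightarrow> mfact x = (\<Prod>i\<in>A. fact (lookup x i))"
  unfolding mfact_def by (rule prod.mono_neutral_left) (auto simp: in_keys_iff)

lemma mfact_add_var: "mfact (x + evar i) = real (Suc (lookup x i)) * mfact x"
proof -
  let ?A = "insert i (keys x)"
  let ?f = "\<lambda>y j. fact (lookup y j) :: real"
  have split: "mfact y = ?f y i * (\<Prod>j\<in>?A - {i}. ?f y j)" if "keys y \<subseteq> ?A" for y
    using mfact_superset[of ?A y] that prod.remove[of ?A i "?f y"] by simp
  have 1: "(\<Prod>j\<in>?A - {i}. ?f (x + evar i) j) = (\<Prod>j\<in>?A - {i}. ?f x j)"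
    by (intro prod.cong refl) (auto simp: lookup_add lookup_single when_def)
  have 2: "?f (x + evar i) i = real (Suc (lookup x i)) * ?f x i" by (simp add: lookup_add)
  have "mfact (x + evar i) = ?f (x + evar i) i * (\<Prod>j\<in>?A - {i}. ?f (x + evar i) j)"
    by (rule split) (simp add: keys_add_nat)
  also have "\<dots> = real (Suc (lookup x i)) * (?f x i * (\<Prod>j\<in>?A - {i}. ?f x j))"
    unfolding 1 2 by (rule mult.assoc)
  also have "?f x i * (\<Prod>j\<in>?A - {i}. ?f x j) = mfact x"
    by (rule split[symmetric]) auto
  finally show ?thesis .
qed

text \<open>In the divided-power basis a partial derivative is a shift of coefficients.\<close>

definition gcoeff :: "'a rpoly \<Rightarrow> ('a \<Rightarrow>\<^sub>0 nat) \<Rightarrow> real" where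
  "gcoeff P x = mfact x * lookup P x"

lemma gcoeff_eqI: "(\<And>x. gcoeff P x = gcoeff Q x) \<Longrightarrow> P = Q"
  by (rule poly_mapping_eqI) (metis gcoeff_def mfact_nz mult_left_cancel)

lemma gcoeff_0 [simp]: "gcoeff 0 x = 0" by (simp add: gcoeff_def)

lemma gcoeff_scaleR: "gcoeff (c *\<^sub>R P) x = c * gcoeff P x" by (simp add: gcoeff_def)

lemma gcoeff_sum: "gcoeff (\<Sum>a\<in>A. f a) x = (\<Sum>a\<in>A. gcoeff (f a) x)"
  by (simp add: gcoeff_def lookup_sum sum_distrib_left)

lemma gcoeff_partial: "gcoeff (partial i P) x = gcoeff P (x + evar i)"
proof -
  have "lookup (partial i P) x = (\<Sum>y\<in>keys P.
      if y = x + evar i then real (Suc (lookup x i)) * lookup P y else 0)"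
    unfolding partial_def lookup_sum
  proof (rule sum.cong[OF refl])
    fix y
    show "lookup (single (y - evar i)
        (real (lookup y i) * lookup P y)) x =
      (if y = x + evar i then real (Suc (lookup x i)) * lookup P y else 0)"
    proof (cases "lookup y i = 0")
      case True
      then have "y \<noteq> x + evar i" by (auto simp: lookup_add)
      then show ?thesis using True by (simp add: lookup_single_one)
    next
      case False
      have "y = (y - evar i) + evar i" using False
        by (intro poly_mapping_eqI) (auto simp: lookup_add lookup_minus lookup_single when_def)
      then have "(y - evar i = x) = (y = x + evar i)" by auto
      then show ?thesis by (auto simp: lookup_single_one lookup_add)
    qed
  qed
  also have "\<dots> = real (Suc (lookup x i)) * lookup P (x + evar i)"
    by (auto simp: in_keys_iff)
  finally show ?thesis unfolding gcoeff_def mfact_add_var by simp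
qed

lemma gcoeff_partial_pow: "gcoeff ((partial i ^^ e) P) x = gcoeff P (x + single i e)"
proof (induct e arbitrary: x)
  case (Suc e)
  have "x + evar i + single i e = x + single i (Suc e)"
    by (simp add: add.assoc flip: single_add)
  then show ?case using Suc by (simp add: gcoeff_partial)
qed simp

lemma gcoeff_partial_monom: "gcoeff (partial_monom y P) x = gcoeff P (x + y)"
proof -
  have "gcoeff (foldr (\<lambda>i. partial i ^^ lookup y i) is P) x =
      gcoeff P (x + (\<Sum>i\<in>set is. single i (lookup y i)))" if "distinct is" for "is" x
    using that by (induct "is" arbitrary: x) (simp_all add: gcoeff_partial_pow add.assoc)
  then have "gcoeff (partial_monom y P) x =
      gcoeff P (x + (\<Sum>i\<in>keys y. single i (lookup y i)))"
    by (simp add: partial_monom_def)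
  moreover have "(\<Sum>i\<in>keys y. single i (lookup y i)) = y"
    by (rule poly_mapping_eqI) (auto simp: lookup_sum lookup_single when_def in_keys_iff)
  ultimately show ?thesis by simp
qed

lemma apply_op_lin_ext: "(\<lambda>D. apply_op D P) = lin_ext (\<lambda>y. partial_monom y P)"
  by (rule ext) (simp add: apply_op_def lin_ext_def)

lemma linear_apply_op: "linear (\<lambda>D. apply_op D P)"
  unfolding apply_op_lin_ext by (rule linear_lin_ext)

lemma gcoeff_apply_op: "gcoeff (apply_op D P) x = lin_ext (\<lambda>y. gcoeff P (x + y)) D"
  by (simp add: apply_op_def lin_ext_def gcoeff_sum gcoeff_scaleR gcoeff_partial_monom)

lemma single_sum: "f = (\<Sum>a\<in>keys f. single a (lookup f a))"
  for f :: "'b \<Rightarrow>\<^sub>0 real"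
  by (rule poly_mapping_eqI) (auto simp: lookup_sum lookup_single_one in_keys_iff)

lemma scaleR_conv_mult: "c *\<^sub>R (f :: 'a rpoly) = Const c * f"
proof -
  have "Const c * f = (\<Sum>a\<in>keys f. Const c * single a (lookup f a))"
    by (subst (1) single_sum[of f]) (rule sum_distrib_left)
  also have "\<dots> = (\<Sum>a\<in>keys f. c *\<^sub>R single a (lookup f a))"
    by (simp add: Const_def mult_single)
  also have "\<dots> = c *\<^sub>R f"
    unfolding scaleR_sum_right[symmetric] by (subst (2) single_sum[of f]) simp
  finally show ?thesis by simp
qed

lemma gcoeff_Var_mult: "gcoeff (Var i * P) x = real (lookup x i) * gcoeff P (x - evar i)"
proof -
  have "Var i * P = (\<Sum>y\<in>keys P. Var i * single y (lookup P y))"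
    by (subst (1) single_sum[of P]) (rule sum_distrib_left)
  also have "\<dots> = (\<Sum>y\<in>keys P. single (evar i + y) (lookup P y))"
    by (simp add: Var_def mult_single)
  finally have eq: "lookup (Var i * P) x =
      (\<Sum>y\<in>keys P. if evar i + y = x then lookup P y else 0)"
    by (simp add: lookup_sum lookup_single_one)
  show ?thesis
  proof (cases "lookup x i = 0")
    case True
    then have "evar i + y \<noteq> x" for y by (auto simp: lookup_add)
    then show ?thesis using True by (simp add: gcoeff_def eq)
  next
    case False
    define w where "w = x - evar i"
    have x: "x = w + evar i" unfolding w_def using False
      by (intro poly_mapping_eqI) (auto simp: lookup_add lookup_minus lookup_single when_def)
    have "(evar i + y = x) = (y = w)" for y unfolding x by (metis add.commute add_left_cancel)
    then have "lookup (Var i * P) x = lookup P w"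
      unfolding eq by (auto simp: in_keys_iff)
    then show ?thesis unfolding x gcoeff_def mfact_add_var by (simp add: lookup_add)
  qed
qed

text \<open>The multinomial theorem in divided powers. The factor \<open>fact N\<close> will cancel
  the normalisation of the volume polynomial.\<close>

lemma gcoeff_linear_form_power:
  assumes "finite I" and q: "\<And>i. q i = (if i \<in> I then a i else 0)"
  shows "gcoeff ((\<Sum>i\<in>I. a i *\<^sub>R Var i) ^ N) x = (if mdeg x = N then fact N * monom_at x q else 0)"
proof (induct N arbitrary: x)
  case 0
  have "lookup (1 :: 'a rpoly) x = (if x = 0 then 1 else 0)" by (simp add: lookup_one when_def)
  moreover have "mfact (0 :: 'a \<Rightarrow>\<^sub>0 nat) = 1" by (simp add: mfact_def)
  ultimately show ?case by (simp add: gcoeff_def)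
next
  case (Suc N)
  let ?Q = "(\<Sum>i\<in>I. a i *\<^sub>R Var i) ^ N"
  have "(\<Sum>i\<in>I. a i *\<^sub>R Var i) ^ Suc N = (\<Sum>i\<in>I. a i *\<^sub>R (Var i * ?Q))"
    by (simp add: scaleR_conv_mult sum_distrib_right mult.assoc)
  then have "gcoeff ((\<Sum>i\<in>I. a i *\<^sub>R Var i) ^ Suc N) x =
      (\<Sum>i\<in>I. a i * (real (lookup x i) * gcoeff ?Q (x - evar i)))"
    by (simp only: gcoeff_sum gcoeff_scaleR gcoeff_Var_mult)
  also have "\<dots> = (\<Sum>i\<in>I. if mdeg x = Suc N then fact N * monom_at x q * real (lookup x i) else 0)"
  proof (rule sum.cong[OF refl])
    fix i assume i: "i \<in> I"
    show "a i * (real (lookup x i) * gcoeff ?Q (x - evar i)) =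
        (if mdeg x = Suc N then fact N * monom_at x q * real (lookup x i) else 0)"
    proof (cases "lookup x i = 0")
      case False
      define w where "w = x - evar i"
      have x: "x = w + evar i" unfolding w_def using False
        by (intro poly_mapping_eqI) (auto simp: lookup_add lookup_minus lookup_single when_def)
      have "mdeg x = Suc (mdeg w)" "monom_at x q = monom_at w q * a i"
        unfolding x by (simp_all add: mdeg_add monom_at_add q i)
      moreover have "x - evar i = w" by (simp add: w_def)
      ultimately show ?thesis using Suc[of w] by simp
    qed simp
  qed
  also have "\<dots> = (if mdeg x = Suc N then fact N * (monom_at x q * real (\<Sum>i\<in>I. lookup x i)) else 0)"
    by (simp add: sum_distrib_left mult.assoc)
  \<comment> \<open>If the support of \<open>x\<close> leaves \<open>I\<close>, both sides are 0;
    otherwise the exponents on \<open>I\<close> add up to the degree.\<close>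
  also have "monom_at x q * real (\<Sum>i\<in>I. lookup x i) = monom_at x q * real (mdeg x)"
  proof (cases "keys x \<subseteq> I")
    case True then show ?thesis using mdeg_superset[OF assms(1)] by simp
  next
    case False
    then obtain j where "j \<in> keys x" "j \<notin> I" by blast
    then have "monom_at x q = 0" by (intro monom_at_zero[of j]) (simp_all add: q)
    then show ?thesis by simp
  qed
  finally show ?case by (simp add: mult_ac)
qed

lemma (in multifan) gcoeff_volume_polynomial:
  "gcoeff (volume_polynomial \<omega> lam v) x = (if mdeg x = CARD('n) then moment v x else 0)"
proof -
  have 1: "gcoeff ((\<Sum>i\<in>I. coord lam v I i *\<^sub>R Var i) ^ CARD('n)) x =
      (if mdeg x = CARD('n) then fact CARD('n) * monom_at x (pt v I) else 0)"
    if "I \<in> keys \<omega>" for I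
    by (rule gcoeff_linear_form_power) (use support_facet(3)[OF that] in \<open>auto simp: pt_def\<close>)
  have "gcoeff (volume_polynomial \<omega> lam v) x = (1 / fact CARD('n)) * (\<Sum>I\<in>keys \<omega>.
      wt v I * gcoeff ((\<Sum>i\<in>I. coord lam v I i *\<^sub>R Var i) ^ CARD('n)) x)"
    by (simp only: volume_polynomial_def gcoeff_scaleR gcoeff_sum wt_def)
  also have "\<dots> = (1 / fact CARD('n)) * (\<Sum>I\<in>keys \<omega>.
      wt v I * (if mdeg x = CARD('n) then fact CARD('n) * monom_at x (pt v I) else 0))"
    using 1 by simp
  also have "\<dots> = (if mdeg x = CARD('n) then moment v x else 0)"
    by (simp add: moment_def mult.left_commute[of _ "fact CARD('n)"] flip: sum_distrib_left)
  finally show ?thesis .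
qed

section \<open>The dimension of a graded component\<close>

lemma diff_ops_simps [simp]:
  "mult (diff_ops M) = (*)" "one (diff_ops M) = 1" "zero (diff_ops M) = 0" "add (diff_ops M) = (+)"
  by (simp_all add: diff_ops_def)

lemma carrier_coords: "carrier (diff_ops M) = coords {m. keys m \<subseteq> M}"
  by (auto simp: coords_def diff_ops_def)

lemma subspace_carrier: "subspace (carrier (diff_ops M))"
  unfolding carrier_coords by (rule subspace_coords)

lemma ring_diff_ops: "ring (diff_ops M)"
proof (rule ringI)
  let ?R = "diff_ops M"
  show "abelian_group ?R"
  proof (rule abelian_groupI)
    fix x y assume x: "x \<in> carrier ?R"
    then show "\<exists>y\<in>carrier ?R. y \<oplus>\<^bsub>?R\<^esub> x = \<zero>\<^bsub>?R\<^esub>"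
      using subspace_neg[OF subspace_carrier] by (intro bexI[of _ "- x"]) simp_all
    assume "y \<in> carrier ?R"
    then show "x \<oplus>\<^bsub>?R\<^esub> y \<in> carrier ?R" using x subspace_add[OF subspace_carrier] by simp
  qed (simp_all add: add.assoc add.commute subspace_0[OF subspace_carrier])
  show "monoid ?R"
  proof (rule monoidI)
    fix x y assume xy: "x \<in> carrier ?R" "y \<in> carrier ?R"
    have "keys m \<subseteq> M" if m: "m \<in> keys (x * y)" for m
    proof -
      obtain a b where ab: "m = a + b" "a \<in> keys x" "b \<in> keys y"
        using keys_mult[of x y] m by blast
      then have "keys a \<subseteq> M" "keys b \<subseteq> M"
        using xy unfolding carrier_coords coords_def by blast+
      then show ?thesis by (simp add: ab(1) keys_add_nat)
    qed
    then show "x \<otimes>\<^bsub>?R\<^esub> y \<in> carrier ?R" unfolding carrier_coords coords_def by auto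
  next
    show "\<one>\<^bsub>?R\<^esub> \<in> carrier ?R" by (simp add: carrier_coords coords_def)
  qed (simp_all add: mult.assoc)
qed (simp_all add: distrib_left distrib_right)

lemma subspace_Ann: "subspace (Ann M P)"
  unfolding Ann_def carrier_coords
  by (rule subspace_kernel_on[OF linear_apply_op subspace_coords])

text \<open>In divided powers, multiplying the operator by a monomial only shifts the index of the
  coefficients, so their vanishing for all indices persists.\<close>

lemma apply_op_mult_zero:
  assumes "apply_op D P = 0"
  shows "apply_op (E * D) P = 0"
proof (rule gcoeff_eqI)
  fix x
  have 0: "lin_ext (\<lambda>y. gcoeff P (w + y)) D = 0" for w
    using assms gcoeff_apply_op[of D P w] by simp
  have "E * D = (\<Sum>a\<in>keys E. lookup E a *\<^sub>R (single a 1 * D))"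
    by (subst single_sum[of E])
      (simp add: sum_distrib_right scaleR_conv_mult Const_def mult_single flip: mult.assoc)
  then have "lin_ext (\<lambda>y. gcoeff P (x + y)) (E * D) = (\<Sum>a\<in>keys E.
      lookup E a *\<^sub>R lin_ext (\<lambda>y. gcoeff P (x + y)) (single a 1 * D))"
    by (simp add: linear_sum[OF linear_lin_ext] linear_scale[OF linear_lin_ext])
  also have "\<dots> = 0"
  proof (intro sum.neutral ballI)
    fix a
    have "single a 1 * D =
        (\<Sum>b\<in>keys D. lookup D b *\<^sub>R basis_elem (a + b))"
      by (subst (1) single_sum[of D]) (simp add: sum_distrib_left mult_single)
    then have "lin_ext (\<lambda>y. gcoeff P (x + y)) (single a 1 * D) =
        (\<Sum>b\<in>keys D. lookup D b *\<^sub>R lin_ext (\<lambda>y. gcoeff P (x + y)) (basis_elem (a + b)))"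
      by (simp only: linear_sum[OF linear_lin_ext] linear_scale[OF linear_lin_ext])
    also have "\<dots> = lin_ext (\<lambda>y. gcoeff P ((x + a) + y)) D"
      by (simp add: lin_ext_def[of _ D] add.assoc)
    finally show "lookup E a *\<^sub>R lin_ext (\<lambda>y. gcoeff P (x + y)) (single a 1 * D) = 0"
      using 0 by simp
  qed
  finally show "gcoeff (apply_op (E * D) P) x = gcoeff 0 x"
    by (simp add: gcoeff_apply_op)
qed

lemma a_inv_diff_ops: "x \<in> carrier (diff_ops M) \<Longrightarrow> \<ominus>\<^bsub>diff_ops M\<^esub> x = - x"
proof -
  interpret ring "diff_ops M" by (rule ring_diff_ops)
  assume x: "x \<in> carrier (diff_ops M)"
  have "- x \<in> carrier (diff_ops M)"
    using x by (rule subspace_neg[OF subspace_carrier])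
  then show ?thesis using x by (intro minus_equality) simp_all
qed

lemma ideal_Ann: "ideal (Ann M P) (diff_ops M)"
proof (rule idealI[OF ring_diff_ops])
  interpret ring "diff_ops M" by (rule ring_diff_ops)
  show "subgroup (Ann M P) (add_monoid (diff_ops M))"
  proof (rule add.subgroupI)
    show "Ann M P \<subseteq> carrier (diff_ops M)" by (auto simp: Ann_def)
    show "Ann M P \<noteq> {}" using subspace_0[OF subspace_Ann] by blast
    fix a assume a: "a \<in> Ann M P"
    then show "\<ominus>\<^bsub>diff_ops M\<^esub> a \<in> Ann M P"
      using subspace_neg[OF subspace_Ann] a_inv_diff_ops[of a M] by (simp add: Ann_def)
    fix b assume "b \<in> Ann M P"
    then show "a \<oplus>\<^bsub>diff_ops M\<^esub> b \<in> Ann M P" using a subspace_add[OF subspace_Ann] by simp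
  qed
  fix a x assume a: "a \<in> Ann M P" and x: "x \<in> carrier (diff_ops M)"
  have ac: "a \<in> carrier (diff_ops M)" and 0: "apply_op a P = 0" using a by (auto simp: Ann_def)
  show "x \<otimes>\<^bsub>diff_ops M\<^esub> a \<in> Ann M P"
    using m_closed[OF x ac] apply_op_mult_zero[OF 0] by (simp add: Ann_def)
  then show "a \<otimes>\<^bsub>diff_ops M\<^esub> x \<in> Ann M P" by (simp add: mult.commute)
qed

lemma Ann_coset_eq:
  assumes "x \<in> carrier (diff_ops M)" "y \<in> carrier (diff_ops M)"
  shows "Ann M P +>\<^bsub>diff_ops M\<^esub> x = Ann M P +>\<^bsub>diff_ops M\<^esub> y \<longleftrightarrow> apply_op x P = apply_op y P"
proof -
  interpret ring "diff_ops M" by (rule ring_diff_ops)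
  have "x - y \<in> carrier (diff_ops M)"
    using assms by (rule subspace_diff[OF subspace_carrier])
  moreover have "x \<ominus>\<^bsub>diff_ops M\<^esub> y = x - y"
    using assms by (simp add: a_minus_def a_inv_diff_ops)
  ultimately have "x \<ominus>\<^bsub>diff_ops M\<^esub> y \<in> Ann M P \<longleftrightarrow> apply_op x P = apply_op y P"
    by (simp add: Ann_def linear_diff[OF linear_apply_op, of _ _ P])
  then show ?thesis
    using quotient_eq_iff_same_a_r_cos[OF ideal_Ann assms] by simp
qed

text \<open>\<open>ring.dimension\<close> is generated by adjoining one vector at a time, which
  dictates an induction over \<open>B\<close>. Independence modulo the annihilator is phrased
  through the action on \<open>P\<close>.\<close>

lemma dimension_cosets:
  fixes B :: "'a::linorder rpoly set"
  assumes "finite B" "B \<subseteq> carrier (diff_ops M)"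
    and "\<And>u. (\<Sum>b\<in>B. u b *\<^sub>R apply_op b P) = 0 \<Longrightarrow> \<forall>b\<in>B. u b = 0"
  shows "ring.dimension (diff_ops M Quot Ann M P) (card B)
    (range (\<lambda>r. Ann M P +>\<^bsub>diff_ops M\<^esub> Const r))
    (range (\<lambda>u. Ann M P +>\<^bsub>diff_ops M\<^esub> (\<Sum>b\<in>B. u b *\<^sub>R b)))"
  using assms
proof (induct B rule: finite_induct)
  let ?R = "diff_ops M" let ?J = "Ann M P" let ?A = "?R Quot ?J"
  let ?K = "range (\<lambda>r. ?J +>\<^bsub>?R\<^esub> Const r)"
  interpret R: ring ?R by (rule ring_diff_ops)
  interpret J: ideal ?J ?R by (rule ideal_Ann)
  interpret A: ring ?A by (rule J.quotient_is_ring)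
  {
    case empty
    have "\<zero>\<^bsub>?A\<^esub> = ?J +>\<^bsub>?R\<^esub> 0"
      using J.a_rcos_const[of 0] subspace_0[OF subspace_Ann, of M P] by (simp add: FactRing_def)
    then have "range (\<lambda>u. ?J +>\<^bsub>?R\<^esub> (\<Sum>b\<in>{}. u b *\<^sub>R b)) = {\<zero>\<^bsub>?A\<^esub>}" by auto
    then show ?case using A.zero_dim by simp
  next
    case (insert v B)
    let ?E = "range (\<lambda>u. ?J +>\<^bsub>?R\<^esub> (\<Sum>b\<in>B. u b *\<^sub>R b))"
    have Bc: "B \<subseteq> carrier ?R" and vc: "v \<in> carrier ?R" using insert.prems(1) by auto
    have comb: "(\<Sum>b\<in>B. u b *\<^sub>R b) \<in> carrier ?R" for u
      using Bc by (intro subspace_sum subspace_scale subspace_carrier) auto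
    have IH: "A.dimension (card B) ?K ?E"
    proof (rule insert.hyps(3)[OF Bc])
      fix u assume 0: "(\<Sum>b\<in>B. u b *\<^sub>R apply_op b P) = 0"
      have "(\<Sum>b\<in>insert v B. (u(v := 0)) b *\<^sub>R apply_op b P) = (\<Sum>b\<in>B. (u(v := 0)) b *\<^sub>R apply_op b P)"
        using insert.hyps by simp
      also have "\<dots> = (\<Sum>b\<in>B. u b *\<^sub>R apply_op b P)"
        using insert.hyps(2) by (intro sum.cong refl) auto
      finally have "(\<Sum>b\<in>insert v B. (u(v := 0)) b *\<^sub>R apply_op b P) = 0" using 0 by simp
      then have "\<forall>b\<in>insert v B. (u(v := 0)) b = 0" by (rule insert.prems(2))
      then show "\<forall>b\<in>B. u b = 0" using insert.hyps(2) by (metis fun_upd_apply insertI2)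
    qed
    have hom: "(+>\<^bsub>?R\<^esub>) ?J \<in> ring_hom ?R ?A" by (rule J.rcos_ring_hom)
    have vA: "?J +>\<^bsub>?R\<^esub> v \<in> carrier ?A" by (rule ring_hom_closed[OF hom vc])
    have vE: "?J +>\<^bsub>?R\<^esub> v \<notin> ?E"
    proof
      assume "?J +>\<^bsub>?R\<^esub> v \<in> ?E"
      then obtain u where "?J +>\<^bsub>?R\<^esub> v = ?J +>\<^bsub>?R\<^esub> (\<Sum>b\<in>B. u b *\<^sub>R b)" by blast
      then have eq: "apply_op v P = (\<Sum>b\<in>B. u b *\<^sub>R apply_op b P)"
        using Ann_coset_eq[OF vc comb]
        by (simp add: linear_sum[OF linear_apply_op[of P]] linear_scale[OF linear_apply_op[of P]])
      let ?u = "\<lambda>b. if b = v then 1 else - u b"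
      have "(\<Sum>b\<in>insert v B. ?u b *\<^sub>R apply_op b P) = apply_op v P + (\<Sum>b\<in>B. ?u b *\<^sub>R apply_op b P)"
        using insert.hyps by simp
      also have "(\<Sum>b\<in>B. ?u b *\<^sub>R apply_op b P) = (\<Sum>b\<in>B. - (u b *\<^sub>R apply_op b P))"
        using insert.hyps(2) by (intro sum.cong refl) auto
      finally have "(\<Sum>b\<in>insert v B. ?u b *\<^sub>R apply_op b P) = 0" by (simp add: eq sum_negf)
      then have "\<forall>b\<in>insert v B. ?u b = 0" by (rule insert.prems(2))
      then show False by simp
    qed
    have Cc: "Const r \<in> carrier ?R" for r
    proof -
      have "Const r \<in> coords {m. keys m \<subseteq> M}"
        unfolding Const_def by (rule single_in_coords) simp
      then show ?thesis by (simp only: carrier_coords)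
    qed
    have step: "(?J +>\<^bsub>?R\<^esub> Const r) \<otimes>\<^bsub>?A\<^esub> (?J +>\<^bsub>?R\<^esub> v) \<oplus>\<^bsub>?A\<^esub> (?J +>\<^bsub>?R\<^esub> (\<Sum>b\<in>B. u b *\<^sub>R b)) =
        ?J +>\<^bsub>?R\<^esub> (\<Sum>b\<in>insert v B. (u(v := r)) b *\<^sub>R b)" for r u
    proof -
      have "(\<Sum>b\<in>insert v B. (u(v := r)) b *\<^sub>R b) = r *\<^sub>R v + (\<Sum>b\<in>B. (u(v := r)) b *\<^sub>R b)"
        using insert.hyps by simp
      also have "(\<Sum>b\<in>B. (u(v := r)) b *\<^sub>R b) = (\<Sum>b\<in>B. u b *\<^sub>R b)"
        using insert.hyps(2) by (intro sum.cong refl) auto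
      finally have "(\<Sum>b\<in>insert v B. (u(v := r)) b *\<^sub>R b) = Const r \<otimes>\<^bsub>?R\<^esub> v \<oplus>\<^bsub>?R\<^esub> (\<Sum>b\<in>B. u b *\<^sub>R b)"
        by (simp add: scaleR_conv_mult)
      then show ?thesis
        using ring_hom_add[OF hom R.m_closed[OF Cc vc] comb] ring_hom_mult[OF hom Cc vc] by metis
    qed
    have "A.line_extension ?K (?J +>\<^bsub>?R\<^esub> v) ?E =
        range (\<lambda>u. ?J +>\<^bsub>?R\<^esub> (\<Sum>b\<in>insert v B. u b *\<^sub>R b))"
    proof (intro subset_antisym subsetI)
      fix w assume "w \<in> A.line_extension ?K (?J +>\<^bsub>?R\<^esub> v) ?E"
      then obtain r u where "w = (?J +>\<^bsub>?R\<^esub> Const r) \<otimes>\<^bsub>?A\<^esub> (?J +>\<^bsub>?R\<^esub> v) \<oplus>\<^bsub>?A\<^esub> (?J +>\<^bsub>?R\<^esub> (\<Sum>b\<in>B. u b *\<^sub>R b))"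
        unfolding A.line_extension_def set_add_def' r_coset_def by blast
      then show "w \<in> range (\<lambda>u. ?J +>\<^bsub>?R\<^esub> (\<Sum>b\<in>insert v B. u b *\<^sub>R b))"
        unfolding step by blast
    next
      fix w assume "w \<in> range (\<lambda>u. ?J +>\<^bsub>?R\<^esub> (\<Sum>b\<in>insert v B. u b *\<^sub>R b))"
      then obtain u where "w = ?J +>\<^bsub>?R\<^esub> (\<Sum>b\<in>insert v B. u b *\<^sub>R b)" by blast
      then have "w = (?J +>\<^bsub>?R\<^esub> Const (u v)) \<otimes>\<^bsub>?A\<^esub> (?J +>\<^bsub>?R\<^esub> v) \<oplus>\<^bsub>?A\<^esub> (?J +>\<^bsub>?R\<^esub> (\<Sum>b\<in>B. u b *\<^sub>R b))"
        using step[of "u v" u] by simp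
      then show "w \<in> A.line_extension ?K (?J +>\<^bsub>?R\<^esub> v) ?E"
        unfolding A.line_extension_def set_add_def' r_coset_def by blast
    qed
    then show ?case
      using A.Suc_dim[OF vA vE IH] insert.hyps by simp
  }
qed

lemma homogeneous_carrier:
  "{D \<in> carrier (diff_ops M). homogeneous (2 * j) D} = coords (mons M j)"
  by (auto simp: carrier_coords homogeneous_def monom_degree_mdeg coords_def mons_def)

text \<open>Applying operators to the volume polynomial identifies the component with the space of
  its derivatives of order \<open>j\<close>; a basis of that space is lifted to operators.\<close>

lemma multifan_dimension_dim:
  fixes M :: "'a::linorder set" and lam :: "'a \<Rightarrow> real ^ 'n::{finite,linorder}"
  assumes "finite M"
  shows "multifan_dimension M \<omega> lam v (2 * j)
    (dim ((\<lambda>D. apply_op D (volume_polynomial \<omega> lam v)) ` coords (mons M j)))"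
proof -
  let ?V = "volume_polynomial \<omega> lam v" let ?R = "diff_ops M" let ?J = "Ann M ?V"
  let ?f = "\<lambda>D. apply_op D ?V"
  let ?D = "coords (mons M j)"
  have fD: "fin_dim ?D" by (rule fin_dim_coords[OF finite_mons[OF assms]])
  have Dc: "?D \<subseteq> carrier ?R" by (auto simp: carrier_coords coords_def mons_def)
  obtain C where C: "finite C" "C \<subseteq> ?f ` ?D" "independent C" "?f ` ?D \<subseteq> span C" "card C = dim (?f ` ?D)"
    using fin_dim_basis[OF fin_dim_image[OF linear_apply_op fD]] by blast
  then have "\<forall>c\<in>C. \<exists>b\<in>?D. ?f b = c" by blast
  then obtain g where g: "\<And>c. c \<in> C \<Longrightarrow> g c \<in> ?D \<and> ?f (g c) = c" by metis
  define B where "B = g ` C"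
  have inj: "inj_on g C" by (rule inj_on_inverseI[of _ ?f]) (use g in simp)
  have B: "finite B" "B \<subseteq> ?D" "card B = dim (?f ` ?D)"
    using C g card_image[OF inj] by (auto simp: B_def)
  have fsum: "?f (\<Sum>b\<in>B. u b *\<^sub>R b) = (\<Sum>c\<in>C. u (g c) *\<^sub>R c)" for u
  proof -
    have "?f (\<Sum>b\<in>B. u b *\<^sub>R b) = (\<Sum>b\<in>B. u b *\<^sub>R ?f b)"
      by (simp add: linear_sum[OF linear_apply_op[of ?V]] linear_scale[OF linear_apply_op[of ?V]])
    also have "\<dots> = (\<Sum>c\<in>C. u (g c) *\<^sub>R c)"
      unfolding B_def sum.reindex[OF inj] o_def using g by (intro sum.cong refl) simp
    finally show ?thesis .
  qed
  have "\<forall>b\<in>B. u b = 0" if "(\<Sum>b\<in>B. u b *\<^sub>R ?f b) = 0" for u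
  proof -
    have "(\<Sum>c\<in>C. u (g c) *\<^sub>R c) = 0"
      using fsum[of u] that by (simp add: linear_sum[OF linear_apply_op[of ?V]] linear_scale[OF linear_apply_op[of ?V]])
    then have "\<forall>c\<in>C. u (g c) = 0" using independentD[OF C(3,1) subset_refl, where u = "\<lambda>c. u (g c)"] by blast
    then show ?thesis by (simp add: B_def)
  qed
  then have dimB: "ring.dimension (?R Quot ?J) (card B) (range (\<lambda>r. ?J +>\<^bsub>?R\<^esub> Const r))
      (range (\<lambda>u. ?J +>\<^bsub>?R\<^esub> (\<Sum>b\<in>B. u b *\<^sub>R b)))"
    using B Dc by (intro dimension_cosets) auto
  have comb: "(\<Sum>b\<in>B. u b *\<^sub>R b) \<in> ?D" for u
    using B(2) by (intro subspace_sum subspace_scale subspace_coords) auto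
  have "(\<lambda>D. ?J +>\<^bsub>?R\<^esub> D) ` ?D = range (\<lambda>u. ?J +>\<^bsub>?R\<^esub> (\<Sum>b\<in>B. u b *\<^sub>R b))"
  proof (intro subset_antisym subsetI)
    fix w assume "w \<in> (\<lambda>D. ?J +>\<^bsub>?R\<^esub> D) ` ?D"
    then obtain D where D: "D \<in> ?D" "w = ?J +>\<^bsub>?R\<^esub> D" by blast
    then have "?f D \<in> span C" using C(4) by blast
    then obtain u where u: "?f D = (\<Sum>c\<in>C. u c *\<^sub>R c)" using C(1) by (auto simp: span_finite)
    have "(\<Sum>c\<in>C. u (?f (g c)) *\<^sub>R c) = (\<Sum>c\<in>C. u c *\<^sub>R c)" using g by (intro sum.cong refl) simp
    then have "?f D = ?f (\<Sum>b\<in>B. u (?f b) *\<^sub>R b)" unfolding fsum using u by simp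
    then have "w = ?J +>\<^bsub>?R\<^esub> (\<Sum>b\<in>B. u (?f b) *\<^sub>R b)"
      using Ann_coset_eq[of D M "\<Sum>b\<in>B. u (?f b) *\<^sub>R b" ?V] D Dc comb[of "\<lambda>b. u (?f b)"] by blast
    then show "w \<in> range (\<lambda>u. ?J +>\<^bsub>?R\<^esub> (\<Sum>b\<in>B. u b *\<^sub>R b))"
      by (intro range_eqI[where x = "\<lambda>b. u (?f b)"])
  next
    fix w assume "w \<in> range (\<lambda>u. ?J +>\<^bsub>?R\<^esub> (\<Sum>b\<in>B. u b *\<^sub>R b))"
    then show "w \<in> (\<lambda>D. ?J +>\<^bsub>?R\<^esub> D) ` ?D" using comb by blast
  qed
  then show ?thesis
    using dimB unfolding multifan_dimension_def multifan_algebra_def multifan_scalars_def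
      multifan_component_def multifan_ann_def homogeneous_carrier B(3) by simp
qed

section \<open>General position\<close>

lemma avoid_negligible:
  assumes "finite \<F>" "\<And>S. S \<in> \<F> \<Longrightarrow> negligible (S :: (real ^ 'n) set)"
  shows "\<exists>x. \<forall>S\<in>\<F>. x \<notin> S"
proof -
  have "negligible (\<Union>\<F>)" using assms by (rule negligible_Union)
  then have "\<Union>\<F> \<noteq> UNIV" using non_negligible_UNIV by metis
  then show ?thesis by blast
qed

lemma proper_subspace_negligible:
  fixes S :: "(real ^ 'n) set"
  assumes "subspace S" "S \<noteq> UNIV"
  shows "negligible S"
proof (rule negligible_lowdim)
  have "dim S \<noteq> DIM(real ^ 'n)" using assms dim_eq_full span_eq_iff by blast
  then show "dim S < DIM(real ^ 'n)" using dim_subset_UNIV[of S] by simp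
qed

text \<open>Greedy choice: each new vector avoids finitely many proper subspaces, which are
  negligible. One sequence serves all \<open>A \<tau>\<close> and all its initial segments at
  once.\<close>

lemma general_position:
  fixes A :: "'i \<Rightarrow> (real ^ 'n) set"
  assumes "finite \<T>"
  shows "\<exists>l :: nat \<Rightarrow> real ^ 'n. \<forall>\<tau>\<in>\<T>. \<forall>s. min CARD('n) (s + dim (A \<tau>)) \<le> dim (l ` {..<s} \<union> A \<tau>)"
proof -
  have "\<exists>l :: nat \<Rightarrow> real ^ 'n. \<forall>s<N. \<forall>\<tau>\<in>\<T>. span (l ` {..<s} \<union> A \<tau>) \<noteq> UNIV \<longrightarrow>
      l s \<notin> span (l ` {..<s} \<union> A \<tau>)" for N
  proof (induct N)
    case (Suc N)
    then obtain l :: "nat \<Rightarrow> real ^ 'n" where l: "\<forall>s<N. \<forall>\<tau>\<in>\<T>. span (l ` {..<s} \<union> A \<tau>) \<noteq> UNIV \<longrightarrow>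
      l s \<notin> span (l ` {..<s} \<union> A \<tau>)" by blast
    let ?F = "{S \<in> (\<lambda>\<tau>. span (l ` {..<N} \<union> A \<tau>)) ` \<T>. S \<noteq> UNIV}"
    have "\<exists>x. \<forall>S\<in>?F. x \<notin> S"
      using assms by (intro avoid_negligible) (auto intro: proper_subspace_negligible)
    then obtain x where x: "\<forall>S\<in>?F. x \<notin> S" by blast
    have im: "(l(N := x)) ` {..<s} = l ` {..<s}" if "s \<le> N" for s
      using that by (intro image_cong) auto
    have "\<forall>s<Suc N. \<forall>\<tau>\<in>\<T>. span ((l(N := x)) ` {..<s} \<union> A \<tau>) \<noteq> UNIV \<longrightarrow>
      (l(N := x)) s \<notin> span ((l(N := x)) ` {..<s} \<union> A \<tau>)"
    proof (intro allI impI ballI)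
      fix s \<tau> assume s: "s < Suc N" and \<tau>: "\<tau> \<in> \<T>" and ne: "span ((l(N := x)) ` {..<s} \<union> A \<tau>) \<noteq> UNIV"
      have im': "(l(N := x)) ` {..<s} = l ` {..<s}" using s by (intro im) simp
      show "(l(N := x)) s \<notin> span ((l(N := x)) ` {..<s} \<union> A \<tau>)"
      proof (cases "s = N")
        case True then show ?thesis using x \<tau> ne unfolding im' by auto
      next
        case False then show ?thesis using l s \<tau> ne unfolding im' by simp
      qed
    qed
    then show ?case by blast
  qed simp
  then obtain l :: "nat \<Rightarrow> real ^ 'n" where l: "\<forall>s<CARD('n). \<forall>\<tau>\<in>\<T>. span (l ` {..<s} \<union> A \<tau>) \<noteq> UNIV \<longrightarrow>
      l s \<notin> span (l ` {..<s} \<union> A \<tau>)" by blast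
  have "min CARD('n) (s + dim (A \<tau>)) \<le> dim (l ` {..<s} \<union> A \<tau>)" if \<tau>: "\<tau> \<in> \<T>" for s \<tau>
  proof (induct s)
    case 0 then show ?case by simp
  next
    case (Suc s)
    let ?B = "l ` {..<s} \<union> A \<tau>"
    have eq: "l ` {..<Suc s} \<union> A \<tau> = insert (l s) ?B" by (auto simp: lessThan_Suc)
    show ?case
    proof (cases "span ?B = UNIV")
      case True
      then have "span (insert (l s) ?B) = UNIV" using span_mono[of ?B "insert (l s) ?B"] by blast
      then have "dim (insert (l s) ?B) = CARD('n)" by (metis dim_span dim_UNIV DIM_cart DIM_real mult.right_neutral)
      then show ?thesis unfolding eq by simp
    next
      case False
      show ?thesis
      proof (cases "s < CARD('n)")
        case True
        then have "l s \<notin> span ?B" using l \<tau> False by blast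
        then have "dim (insert (l s) ?B) = Suc (dim ?B)" by (simp add: dim_insert)
        then show ?thesis unfolding eq using Suc by simp
      next
        case F: False
        have "CARD('n) \<le> dim ?B" using Suc F by simp
        then have "span ?B = UNIV" using dim_eq_full[of ?B] dim_subset_UNIV[of ?B] by simp
        then show ?thesis using False by simp
      qed
    qed
  qed
  then show ?thesis by blast
qed

lemma subspace_combinations: "subspace (range (\<lambda>a. \<Sum>r<q. a r *\<^sub>R (l r :: 'v::real_vector)))"
proof (rule subspaceI)
  show "0 \<in> range (\<lambda>a. \<Sum>r<q. a r *\<^sub>R l r)" by (rule range_eqI[of _ _ "\<lambda>_. 0"]) simp
  fix x y assume "x \<in> range (\<lambda>a. \<Sum>r<q. a r *\<^sub>R l r)" "y \<in> range (\<lambda>a. \<Sum>r<q. a r *\<^sub>R l r)"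
  then obtain a b where "x = (\<Sum>r<q. a r *\<^sub>R l r)" "y = (\<Sum>r<q. b r *\<^sub>R l r)" by blast
  then show "x + y \<in> range (\<lambda>a. \<Sum>r<q. a r *\<^sub>R l r)"
    by (intro range_eqI[of _ _ "\<lambda>r. a r + b r"]) (simp add: scaleR_add_left sum.distrib)
next
  fix c x assume "x \<in> range (\<lambda>a. \<Sum>r<q. a r *\<^sub>R l r)"
  then obtain a where "x = (\<Sum>r<q. a r *\<^sub>R l r)" by blast
  then show "c *\<^sub>R x \<in> range (\<lambda>a. \<Sum>r<q. a r *\<^sub>R l r)"
    by (intro range_eqI[of _ _ "\<lambda>r. c * a r"]) (simp add: scaleR_sum_right)
qed

text \<open>Let \<open>A \<tau>\<close> consist of the functionals vanishing on the vectors of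
  \<open>\<tau>\<close>; its codimension is \<open>card \<tau>\<close>. By general position the
  first \<open>card \<tau>\<close> vectors span everything together with \<open>A \<tau>\<close>, so
  they restrict to a basis of the functionals on the span of those vectors.\<close>

lemma general_functionals:
  fixes lam :: "'a \<Rightarrow> real ^ 'n"
  assumes fin: "finite \<T>" and \<T>: "\<And>\<tau>. \<tau> \<in> \<T> \<Longrightarrow> finite \<tau> \<and> inj_on lam \<tau> \<and> independent (lam ` \<tau>)"
  shows "\<exists>l :: nat \<Rightarrow> real ^ 'n. \<forall>\<tau>\<in>\<T>. \<forall>i\<in>\<tau>.
    \<exists>a. \<forall>j\<in>\<tau>. (\<Sum>r<card \<tau>. a r * (l r \<bullet> lam j)) = (if j = i then 1 else 0)"
proof -
  define A where "A \<tau> = {\<xi>. \<forall>j\<in>\<tau>. \<xi> \<bullet> lam j = 0}" for \<tau>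
  have sA: "subspace (A \<tau>)" for \<tau> by (auto simp: A_def subspace_def inner_add_left)
  obtain l :: "nat \<Rightarrow> real ^ 'n" where
    l: "\<forall>\<tau>\<in>\<T>. \<forall>s. min CARD('n) (s + dim (A \<tau>)) \<le> dim (l ` {..<s} \<union> A \<tau>)"
    using general_position[OF fin, of A] by blast
  have "\<exists>a. \<forall>j\<in>\<tau>. (\<Sum>r<card \<tau>. a r * (l r \<bullet> lam j)) = (if j = i then 1 else 0)"
    if \<tau>: "\<tau> \<in> \<T>" and i: "i \<in> \<tau>" for \<tau> i
  proof -
    have ft: "finite \<tau>" "inj_on lam \<tau>" "independent (lam ` \<tau>)" using \<T>[OF \<tau>] by auto
    let ?q = "card \<tau>"
    have "dim (span (lam ` \<tau>)) = ?q"
      using dim_span_eq_card_independent[OF ft(3)] card_image[OF ft(2)] by simp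
    moreover have "dim {y \<in> UNIV. \<forall>x\<in>span (lam ` \<tau>). orthogonal x y} + dim (span (lam ` \<tau>)) = dim (UNIV :: (real ^ 'n) set)"
      by (rule dim_subspace_orthogonal_to_vectors) auto
    moreover have "{y \<in> UNIV. \<forall>x\<in>span (lam ` \<tau>). orthogonal x y} \<subseteq> A \<tau>"
      by (auto simp: A_def orthogonal_def inner_commute span_base)
    ultimately have "CARD('n) \<le> ?q + dim (A \<tau>)"
      using dim_subset[of "{y \<in> UNIV. \<forall>x\<in>span (lam ` \<tau>). orthogonal x y}" "A \<tau>"] by simp
    then have "CARD('n) \<le> dim (l ` {..<?q} \<union> A \<tau>)" using l \<tau> by (metis min.absorb1)
    then have "span (l ` {..<?q} \<union> A \<tau>) = UNIV"
      using dim_eq_full[of "l ` {..<?q} \<union> A \<tau>"] dim_subset_UNIV[of "l ` {..<?q} \<union> A \<tau>"] by simp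
    obtain \<xi> where \<xi>: "\<And>j. j \<in> \<tau> \<Longrightarrow> \<xi> \<bullet> lam j = (if j = i then 1 else 0)"
      by (rule dual_vector[OF ft(2,3) i]) blast
    have "\<xi> \<in> span (l ` {..<?q} \<union> A \<tau>)" using \<open>span (l ` {..<?q} \<union> A \<tau>) = UNIV\<close> by simp
    then obtain x \<eta> where x: "\<xi> = x + \<eta>" "x \<in> span (l ` {..<?q})" "\<eta> \<in> span (A \<tau>)"
      unfolding span_Un by blast
    have \<eta>: "\<eta> \<in> A \<tau>" using x(3) span_eq_iff[THEN iffD2, OF sA] by simp
    have "l ` {..<?q} \<subseteq> range (\<lambda>a. \<Sum>r<?q. a r *\<^sub>R l r)"
    proof
      fix y assume "y \<in> l ` {..<?q}"
      then obtain s where s: "s < ?q" "y = l s" by blast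
      have "(\<Sum>r<?q. (if r = s then 1 else 0) *\<^sub>R l r) = (\<Sum>r<?q. if r = s then l r else 0)"
        by (intro sum.cong) auto
      then show "y \<in> range (\<lambda>a. \<Sum>r<?q. a r *\<^sub>R l r)"
        using s by (intro range_eqI[of _ _ "\<lambda>r. if r = s then 1 else 0"]) simp
    qed
    then have "x \<in> range (\<lambda>a. \<Sum>r<?q. a r *\<^sub>R l r)"
      using x(2) span_minimal[OF _ subspace_combinations] by blast
    then obtain a where a: "x = (\<Sum>r<?q. a r *\<^sub>R l r)" by blast
    have "(\<Sum>r<?q. a r * (l r \<bullet> lam j)) = (if j = i then 1 else 0)" if "j \<in> \<tau>" for j
    proof -
      have "\<xi> \<bullet> lam j = x \<bullet> lam j" using \<eta> that by (simp add: x(1) A_def inner_add_left)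
      then show ?thesis using \<xi>[OF that] by (simp add: a inner_sum_left)
    qed
    then show ?thesis by blast
  qed
  then show ?thesis by blast
qed

lemma (in multifan) nongeneric_negligible: "negligible {v. \<not> generic \<omega> lam v}"
proof -
  have "negligible {v. coord lam v I i = 0}" if I: "I \<in> keys \<omega>" and i: "i \<in> I" for I i
  proof -
    obtain \<xi> where \<xi>: "\<And>j. j \<in> I \<Longrightarrow> \<xi> \<bullet> lam j = (if j = i then 1 else 0)" by (rule dual_basis[OF I i]) blast
    have "\<xi> \<bullet> v = coord lam v I i" for v
    proof -
      have "\<xi> \<bullet> v = (\<Sum>s\<in>I. if s = i then pt v I s else 0)"
        unfolding pt_inner[OF I, where \<xi> = \<xi> and v = v, symmetric] by (intro sum.cong refl) (simp add: \<xi>)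
      then show ?thesis using i support_facet(3)[OF I] by (simp add: pt_def)
    qed
    moreover have "\<xi> \<noteq> 0" using \<xi>[OF i] by auto
    ultimately show ?thesis using negligible_hyperplane[of \<xi> 0] by simp
  qed
  moreover have "{v. \<not> generic \<omega> lam v} =
      \<Union>((\<lambda>(I, i). {v. coord lam v I i = 0}) ` Sigma (keys \<omega>) id)"
    unfolding generic_def by (auto; blast)
  moreover have "finite (Sigma (keys \<omega>) id)"
    using support_facet(3) by (intro finite_SigmaI) auto
  ultimately show ?thesis by (simp only:) (rule negligible_Union, auto)
qed

section \<open>Smooth vertices\<close>

lemma lookup_cycle_link:
  "lookup (cycle_link \<omega> k) \<sigma> =
    (if k \<in> \<sigma> then 0 else vertex_sign (insert k \<sigma>) k * lookup \<omega> (insert k \<sigma>))"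
proof -
  have "lookup (cycle_link \<omega> k) \<sigma> = (\<Sum>I\<in>{I \<in> keys \<omega>. k \<in> I}.
      if I = insert k \<sigma> then (if k \<in> \<sigma> then 0 else vertex_sign I k * lookup \<omega> I) else 0)"
    unfolding cycle_link_def lookup_sum by (intro sum.cong refl) (auto simp: lookup_single_one)
  also have "\<dots> = (if k \<in> \<sigma> then 0 else vertex_sign (insert k \<sigma>) k * lookup \<omega> (insert k \<sigma>))"
    by (auto simp: in_keys_iff)
  finally show ?thesis .
qed

lemma linear_partial: "linear (partial i)"
proof -
  have "partial i = lin_ext (\<lambda>m. real (lookup m i) *\<^sub>R basis_elem (m - evar i))"
    by (rule ext) (simp add: partial_def lin_ext_def mult.commute)
  then show ?thesis by (simp add: linear_lin_ext)
qed

locale smooth_fan = multifan M \<omega> lam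
  for M :: "'a::linorder set" and \<omega> and lam :: "'a \<Rightarrow> real ^ 'n::{finite,linorder}" +
  fixes k :: 'a and L :: "'a set set" and v :: "real ^ 'n::{finite,linorder}"
  assumes kM: "k \<in> M"
    and sphereL: "homology_sphere (CARD('n) - 1) L"
    and fundL: "fundamental_cycle (CARD('n) - 1) L (cycle_link \<omega> k)"
    and gen: "generic \<omega> lam v"
begin

sublocale S: sphere "CARD('n) - 1" L "cycle_link \<omega> k"
  by unfold_locales (rule sphereL, rule fundL)

lemma Suc_m: "Suc (CARD('n) - 1) = CARD('n)" by simp

text \<open>The coefficient of the link at a facet of \<open>L\<close> is nonzero, which puts the
  cone over the facet into the support of \<open>\<omega>\<close>.\<close>

lemma facet_key:
  assumes "\<sigma> \<in> S.facets"
  shows "k \<notin> \<sigma>" "insert k \<sigma> \<in> keys \<omega>"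
  using S.z_nonzero[OF assms] by (auto simp: lookup_cycle_link in_keys_iff split: if_splits)

lemma key_facet:
  assumes "I \<in> keys \<omega>" "k \<in> I"
  shows "I - {k} \<in> S.facets"
proof -
  have "insert k (I - {k}) = I" using assms(2) by auto
  then have "lookup (cycle_link \<omega> k) (I - {k}) \<noteq> 0"
    using assms(1) by (simp add: lookup_cycle_link in_keys_iff vertex_sign_def)
  then show ?thesis using S.z_facets by (auto simp: coords_def in_keys_iff)
qed

lemma face_key:
  assumes "\<sigma> \<in> L"
  obtains I where "I \<in> keys \<omega>" "insert k \<sigma> \<subseteq> I" "k \<notin> \<sigma>"
proof -
  obtain \<rho> where \<rho>: "\<rho> \<in> L" "\<sigma> \<subseteq> \<rho>" "card \<rho> = CARD('n) - 1" by (rule S.pure[OF assms])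
  then have "\<rho> \<in> S.facets" unfolding S.facets_def by blast
  from facet_key[OF this] show ?thesis using \<rho>(2) by (intro that[of "insert k \<rho>"]) auto
qed

lemma functionals_exist:
  obtains l :: "nat \<Rightarrow> real ^ 'n::{finite,linorder}" where "\<And>\<sigma> i. \<sigma> \<in> L \<Longrightarrow> i \<in> insert k \<sigma> \<Longrightarrow>
      \<exists>a. \<forall>j\<in>insert k \<sigma>. (\<Sum>r<Suc (card \<sigma>). a r * (l r \<bullet> lam j)) = (if j = i then 1 else 0)"
proof -
  have fin: "finite (insert k ` L)" using S.finite_L by simp
  have T: "finite \<tau> \<and> inj_on lam \<tau> \<and> independent (lam ` \<tau>)" if \<tau>: "\<tau> \<in> insert k ` L" for \<tau>
  proof -
    obtain \<sigma> where \<sigma>: "\<sigma> \<in> L" "\<tau> = insert k \<sigma>" using \<tau> by blast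
    obtain I where I: "I \<in> keys \<omega>" "insert k \<sigma> \<subseteq> I" by (rule face_key[OF \<sigma>(1)])
    note K = support_facet[OF I(1)]
    have "finite \<tau>" using K(3) I(2) \<sigma>(2) by (auto intro: finite_subset)
    moreover have "inj_on lam \<tau>" using inj_on_subset[OF K(4) I(2)] \<sigma>(2) by simp
    moreover have "independent (lam ` \<tau>)" using K(5) I(2) \<sigma>(2) by (metis image_mono independent_mono)
    ultimately show ?thesis by blast
  qed
  obtain l :: "nat \<Rightarrow> real ^ 'n::{finite,linorder}" where l: "\<And>\<tau> i. \<tau> \<in> insert k ` L \<Longrightarrow> i \<in> \<tau> \<Longrightarrow>
      \<exists>a. \<forall>j\<in>\<tau>. (\<Sum>r<card \<tau>. a r * (l r \<bullet> lam j)) = (if j = i then 1 else 0)"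
    using general_functionals[OF fin T] by metis
  show ?thesis
  proof (rule that)
    fix \<sigma> i assume \<sigma>: "\<sigma> \<in> L" and i: "i \<in> insert k \<sigma>"
    have "k \<notin> \<sigma>" using face_key[OF \<sigma>] by blast
    then have "card (insert k \<sigma>) = Suc (card \<sigma>)" using S.finite_face[OF \<sigma>] by simp
    then show "\<exists>a. \<forall>j\<in>insert k \<sigma>. (\<Sum>r<Suc (card \<sigma>). a r * (l r \<bullet> lam j)) = (if j = i then 1 else 0)"
      using l[of "insert k \<sigma>" i] \<sigma> i by simp
  qed
qed

abbreviation V :: "'a rpoly" where "V \<equiv> volume_polynomial \<omega> lam v"

lemma gcoeff_V: "gcoeff V x = (if mdeg x = CARD('n) then moment v x else 0)"
  by (rule gcoeff_volume_polynomial)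

lemma moment_low_all: "mdeg x < CARD('n) \<Longrightarrow> moment v x = 0"
proof (cases "keys x \<subseteq> M")
  case True
  assume "mdeg x < CARD('n)"
  then show ?thesis using moment_low[OF gen, of "mdeg x" x] True by (simp add: mons_def)
next
  case False
  then have "\<not> face (keys x)" using support_facet(1) by (auto simp: face_def)
  then show ?thesis by (rule moment_nonface)
qed

text \<open>The factor \<open>evar k\<close> removes the points with \<open>k \<notin> I\<close>,
  and its value joins the weight. For \<open>mdeg x = CARD('n) - 1\<close> these numbers are the
  divided-power coefficients of the derivative of \<open>V\<close> at \<open>k\<close>.\<close>

lemma moment_link:
  "moment v (x + evar k) = (\<Sum>\<sigma>\<in>S.facets. (wt v (insert k \<sigma>) * pt v (insert k \<sigma>) k) * monom_at x (pt v (insert k \<sigma>)))"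
proof -
  have "moment v (x + evar k) =
      (\<Sum>I\<in>{I \<in> keys \<omega>. k \<in> I}. wt v I * (monom_at x (pt v I) * pt v I k))"
    unfolding moment_def monom_at_add
    by (intro sum.mono_neutral_cong_right) (auto simp: pt_def)
  also have "\<dots> = (\<Sum>\<sigma>\<in>S.facets. wt v (insert k \<sigma>) * (monom_at x (pt v (insert k \<sigma>)) * pt v (insert k \<sigma>) k))"
  proof (rule sum.reindex_bij_witness[of _ "insert k" "\<lambda>I. I - {k}"])
    fix I assume "I \<in> {I \<in> keys \<omega>. k \<in> I}"
    then have I: "I \<in> keys \<omega>" "k \<in> I" by auto
    show "I - {k} \<in> S.facets" by (rule key_facet[OF I])
    show e: "insert k (I - {k}) = I" using I by auto
    show "wt v (insert k (I - {k})) * (monom_at x (pt v (insert k (I - {k}))) * pt v (insert k (I - {k})) k) =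
        wt v I * (monom_at x (pt v I) * pt v I k)" unfolding e ..
  next
    fix \<sigma> assume "\<sigma> \<in> S.facets"
    from facet_key[OF this] show "insert k \<sigma> - {k} = \<sigma>" "insert k \<sigma> \<in> {I \<in> keys \<omega>. k \<in> I}" by auto
  qed
  finally show ?thesis by (simp add: mult_ac)
qed

lemma wt_nz: "I \<in> keys \<omega> \<Longrightarrow> wt v I \<noteq> 0"
proof -
  assume I: "I \<in> keys \<omega>"
  let ?L = "sorted_list_of_set I"
  have "char_det lam I \<noteq> 0"
  proof -
    let ?A = "\<chi> r s. lam (?L ! position (s::'n)) $ r"
    have len: "length ?L = CARD('n)" using support_facet[OF I] by simp
    have "columns ?A = lam ` I"
    proof -
      have "columns ?A = range (\<lambda>s::'n. lam (?L ! position s))"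
        by (auto simp: columns_def column_def vec_eq_iff)
      also have "\<dots> = lam ` (\<lambda>p. ?L ! p) ` range (position :: 'n \<Rightarrow> nat)" by (auto simp: image_image)
      also have "(\<lambda>p. ?L ! p) ` range (position :: 'n \<Rightarrow> nat) = I"
        unfolding range_position len[symmetric] using support_facet(3)[OF I] nth_image[of "length ?L" ?L] by (simp add: lessThan_atLeast0)
      finally show ?thesis .
    qed
    then have "span (columns ?A) = UNIV" using support_facet(6)[OF I] by simp
    then have "invertible ?A"
      unfolding invertible_right_inverse matrix_right_invertible_span_columns span_vec_eq .
    then have "det ?A \<noteq> 0" by (simp add: invertible_det_nz)
    then show ?thesis by (simp add: char_det_def position_def)
  qed
  moreover have "(\<Prod>i\<in>I. coord lam v I i) \<noteq> 0" using coord_nz[OF gen I] support_facet(3)[OF I] by simp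
  ultimately show ?thesis using I by (simp add: wt_def in_keys_iff)
qed

text \<open>These operators will produce exactly the derivatives of \<open>V\<close> killed by
  \<open>partial k\<close>; neither the set nor the facets that it detects involve the vector at
  \<open>k\<close>.\<close>

definition NF :: "nat \<Rightarrow> 'a rpoly set" where
  "NF j = coords {x \<in> mons M j. k \<notin> keys x \<and> keys x \<notin> L}"

lemma gcoeff_apply_basis: "gcoeff (apply_op (basis_elem x) V) y = (if mdeg y + mdeg x = CARD('n) then moment v (y + x) else 0)"
  by (simp add: gcoeff_apply_op gcoeff_V mdeg_add)

text \<open>The vertices other than \<open>k\<close> of a facet of \<open>\<omega>\<close> through
  \<open>k\<close> form a face of \<open>L\<close>, so no facet carries the whole monomial.\<close>

lemma moment_star_nonface:
  assumes "keys x - {k} \<notin> L" "k \<in> keys (y + x)"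
  shows "moment v (y + x) = 0"
proof (rule moment_nonface)
  show "\<not> face (keys (y + x))"
  proof
    assume "face (keys (y + x))"
    then obtain I where I: "I \<in> keys \<omega>" "keys (y + x) \<subseteq> I" by (auto simp: face_def)
    have "k \<in> I" using I(2) assms(2) by blast
    then have "I - {k} \<in> L" using key_facet[OF I(1)] unfolding S.facets_def by blast
    moreover have "keys x - {k} \<subseteq> I - {k}" using I(2) by (auto simp: keys_add_nat)
    ultimately show False using S.face_subset assms(1) by blast
  qed
qed

end

section \<open>The derivative at a smooth vertex\<close>

locale smooth_fan_basis = smooth_fan M \<omega> lam k L v
  for M :: "'a::linorder set" and \<omega> and lam :: "'a \<Rightarrow> real ^ 'n::{finite,linorder}" and k L v +
  fixes l :: "nat \<Rightarrow> real ^ 'n::{finite,linorder}"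
  assumes l: "\<sigma> \<in> L \<Longrightarrow> i \<in> insert k \<sigma> \<Longrightarrow>
      \<exists>a. \<forall>j\<in>insert k \<sigma>. (\<Sum>r<Suc (card \<sigma>). a r * (l r \<bullet> lam j)) = (if j = i then 1 else 0)"
begin

text \<open>The link lives in one dimension less, hence the parameter \<open>CARD('n) - 1\<close>.
  The extra factor \<open>pt v (insert k \<sigma>) k\<close> in the weights supplies one degree, so
  the vanishing of moments below \<open>CARD('n)\<close> becomes orthogonality below
  \<open>CARD('n) - 1\<close>.\<close>

sublocale P: sphere_points "CARD('n) - 1" L "cycle_link \<omega> k" M k "\<lambda>r i. l r \<bullet> lam i"
  "\<lambda>\<sigma>. pt v (insert k \<sigma>)" "\<lambda>\<sigma>. wt v (insert k \<sigma>) * pt v (insert k \<sigma>) k" "\<lambda>r. l r \<bullet> v"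
proof unfold_locales
  show "finite M" "k \<in> M" by (rule finM, rule kM)
  fix \<sigma> i r
  show "\<sigma> \<subseteq> M - {k}" if \<sigma>: "\<sigma> \<in> L"
  proof -
    obtain I where "I \<in> keys \<omega>" "insert k \<sigma> \<subseteq> I" "k \<notin> \<sigma>" by (rule face_key[OF \<sigma>])
    then show ?thesis using support_facet(1)[of I] by blast
  qed
  show "\<sigma> \<in> L \<Longrightarrow> i \<in> insert k \<sigma> \<Longrightarrow>
      \<exists>a. \<forall>j\<in>insert k \<sigma>. (\<Sum>r<Suc (card \<sigma>). a r * (l r \<bullet> lam j)) = (if j = i then 1 else 0)" by (rule l)
  show "pt v (insert k \<sigma>) i = 0" if "i \<notin> insert k \<sigma>" using that by (simp add: pt_def)
  assume \<sigma>: "\<sigma> \<in> S.facets"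
  note I = facet_key[OF \<sigma>]
  show nz: "pt v (insert k \<sigma>) i \<noteq> 0" if "i \<in> insert k \<sigma>" for i
    using coord_nz[OF gen I(2) that] that by (simp add: pt_def)
  show "wt v (insert k \<sigma>) * pt v (insert k \<sigma>) k \<noteq> 0" using wt_nz[OF I(2)] nz[of k] by simp
  show "(\<Sum>i\<in>insert k \<sigma>. (l r \<bullet> lam i) * pt v (insert k \<sigma>) i) = l r \<bullet> v" by (rule pt_inner[OF I(2)])
next
  fix x d assume "x \<in> mons M d" "d < CARD('n) - 1"
  then show "(\<Sum>\<sigma>\<in>S.facets. wt v (insert k \<sigma>) * pt v (insert k \<sigma>) k * monom_at x (pt v (insert k \<sigma>))) = 0"
    unfolding moment_link[symmetric] by (intro moment_low_all) (simp add: mons_def mdeg_add)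
qed

text \<open>By \<open>moment_theta\<close> the coefficients in question are multiples of moments of
  degree \<open>CARD('n) - 1\<close>, which vanish.\<close>

lemma theta_kills: "g \<in> P.D e \<Longrightarrow> apply_op (P.thetaM r g) V = 0"
proof -
  assume g: "g \<in> P.D e"
  have "((\<lambda>D. apply_op D V) \<circ> P.thetaM r) g = 0"
  proof (rule linear_eq_on_coords[OF linear_compose[OF P.linear_thetaM linear_apply_op] linear_zero _ g])
    fix x assume "x \<in> mons M e"
    have "gcoeff (apply_op (P.thetaM r (basis_elem x)) V) y = 0" for y
    proof -
      have "gcoeff (apply_op (P.thetaM r (basis_elem x)) V) y =
          (\<Sum>i\<in>M. (l r \<bullet> lam i) * gcoeff V (y + (x + evar i)))"
        by (simp add: P.thetaM_def gcoeff_apply_op linear_sum[OF linear_lin_ext] linear_scale[OF linear_lin_ext]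
          del: scaleR_single)
      also have "\<dots> = (if Suc (mdeg y + mdeg x) = CARD('n) then
          (\<Sum>i\<in>M. (l r \<bullet> lam i) * moment v ((y + x) + evar i)) else 0)"
        by (simp add: gcoeff_V mdeg_add add.assoc)
      also have "\<dots> = 0"
        unfolding moment_theta using moment_low_all[of "y + x"] by (simp add: mdeg_add)
      finally show ?thesis .
    qed
    then have "apply_op (P.thetaM r (basis_elem x)) V = 0" by (intro gcoeff_eqI) simp
    then show "((\<lambda>D. apply_op D V) \<circ> P.thetaM r) (basis_elem x) = 0" by simp
  qed
  then show ?thesis by simp
qed

text \<open>Of the generators of \<open>T\<close>, the linear forms annihilate \<open>V\<close>, and
  by \<open>moment_star_nonface\<close> so do the nonface monomials divisible by \<open>k\<close>.
  What remains is \<open>NF j\<close>.\<close>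

lemma T_image: "(\<lambda>D. apply_op D V) ` P.T j = (\<lambda>D. apply_op D V) ` NF j"
proof -
  define \<pi> :: "'a rpoly \<Rightarrow> 'a rpoly" where
    "\<pi> = lin_ext (\<lambda>x. if k \<in> keys x then 0 else basis_elem x)"
  have NF: "\<pi> s \<in> NF j" if "s \<in> P.SR j" for s
    unfolding \<pi>_def NF_def
    by (rule lin_ext_in_subspace[OF subspace_coords _ that[unfolded P.SR_def]])
      (auto intro: single_in_coords subspace_0[OF subspace_coords])
  have red: "apply_op s V = apply_op (\<pi> s) V" if s: "s \<in> P.SR j" for s
  proof -
    have "apply_op s V = ((\<lambda>D. apply_op D V) \<circ> \<pi>) s"
    proof (rule linear_eq_on_coords[OF linear_apply_op linear_compose[OF _ linear_apply_op] _ s[unfolded P.SR_def]])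
      show "linear \<pi>" unfolding \<pi>_def by (rule linear_lin_ext)
      fix x assume x: "x \<in> {x \<in> mons M j. keys x - {k} \<notin> L}"
      show "apply_op (basis_elem x) V = ((\<lambda>D. apply_op D V) \<circ> \<pi>) (basis_elem x)"
      proof (cases "k \<in> keys x")
        case True
        have "gcoeff (apply_op (basis_elem x) V) y = 0" for y
          unfolding gcoeff_apply_basis using moment_star_nonface[of x y] x True by (simp add: keys_add_nat)
        then have "apply_op (basis_elem x) V = 0" by (intro gcoeff_eqI) simp
        then show ?thesis using True by (simp add: \<pi>_def linear_0[OF linear_apply_op[of V]])
      qed (simp add: \<pi>_def)
    qed
    then show ?thesis by simp
  qed
  have NF_SR: "NF j \<subseteq> P.SR j" unfolding NF_def P.SR_def coords_def by auto
  have SR_T: "P.SR j \<subseteq> P.T j"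
    using subspace_0[OF graded_module.gideal_subspace[OF P.graded_K, of "Suc (CARD('n) - 1)" j]]
    unfolding P.psi_ker[symmetric] P.T_def by auto
  have T_SR: "\<exists>s\<in>P.SR j. apply_op f V = apply_op s V" if f: "f \<in> P.T j" for f
  proof (cases j)
    case 0 then show ?thesis using f P.T_0 by auto
  next
    case (Suc e)
    obtain g s where gs: "\<And>r. r \<le> CARD('n) - 1 \<Longrightarrow> g r \<in> P.D e" "s \<in> P.SR (Suc e)"
      "f = (\<Sum>r\<le>CARD('n) - 1. P.thetaM r (g r)) + s"
      by (rule P.T_SucE[OF f[unfolded Suc]]) blast
    have "apply_op f V = apply_op s V"
      unfolding gs(3) by (simp add: linear_add[OF linear_apply_op[of V]] linear_sum[OF linear_apply_op[of V]]
        theta_kills[OF gs(1)])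
    then show ?thesis using gs(2) Suc by blast
  qed
  show ?thesis
  proof (intro subset_antisym subsetI)
    fix w assume "w \<in> (\<lambda>D. apply_op D V) ` P.T j"
    then obtain f where "f \<in> P.T j" "w = apply_op f V" by blast
    then obtain s where "s \<in> P.SR j" "w = apply_op s V" using T_SR by metis
    then show "w \<in> (\<lambda>D. apply_op D V) ` NF j" using red[of s] NF[of s] by blast
  qed (use NF_SR SR_T in blast)
qed

text \<open>Vanishing coefficients of the derivative say that \<open>E\<close> pairs to 0 with all
  monomials of complementary degree, so duality on the link applies. Conversely, an element of
  \<open>T j\<close> acts on \<open>V\<close> like nonfaces avoiding \<open>k\<close>, whose effect
  a further derivative at \<open>k\<close> kills.\<close>

lemma annihilator_of_partial:
  assumes "j \<le> CARD('n)"
  shows "{E \<in> P.D j. partial k (apply_op E V) = 0} = P.T j"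
proof (intro subset_antisym subsetI)
  fix E assume "E \<in> {E \<in> P.D j. partial k (apply_op E V) = 0}"
  then have E: "E \<in> P.D j" and 0: "partial k (apply_op E V) = 0" by auto
  show "E \<in> P.T j"
  proof (cases "j = CARD('n)")
    \<comment> \<open>The degree \<open>CARD('n)\<close> lies beyond the range of the duality; there
      \<open>T\<close> contains all forms.\<close>
    case True then show ?thesis using E P.T_top Suc_m by simp
  next
    case False
    then have j: "j \<le> CARD('n) - 1" using assms by simp
    show ?thesis
    proof (rule P.poincare_duality[OF E j])
      fix y assume y: "y \<in> mons M (CARD('n) - 1 - j)"
      have "0 = gcoeff (apply_op E V) (y + evar k)"
        using arg_cong[OF 0, of "\<lambda>P. gcoeff P y"] by (simp add: gcoeff_partial)
      also have "\<dots> = (\<Sum>x\<in>keys E. lookup E x * gcoeff V (y + evar k + x))"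
        by (simp add: gcoeff_apply_op lin_ext_def)
      also have "\<dots> = (\<Sum>x\<in>keys E. lookup E x * moment v ((x + y) + evar k))"
      proof (rule sum.cong[OF refl])
        fix x assume "x \<in> keys E"
        then have mx: "mdeg x = j" using E by (auto simp: coords_def mons_def)
        have my: "mdeg y = CARD('n) - 1 - j" using y unfolding mons_def by blast
        have "mdeg (y + evar k + x) = CARD('n) - 1 - j + 1 + j"
          by (simp only: mdeg_add mdeg_single mx my)
        then have "mdeg (y + evar k + x) = CARD('n)" using j Suc_m by linarith
        moreover have "y + evar k + x = (x + y) + evar k" by (simp add: ac_simps)
        ultimately show "lookup E x * gcoeff V (y + evar k + x) =
            lookup E x * moment v ((x + y) + evar k)" by (simp only: gcoeff_V if_True simp_thms)
      qed
      also have "\<dots> = (\<Sum>\<sigma>\<in>S.facets. wt v (insert k \<sigma>) * pt v (insert k \<sigma>) k *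
          ((\<Sum>x\<in>keys E. lookup E x * monom_at x (pt v (insert k \<sigma>))) * monom_at y (pt v (insert k \<sigma>))))"
        unfolding moment_link monom_at_add sum_distrib_left sum_distrib_right
        by (subst sum.swap) (simp add: mult_ac)
      also have "\<dots> = (\<Sum>\<sigma>\<in>S.facets. wt v (insert k \<sigma>) * pt v (insert k \<sigma>) k *
          (lookup (P.ev E) \<sigma> * monom_at y (pt v (insert k \<sigma>))))"
        by (intro sum.cong refl) (simp only: P.lookup_ev)
      finally show "(\<Sum>\<sigma>\<in>S.facets. wt v (insert k \<sigma>) * pt v (insert k \<sigma>) k *
          (lookup (P.ev E) \<sigma> * monom_at y (pt v (insert k \<sigma>)))) = 0" by simp
    qed
  qed
next
  fix E assume E: "E \<in> P.T j"
  have "apply_op E V \<in> (\<lambda>D. apply_op D V) ` NF j" using E T_image by blast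
  then obtain s where s: "s \<in> NF j" "apply_op E V = apply_op s V" by blast
  have "(partial k \<circ> (\<lambda>D. apply_op D V)) s = 0"
  proof (rule linear_eq_on_coords[OF linear_compose[OF linear_apply_op linear_partial] linear_zero _ s(1)[unfolded NF_def]])
    fix x assume x: "x \<in> {x \<in> mons M j. k \<notin> keys x \<and> keys x \<notin> L}"
    have "gcoeff (partial k (apply_op (basis_elem x) V)) y = 0" for y
      unfolding gcoeff_partial gcoeff_apply_basis
      using moment_star_nonface[of x "y + evar k"] x by (simp add: keys_add_nat)
    then have "partial k (apply_op (basis_elem x) V) = 0" by (intro gcoeff_eqI) simp
    then show "(partial k \<circ> (\<lambda>D. apply_op D V)) (basis_elem x) = 0" by simp
  qed
  then show "E \<in> {E \<in> P.D j. partial k (apply_op E V) = 0}"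
    using E s(2) P.T_D by auto
qed

text \<open>Rank-nullity for \<open>partial k\<close> on the derivatives of order \<open>j\<close>.
  The rank is the codimension of \<open>T j\<close>, a number determined by \<open>L\<close>; the
  kernel comes from \<open>NF j\<close>.\<close>

lemma dim_component:
  assumes "j \<le> CARD('n)"
  shows "int (dim ((\<lambda>D. apply_op D V) ` coords (mons M j))) =
    hilb L CARD('n) j + int (dim ((\<lambda>D. apply_op D V) ` NF j))"
proof -
  let ?f = "\<lambda>D. apply_op D V"
  have lf: "linear ?f" by (rule linear_apply_op)
  have lpf: "linear (partial k \<circ> ?f)" by (rule linear_compose[OF linear_apply_op linear_partial])
  have fD: "fin_dim (P.D j)" by (rule fin_dim_coords[OF P.finite_mons_M])
  have "{Q \<in> ?f ` P.D j. partial k Q = 0} = ?f ` {E \<in> P.D j. partial k (apply_op E V) = 0}" by blast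
  also have "\<dots> = ?f ` NF j" unfolding annihilator_of_partial[OF assms] by (rule T_image)
  finally have ker: "{Q \<in> ?f ` P.D j. partial k Q = 0} = ?f ` NF j" .
  have 1: "dim (?f ` P.D j) = dim (partial k ` ?f ` P.D j) + dim (?f ` NF j)"
    using rank_nullity[OF linear_partial linear_subspace_image[OF lf subspace_coords] fin_dim_image[OF lf fD], of k]
    unfolding ker .
  have 2: "dim (P.D j) = dim ((partial k \<circ> ?f) ` P.D j) + dim (P.T j)"
    using rank_nullity[OF lpf subspace_coords fD] annihilator_of_partial[OF assms] by simp
  have "int (dim (P.D j)) - int (dim (P.T j)) = hilb L CARD('n) j"
    using P.dim_T[of j] Suc_m by simp
  then show ?thesis using 1 2 by (simp add: image_comp)
qed

end

section \<open>Comparison of the two characteristic functions\<close>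

lemma coord_cong:
  assumes "\<And>i. i \<in> I \<Longrightarrow> lam1 i = lam2 i" "i \<in> I"
  shows "coord lam1 v I i = coord lam2 v I i"
proof -
  have "lam1 ` I = lam2 ` I" using assms(1) by (rule image_cong[OF refl])
  then show ?thesis using assms by (simp add: coord_def)
qed

theorem theorem1:
  fixes M :: "'a::linorder set"
    and \<omega> :: "'a set \<Rightarrow>\<^sub>0 real"
    and k :: 'a
    and lam1 lam2 :: "'a \<Rightarrow> real ^ 'n::{finite,linorder}"
    and v1 v2 :: "real ^ 'n::{finite,linorder}"
    and j :: nat
  assumes "finite M"
    and "simplicial_cycle M CARD('n) \<omega>"
    and "k \<in> M"
    and "smooth_vertex CARD('n) \<omega> k"
    and "characteristic_function \<omega> lam1"
    and "characteristic_function \<omega> lam2"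
    and "\<And>i. i \<in> M - {k} \<Longrightarrow> lam1 i = lam2 i"
    and "generic \<omega> lam1 v1"
    and "generic \<omega> lam2 v2"
    and "j \<le> CARD('n)"
  shows "\<exists>d. multifan_dimension M \<omega> lam1 v1 (2 * j) d \<and> multifan_dimension M \<omega> lam2 v2 (2 * j) d"
proof -
  obtain L where L: "homology_sphere (CARD('n) - 1) L" "fundamental_cycle (CARD('n) - 1) L (cycle_link \<omega> k)"
    using assms(4) by (auto simp: smooth_vertex_def)
  interpret F1: smooth_fan M \<omega> lam1 k L v1 by unfold_locales (use assms L in auto)
  interpret F2: smooth_fan M \<omega> lam2 k L v2 by unfold_locales (use assms L in auto)
  let ?f1 = "\<lambda>D. apply_op D F1.V" and ?f2 = "\<lambda>D. apply_op D F2.V"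
  obtain l1 where l1: "\<And>\<sigma> i. \<sigma> \<in> L \<Longrightarrow> i \<in> insert k \<sigma> \<Longrightarrow>
      \<exists>a. \<forall>j\<in>insert k \<sigma>. (\<Sum>r<Suc (card \<sigma>). a r * (l1 r \<bullet> lam1 j)) = (if j = i then 1 else 0)"
    by (rule F1.functionals_exist) blast
  interpret B1: smooth_fan_basis M \<omega> lam1 k L v1 l1 by unfold_locales (rule l1)
  obtain l2 where l2: "\<And>\<sigma> i. \<sigma> \<in> L \<Longrightarrow> i \<in> insert k \<sigma> \<Longrightarrow>
      \<exists>a. \<forall>j\<in>insert k \<sigma>. (\<Sum>r<Suc (card \<sigma>). a r * (l2 r \<bullet> lam2 j)) = (if j = i then 1 else 0)"
    by (rule F2.functionals_exist) blast
  interpret B2: smooth_fan_basis M \<omega> lam2 k L v2 l2 by unfold_locales (rule l2)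
  \<comment> \<open>The moments of degree \<open>CARD('n)\<close> do not change with the generic
    vector, so the comparison may use one that is generic for both characteristic functions.\<close>
  obtain v where v: "generic \<omega> lam1 v" "generic \<omega> lam2 v"
    using avoid_negligible[of "{{v. \<not> generic \<omega> lam1 v}, {v. \<not> generic \<omega> lam2 v}}"]
      F1.nongeneric_negligible F2.nongeneric_negligible by auto
  have moments: "F1.moment v1 (y + x) = F2.moment v2 (y + x)"
    if x: "k \<notin> keys x" "keys x \<notin> L" and d: "mdeg (y + x) = CARD('n)" for x y
  proof (cases "keys (y + x) \<subseteq> M")
    case False
    then have "\<not> F1.face (keys (y + x))" using F1.support_facet(1) by (auto simp: F1.face_def)
    then show ?thesis using F1.moment_nonface F2.moment_nonface by (simp add: F1.face_def F2.face_def)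
  next
    case True
    then have yx: "y + x \<in> mons M CARD('n)" using d by (simp add: mons_def)
    have "F1.moment v (y + x) = F2.moment v (y + x)"
      unfolding F1.moment_def F2.moment_def
    proof (rule sum.cong[OF refl])
      fix I assume I: "I \<in> keys \<omega>"
      show "F1.wt v I * monom_at (y + x) (F1.pt v I) = F2.wt v I * monom_at (y + x) (F2.pt v I)"
      proof (cases "k \<in> I")
        case True
        \<comment> \<open>A facet through \<open>k\<close> containing this support would make the
          support of \<open>x\<close> a face of \<open>L\<close>. So only facets avoiding
          \<open>k\<close> contribute, on which the two functions agree.\<close>
        have "\<not> keys (y + x) \<subseteq> I"
        proof
          assume "keys (y + x) \<subseteq> I"
          then have "keys x \<subseteq> I - {k}" using x(1) by (auto simp: keys_add_nat)
          moreover have "I - {k} \<in> L" using F1.key_facet[OF I True] unfolding F1.S.facets_def by blast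
          ultimately show False using F1.S.face_subset x(2) by blast
        qed
        then show ?thesis by (simp add: F1.monom_at_nonface F2.monom_at_nonface)
      next
        case False
        then have eq: "lam1 i = lam2 i" if "i \<in> I" for i
          using that F1.support_facet(1)[OF I] assms(7) by blast
        have len: "length (sorted_list_of_set I) = CARD('n)" using F1.support_facet[OF I] by simp
        have "char_det lam1 I = char_det lam2 I"
          unfolding char_det_def
        proof (intro arg_cong[where f = det] iffD2[OF vec_eq_iff] allI, simp only: vec_lambda_beta)
          fix r s :: 'n
          have "sorted_list_of_set I ! card {t. t < s} \<in> set (sorted_list_of_set I)"
            using position_less[of s] len by (intro nth_mem) (simp add: position_def)
          then have "sorted_list_of_set I ! card {t. t < s} \<in> I" using F1.support_facet(3)[OF I] by simp
          then show "lam1 (sorted_list_of_set I ! card {t. t < s}) $ r = lam2 (sorted_list_of_set I ! card {t. t < s}) $ r"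
            using eq by simp
        qed
        moreover have "coord lam1 v I i = coord lam2 v I i" if "i \<in> I" for i
          using eq that by (rule coord_cong)
        ultimately have "F1.wt v I = F2.wt v I" "F1.pt v I = F2.pt v I"
          by (auto simp: F1.wt_def F2.wt_def F1.pt_def F2.pt_def fun_eq_iff)
        then show ?thesis by simp
      qed
    qed
    then show ?thesis
      using F1.moment_independent[OF assms(8) v(1) yx] F2.moment_independent[OF assms(9) v(2) yx] by simp
  qed
  have "?f1 s = ?f2 s" if s: "s \<in> F1.NF j" for s
  proof (rule linear_eq_on_coords[OF linear_apply_op linear_apply_op _ s[unfolded F1.NF_def]])
    fix x assume "x \<in> {x \<in> mons M j. k \<notin> keys x \<and> keys x \<notin> L}"
    then have x: "k \<notin> keys x" "keys x \<notin> L" by auto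
    show "?f1 (basis_elem x) = ?f2 (basis_elem x)"
      by (rule gcoeff_eqI)
        (use moments[OF x] in \<open>simp add: F1.gcoeff_apply_basis F2.gcoeff_apply_basis mdeg_add\<close>)
  qed
  moreover have "F1.NF j = F2.NF j" by (simp add: F1.NF_def F2.NF_def)
  ultimately have "?f1 ` F1.NF j = ?f2 ` F2.NF j" by (metis image_cong)
  \<comment> \<open>The term \<open>hilb L CARD('n) j\<close> is the same for both multi-fans, and
    the kernel parts are now equal as sets.\<close>
  then have "dim (?f1 ` coords (mons M j)) = dim (?f2 ` coords (mons M j))"
    using B1.dim_component[OF assms(10)] B2.dim_component[OF assms(10)] by simp
  then show ?thesis
    using multifan_dimension_dim[OF assms(1), of \<omega> lam1 v1 j] multifan_dimension_dim[OF assms(1), of \<omega> lam2 v2 j]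
    by auto
qed

end
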